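(* Let $\gamma\ge 1$ and let $\Theta:\mathbb R^2\to[0,\infty)$ be a measurable function such that (i) $\Theta(tx,ty)=t^\gamma\Theta(x,y)$ for all $x,y\in\mathbb R$ and $t>0$; (ii) there are constants $0<c\le C$ with $c\le\Theta(x,y)\le C$ whenever $x^2+y^2=1$, and $\Theta(x,y)=\Theta(y,x)$ for all $x,y\in\mathbb R$; (iii) there are $\epsilon>0$ and $C>0$ such that $|\Theta(t,1)-\Theta(1,1)|\le C|t-1|$ for $t\in(1-\epsilon,1+\epsilon)$ and $|\Theta(t,-1)-\Theta(-1,-1)|\le C|t+1|$ for $t\in(-1-\epsilon,-1+\epsilon)$. For $\beta>0$ let $\mathbf K_\beta$ be the integral operator on $L^2(\mathbb R)$ with kernel $$K_\beta(x,y)=\frac1\pi\,\frac{1}{1+(x-y)^2+\beta^2\Theta(x,y)},$$ let $\mathsf M_\beta$ be its largest eigenvalue and $\Psi_\beta$ the corresponding normalized, almost everywhere positive eigenfunction. Let $\lambda_1$ be the lowest eigenvalue of the operator $\mathbf A=|D_x|+\frac12\Theta(x,x)$ on $L^2(\mathbb R)$, and $\phi_1$ the corresponding normalized, almost everywhere non-negative eigenfunction. Then $$\lim_{\beta\to0}\beta^{-\frac{2}{\gamma+1}}(1-\mathsf M_\beta)=\lambda_1 .$$ Moreover, with $\alpha=\beta^{\frac{2}{\gamma+1}}$, the rescaled eigenfunctions $x\mapsto\alpha^{-1/2}\Psi_\beta(\alpha^{-1}x)$ converge to $\phi_1$ in the norm of $L^2(\mathbb R)$ as $\beta\to0$.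
   Context: Under (i), (ii) the operator $\mathbf K_\beta$, $(\mathbf K_\beta u)(x)=\int_{\mathbb R}K_\beta(x,y)u(y)\,dy$, is self-adjoint and compact on $L^2(\mathbb R)$, and it is positivity improving; hence its largest eigenvalue is non-degenerate and the normalized eigenfunction $\Psi_\beta$ is uniquely determined by requiring $\Psi_\beta>0$ a.e. The operator $\mathbf A$ is $(\mathbf Au)(x)=(|D_x|u)(x)+\frac12\theta(x)u(x)$, where $\theta(x)=\Theta(x,x)$ and $|D_x|$ is the Fourier multiplier by $|\xi|$, i.e. $\widehat{|D_x|u}(\xi)=|\xi|\hat u(\xi)$ with $\hat u(\xi)=(2\pi)^{-1/2}\int e^{-i\xi x}u(x)\,dx$. It is essentially self-adjoint on $C_0^\infty(\mathbb R)$, self-adjoint on $D(\mathbf A)=H^1(\mathbb R)\cap L^2(\mathbb R,|x|^{2\gamma}dx)$, and has purely discrete spectrum. Its lowest eigenvalue $\lambda_1>0$ is non-degenerate and the eigenfunction $\phi_1$ is chosen non-negative (in fact positive) a.e. "Normalized" means of unit norm in $L^2(\mathbb R)$. *)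

theory Defs
  imports "HOL-Analysis.Analysis"
begin

text \<open>Elements of complex \<open>L\<^sup>2(\<real>)\<close> are represented by functions; nothing below distinguishes
  functions that agree almost everywhere.\<close>

definition L2 :: "(real \<Rightarrow> complex) set" where
  "L2 = {u. u \<in> borel_measurable lebesgue \<and> integrable lebesgue (\<lambda>x. (cmod (u x))\<^sup>2)}"

definition L2_norm :: "(real \<Rightarrow> complex) \<Rightarrow> real" where
  "L2_norm u = sqrt (\<integral>x. (cmod (u x))\<^sup>2 \<partial>lebesgue)"

text \<open>Membership in \<^term>\<open>L2\<close> is required because \<^term>\<open>L2_norm\<close> is 0 on functions whose
  square is not integrable.\<close>

definition L2_tendsto :: "('i \<Rightarrow> real \<Rightarrow> complex) \<Rightarrow> (real \<Rightarrow> complex) \<Rightarrow> 'i filter \<Rightarrow> bool" where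
  "L2_tendsto f u F \<longleftrightarrow> u \<in> L2 \<and> (\<forall>\<^sub>F i in F. f i \<in> L2) \<and>
     ((\<lambda>i. L2_norm (\<lambda>x. f i x - u x)) \<longlongrightarrow> 0) F"

text \<open>\<open>v\<close> is a version of the Fourier transform of \<open>u \<in> L\<^sup>2\<close>. The Fourier integral need not
  converge absolutely, so the transform is the \<open>L\<^sup>2\<close> limit of the truncated integrals.\<close>

definition L2_fourier :: "(real \<Rightarrow> complex) \<Rightarrow> (real \<Rightarrow> complex) \<Rightarrow> bool" where
  "L2_fourier u v \<longleftrightarrow> u \<in> L2 \<and>
     L2_tendsto
       (\<lambda>R \<xi>. complex_of_real (1 / sqrt (2 * pi)) *
               (LINT x:{-R..R}|lebesgue. exp (- \<i> * complex_of_real (\<xi> * x)) * u x))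
       v at_top"

definition H1 :: "(real \<Rightarrow> complex) set" where
  "H1 = {u. \<exists>v. L2_fourier u v \<and> (\<lambda>\<xi>. complex_of_real (sqrt (1 + \<xi>\<^sup>2)) * v \<xi>) \<in> L2}"

text \<open>An operator \<open>T\<close>, possibly unbounded, is given by its graph: \<open>T u f\<close> says that \<open>u\<close> is in
  the domain and \<open>f\<close> is a version of the image of \<open>u\<close>.\<close>

type_synonym operator = "(real \<Rightarrow> complex) \<Rightarrow> (real \<Rightarrow> complex) \<Rightarrow> bool"

definition eigenfunction :: "operator \<Rightarrow> complex \<Rightarrow> (real \<Rightarrow> complex) \<Rightarrow> bool" where
  "eigenfunction T \<mu> u \<longleftrightarrow> T u (\<lambda>x. \<mu> * u x) \<and> \<not> (AE x in lebesgue. u x = 0)"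

definition eigenvalue :: "operator \<Rightarrow> complex \<Rightarrow> bool" where
  "eigenvalue T \<mu> \<longleftrightarrow> (\<exists>u. eigenfunction T \<mu> u)"

text \<open>The next two notions are meant for self-adjoint operators, all of whose eigenvalues are
  real.\<close>

definition largest_eigenvalue :: "operator \<Rightarrow> real \<Rightarrow> bool" where
  "largest_eigenvalue T m \<longleftrightarrow> eigenvalue T (complex_of_real m) \<and>
     (\<forall>\<mu>::real. eigenvalue T (complex_of_real \<mu>) \<longrightarrow> \<mu> \<le> m)"

definition lowest_eigenvalue :: "operator \<Rightarrow> real \<Rightarrow> bool" where
  "lowest_eigenvalue T m \<longleftrightarrow> eigenvalue T (complex_of_real m) \<and>
     (\<forall>\<mu>::real. eigenvalue T (complex_of_real \<mu>) \<longrightarrow> m \<le> \<mu>)"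

definition K_kernel :: "(real \<times> real \<Rightarrow> real) \<Rightarrow> real \<Rightarrow> real \<Rightarrow> real \<Rightarrow> real" where
  "K_kernel \<Theta> \<beta> x y = (1 / pi) * (1 / (1 + (x - y)\<^sup>2 + \<beta>\<^sup>2 * \<Theta> (x, y)))"

definition K_op :: "(real \<times> real \<Rightarrow> real) \<Rightarrow> real \<Rightarrow> operator" where
  "K_op \<Theta> \<beta> u f \<longleftrightarrow> u \<in> L2 \<and> f \<in> L2 \<and>
     (AE x in lebesgue. f x = (\<integral>y. complex_of_real (K_kernel \<Theta> \<beta> x y) * u y \<partial>lebesgue))"

definition abs_D :: operator where
  "abs_D u g \<longleftrightarrow> u \<in> H1 \<and>
     (\<exists>v. L2_fourier u v \<and> L2_fourier g (\<lambda>\<xi>. complex_of_real \<bar>\<xi>\<bar> * v \<xi>))"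

text \<open>The domain is \<open>H\<^sup>1(\<real>) \<inter> L\<^sup>2(\<real>, \<bar>x\<bar>\<^sup>2\<^sup>\<gamma> dx)\<close>.\<close>

definition A_op :: "real \<Rightarrow> (real \<times> real \<Rightarrow> real) \<Rightarrow> operator" where
  "A_op \<gamma> \<Theta> u f \<longleftrightarrow>
     u \<in> H1 \<and> (\<lambda>x. complex_of_real (\<bar>x\<bar> powr \<gamma>) * u x) \<in> L2 \<and> f \<in> L2 \<and>
     (\<exists>g. abs_D u g \<and> (AE x in lebesgue. f x = g x + complex_of_real (\<Theta> (x, x) / 2) * u x))"

end

theory Submission
  imports Defs "HOL-Probability.Sinc_Integral" "HOL-Real_Asymp.Real_Asymp"
begin

text \<open>Let \<open>\<alpha> = \<beta>\<^sup>2\<^sup>/\<^sup>(\<^sup>\<gamma>\<^sup>+\<^sup>1\<^sup>)\<close>. By homogeneity of \<open>\<Theta>\<close>, the substitution \<open>x \<mapsto> x / \<alpha>\<close> turns the operator into the one with kernel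
\<open>K\<^sub>a(x,y) = a / (\<pi> (a\<^sup>2 + (x - y)\<^sup>2 + a\<^sup>3 \<Theta>(x,y)))\<close> at \<open>a = \<alpha>\<close>, and the rescaled eigenfunctions \<open>u > 0\<close> satisfy
\<open>K\<^sub>a u = M u\<close>. For \<open>\<Theta> = 0\<close> this is the Poisson kernel, that is, the operator \<open>P\<^sub>a = exp (- a \<bar>D\<bar>)\<close>; the perturbation
contributes \<open>- a \<Theta>(x,x) / 2\<close> in first order. So formally \<open>K\<^sub>a = 1 - a A + o(a)\<close>, and \<open>(1 - M) / a\<close> should tend to the
lowest eigenvalue of \<open>A\<close>. Three facts make this precise. Write \<open>\<phi>\<close> for the ground state of \<open>A\<close>.

\<^item> On the ground state the expansion holds in norm: \<open>(\<phi> - K\<^sub>a \<phi>) / a \<rightarrow> \<lambda>\<^sub>1 \<phi>\<close> in \<open>L\<^sup>2\<close>. The quotient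
  \<open>(\<phi> - P\<^sub>a \<phi>) / a\<close> is an average of the functions \<open>P\<^sub>s \<bar>D\<bar>\<phi>\<close> over \<open>0 < s < a\<close> and tends to \<open>\<bar>D\<bar>\<phi>\<close>
  (lemmas \<open>abs_D_semigroup\<close> and \<open>poisson_generator_limit\<close>). The kernel of \<open>(P\<^sub>a - K\<^sub>a) / a\<close> concentrates on the diagonal at
  scale \<open>a\<close> and has mass \<open>\<Theta>(x,x) / 2\<close> in the limit (lemma \<open>potential_limit\<close>).

\<^item> Pairing this with \<open>u\<close> shows that \<open>((1 - M) / a - \<lambda>\<^sub>1) \<langle>u, \<phi>\<rangle>\<close> tends to 0. A positive eigenfunction maximises the
  Rayleigh quotient (lemma \<open>ground_state_maximal\<close>), hence \<open>(1 - M) / a\<close> is at most the corresponding quotient of \<open>\<phi>\<close> and the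
  energies \<open>\<langle>u, (1 - K\<^sub>a) u\<rangle> / a\<close> are bounded. Bounded energy prevents mass from escaping to infinity and from
  concentrating at small scales (lemma \<open>bounded_energy_vanishing\<close>); as \<open>\<phi> > 0\<close> almost everywhere, \<open>\<langle>u, \<phi>\<rangle>\<close> stays away
  from 0 (lemma \<open>overlap_bounded_below\<close>). This proves the convergence of the eigenvalues.

\<^item> The ground state identity \<open>\<integral>\<integral> K\<^sub>a(x,y) (\<phi>(x) u(y) - \<phi>(y) u(x))\<^sup>2 / (u(x) u(y)) = 2 (M - \<langle>\<phi>, K\<^sub>a \<phi>\<rangle>)\<close> has a right side of
  order \<open>o(a)\<close>, because both \<open>(1 - M) / a\<close> and \<open>(1 - \<langle>\<phi>, K\<^sub>a \<phi>\<rangle>) / a\<close> tend to \<open>\<lambda>\<^sub>1\<close>. On bounded sets \<open>K\<^sub>a / a\<close> is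
  bounded below, so \<open>\<phi>(x) u(y) - \<phi>(y) u(x)\<close> tends to 0 in the mean there, and \<open>u - t \<phi>\<close> tends to 0 locally in
  \<open>L\<^sup>1\<close> for suitable numbers \<open>t \<ge> 0\<close>. Since the energy of \<open>u - t \<phi>\<close> is bounded, the convergence holds in \<open>L\<^sup>2\<close>, and
  \<open>t \<rightarrow> 1\<close> by normalisation.

The analysis is carried out for real Borel functions and along sequences \<open>a\<^sub>n \<rightarrow> 0\<close>. The symbol \<open>\<Theta>\<close> is
replaced by a Borel function that agrees with it almost everywhere and on the diagonal (lemma \<open>borel_symbol\<close>).\<close>

section \<open>Squared norms in the extended reals\<close>

text \<open>The squared \<open>L\<^sup>2\<close> norm is kept as an extended real, so that an error term can be bounded, split and
passed to the limit before it is known to be square integrable.\<close>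

definition sqint :: "(real \<Rightarrow> real) \<Rightarrow> ennreal" where
  "sqint f = (\<integral>\<^sup>+x. ennreal ((f x)\<^sup>2) \<partial>lborel)"

lemma square_add_le: "(a + b)\<^sup>2 \<le> 2 * a\<^sup>2 + 2 * (b::real)\<^sup>2"
  using sum_squares_bound[of a b] by (simp add: power2_sum)

lemma sqint_add_le:
  assumes [measurable]: "f \<in> borel_measurable borel" "g \<in> borel_measurable borel" "h \<in> borel_measurable borel"
    and "AE x in lborel. h x = f x + g x"
  shows "sqint h \<le> 2 * sqint f + 2 * sqint g"
proof -
  have "sqint h \<le> (\<integral>\<^sup>+x. 2 * ennreal ((f x)\<^sup>2) + 2 * ennreal ((g x)\<^sup>2) \<partial>lborel)"
    unfolding sqint_def
  proof (rule nn_integral_mono_AE)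
    show "AE x in lborel. ennreal ((h x)\<^sup>2) \<le> 2 * ennreal ((f x)\<^sup>2) + 2 * ennreal ((g x)\<^sup>2)"
      using assms(4)
    proof eventually_elim
      case (elim x)
      have "ennreal ((h x)\<^sup>2) \<le> ennreal (2 * (f x)\<^sup>2 + 2 * (g x)\<^sup>2)"
        unfolding elim by (intro ennreal_leI square_add_le)
      also have "\<dots> = 2 * ennreal ((f x)\<^sup>2) + 2 * ennreal ((g x)\<^sup>2)"
        by (simp add: ennreal_mult')
      finally show ?case .
    qed
  qed
  also have "\<dots> = 2 * sqint f + 2 * sqint g"
    unfolding sqint_def by (simp add: nn_integral_add nn_integral_cmult)
  finally show ?thesis .
qed

lemma sqint_cmult:
  assumes [measurable]: "f \<in> borel_measurable borel"
  shows "sqint (\<lambda>x. c * f x) = ennreal (c\<^sup>2) * sqint f"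
  unfolding sqint_def by (simp add: power_mult_distrib ennreal_mult nn_integral_cmult)

lemma sqint_finite_iff:
  assumes [measurable]: "f \<in> borel_measurable borel"
  shows "sqint f < top \<longleftrightarrow> integrable lborel (\<lambda>x. (f x)\<^sup>2)"
  unfolding sqint_def by (simp add: integrable_iff_bounded)

lemma sqint_eq_integral:
  assumes "integrable lborel (\<lambda>x. (f x)\<^sup>2)"
  shows "sqint f = ennreal (\<integral>x. (f x)\<^sup>2 \<partial>lborel)"
  unfolding sqint_def using assms by (intro nn_integral_eq_integral) auto

lemma integrable_mult_of_squares:
  fixes f g :: "'a \<Rightarrow> real"
  assumes [measurable]: "f \<in> borel_measurable M" "g \<in> borel_measurable M"
    and "integrable M (\<lambda>x. (f x)\<^sup>2)" "integrable M (\<lambda>x. (g x)\<^sup>2)"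
  shows "integrable M (\<lambda>x. f x * g x)"
proof (rule Bochner_Integration.integrable_bound)
  show "integrable M (\<lambda>x. (f x)\<^sup>2 + (g x)\<^sup>2)" using assms by auto
  have "\<bar>a * b\<bar> \<le> a\<^sup>2 + b\<^sup>2" for a b :: real
  proof -
    have "0 \<le> \<bar>a\<bar> * \<bar>b\<bar>" "2 * (\<bar>a\<bar> * \<bar>b\<bar>) \<le> a\<^sup>2 + b\<^sup>2"
      using sum_squares_bound[of "\<bar>a\<bar>" "\<bar>b\<bar>"] by (auto simp: mult.assoc)
    then show ?thesis unfolding abs_mult by linarith
  qed
  then show "AE x in M. norm (f x * g x) \<le> norm ((f x)\<^sup>2 + (g x)\<^sup>2)" by simp
qed simp

lemma integral_mult_le_sqrt:
  fixes f g :: "'a \<Rightarrow> real"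
  assumes [measurable]: "f \<in> borel_measurable M" "g \<in> borel_measurable M"
    and f: "integrable M (\<lambda>x. (f x)\<^sup>2)" and g: "integrable M (\<lambda>x. (g x)\<^sup>2)"
  shows "(\<integral>x. f x * g x \<partial>M)\<^sup>2 \<le> (\<integral>x. (f x)\<^sup>2 \<partial>M) * (\<integral>x. (g x)\<^sup>2 \<partial>M)"
proof -
  have i: "integrable M (\<lambda>x. f x * g x)" by (rule integrable_mult_of_squares) fact+
  have "ennreal ((\<integral>x. f x * g x \<partial>M)\<^sup>2) \<le> ennreal ((\<integral>x. \<bar>f x\<bar> * \<bar>g x\<bar> \<partial>M)\<^sup>2)"
  proof (rule ennreal_leI)
    have "\<bar>\<integral>x. f x * g x \<partial>M\<bar> \<le> (\<integral>x. \<bar>f x\<bar> * \<bar>g x\<bar> \<partial>M)"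
      using integral_abs_bound[of M "\<lambda>x. f x * g x"] by (simp add: abs_mult)
    then show "(\<integral>x. f x * g x \<partial>M)\<^sup>2 \<le> (\<integral>x. \<bar>f x\<bar> * \<bar>g x\<bar> \<partial>M)\<^sup>2"
      using abs_le_square_iff by fastforce
  qed
  also have "\<dots> = (\<integral>\<^sup>+x. ennreal \<bar>f x\<bar> * ennreal \<bar>g x\<bar> \<partial>M)\<^sup>2"
    using integrable_abs[OF i] by (simp add: nn_integral_eq_integral ennreal_mult[symmetric] abs_mult ennreal_power)
  also have "\<dots> \<le> (\<integral>\<^sup>+x. (ennreal \<bar>f x\<bar>)\<^sup>2 \<partial>M) * (\<integral>\<^sup>+x. (ennreal \<bar>g x\<bar>)\<^sup>2 \<partial>M)"
    by (rule Cauchy_Schwarz_nn_integral) auto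
  also have "\<dots> = ennreal ((\<integral>x. (f x)\<^sup>2 \<partial>M) * (\<integral>x. (g x)\<^sup>2 \<partial>M))"
    using f g by (simp add: ennreal_power nn_integral_eq_integral ennreal_mult[symmetric])
  finally show ?thesis by (subst (asm) ennreal_le_iff) (auto intro!: mult_nonneg_nonneg)
qed

text \<open>Cauchy--Schwarz with respect to the measure of density \<open>A\<close>. Both sides make sense when the integral on the
left does not converge, because it is then 0.\<close>

lemma jensen_kernel:
  fixes A h :: "'a \<Rightarrow> real"
  assumes [measurable]: "A \<in> borel_measurable M" "h \<in> borel_measurable M"
    and nn: "\<And>y. 0 \<le> A y"
  shows "ennreal ((\<integral>y. A y * h y \<partial>M)\<^sup>2) \<le> (\<integral>\<^sup>+y. ennreal (A y) \<partial>M) * (\<integral>\<^sup>+y. ennreal (A y * (h y)\<^sup>2) \<partial>M)"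
proof -
  have 1: "ennreal \<bar>\<integral>y. A y * h y \<partial>M\<bar> \<le> (\<integral>\<^sup>+y. ennreal \<bar>A y * h y\<bar> \<partial>M)"
  proof (cases "integrable M (\<lambda>y. A y * h y)")
    case True
    show ?thesis using True integral_norm_bound_ennreal[OF True] by simp
  qed (simp add: not_integrable_integral_eq)
  have "ennreal ((\<integral>y. A y * h y \<partial>M)\<^sup>2) = (ennreal \<bar>\<integral>y. A y * h y \<partial>M\<bar>)\<^sup>2"
    by (simp add: ennreal_power)
  also have "\<dots> \<le> (\<integral>\<^sup>+y. ennreal \<bar>A y * h y\<bar> \<partial>M)\<^sup>2"
    using 1 by (simp add: power_mono)
  also have "\<dots> = (\<integral>\<^sup>+y. ennreal (sqrt (A y)) * ennreal (sqrt (A y) * \<bar>h y\<bar>) \<partial>M)\<^sup>2"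
    using nn by (simp add: ennreal_mult[symmetric] abs_mult mult.assoc[symmetric])
  also have "\<dots> \<le> (\<integral>\<^sup>+y. (ennreal (sqrt (A y)))\<^sup>2 \<partial>M) * (\<integral>\<^sup>+y. (ennreal (sqrt (A y) * \<bar>h y\<bar>))\<^sup>2 \<partial>M)"
    by (rule Cauchy_Schwarz_nn_integral) auto
  also have "\<dots> = (\<integral>\<^sup>+y. ennreal (A y) \<partial>M) * (\<integral>\<^sup>+y. ennreal (A y * (h y)\<^sup>2) \<partial>M)"
    using nn by (simp add: ennreal_power power_mult_distrib)
  finally show ?thesis .
qed

section \<open>Continuity of translations\<close>

definition shift_diff :: "(real \<Rightarrow> real) \<Rightarrow> real \<Rightarrow> ennreal" where
  "shift_diff F z = (\<integral>\<^sup>+x. ennreal \<bar>F (x + z) - F x\<bar> \<partial>lborel)"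

lemma nn_integral_shift:
  fixes f :: "real \<Rightarrow> ennreal"
  assumes [measurable]: "f \<in> borel_measurable borel"
  shows "(\<integral>\<^sup>+x. f (x + z) \<partial>lborel) = (\<integral>\<^sup>+x. f x \<partial>lborel)"
  using nn_integral_real_affine[of f 1 z] by (simp add: add.commute)

lemma nn_integral_scale:
  assumes [measurable]: "f \<in> borel_measurable borel" and "0 < (a::real)"
  shows "(\<integral>\<^sup>+x. f x \<partial>lborel) = (\<integral>\<^sup>+s. ennreal a * f (y + a * s) \<partial>lborel)"
  using nn_integral_real_affine[of f a y] assms by (simp add: nn_integral_cmult)

lemma shift_diff_approx:
  assumes [measurable]: "F \<in> borel_measurable borel" "G \<in> borel_measurable borel"
  shows "shift_diff F z \<le> shift_diff G z + 2 * (\<integral>\<^sup>+x. ennreal \<bar>F x - G x\<bar> \<partial>lborel)"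
proof -
  have "shift_diff F z \<le> (\<integral>\<^sup>+x. ennreal \<bar>G (x + z) - G x\<bar> + (ennreal \<bar>F (x+z) - G (x+z)\<bar> + ennreal \<bar>F x - G x\<bar>) \<partial>lborel)"
    unfolding shift_diff_def
    by (intro nn_integral_mono) (simp add: ennreal_plus[symmetric] del: ennreal_plus)
  also have "\<dots> = shift_diff G z + ((\<integral>\<^sup>+x. ennreal \<bar>F (x+z) - G (x+z)\<bar> \<partial>lborel) + (\<integral>\<^sup>+x. ennreal \<bar>F x - G x\<bar> \<partial>lborel))"
    unfolding shift_diff_def by (simp add: nn_integral_add)
  also have "(\<integral>\<^sup>+x. ennreal \<bar>F (x+z) - G (x+z)\<bar> \<partial>lborel) = (\<integral>\<^sup>+x. ennreal \<bar>F x - G x\<bar> \<partial>lborel)"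
    using nn_integral_shift[of "\<lambda>x. ennreal \<bar>F x - G x\<bar>"] by simp
  finally show ?thesis by (simp add: mult_2)
qed

text \<open>The form in which density arguments are used below: the error of the approximation is uniform in \<open>n\<close>.\<close>

lemma tendsto_0_ennreal_by_approx:
  fixes f :: "nat \<Rightarrow> ennreal"
  assumes "\<And>e::real. 0 < e \<Longrightarrow> \<exists>g. g \<longlonglongrightarrow> 0 \<and> (\<forall>n. f n \<le> g n + ennreal e)"
  shows "f \<longlonglongrightarrow> 0"
proof (rule order_tendstoI)
  fix a :: ennreal assume "0 < a"
  then obtain e where e: "0 < e" "ennreal (e + e) < a"
  proof -
    assume *: "\<And>e. 0 < e \<Longrightarrow> ennreal (e + e) < a \<Longrightarrow> thesis"
    obtain r where r: "0 < ennreal r" "ennreal r < a" "0 < r"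
    proof -
      obtain b where b: "0 < b" "b < a" using dense[OF \<open>0 < a\<close>] by blast
      then have "b < top" by (meson order_less_le_trans top_greatest)
      then obtain r where "0 \<le> r" "b = ennreal r" using ennreal_cases by (metis less_top)
      with b that[of r] show thesis by simp
    qed
    then show thesis using *[of "r/2"] by simp
  qed
  obtain g where g: "g \<longlonglongrightarrow> 0" "\<And>n. f n \<le> g n + ennreal e" using assms[OF e(1)] by blast
  have "eventually (\<lambda>n. g n < ennreal e) sequentially"
    using order_tendstoD(2)[OF g(1), of "ennreal e"] e(1) by simp
  then show "eventually (\<lambda>n. f n < a) sequentially"
  proof eventually_elim
    case (elim n)
    have "f n \<le> ennreal e + ennreal e" using g(2)[of n] elim by (meson add_right_mono less_imp_le order_trans)
    also have "\<dots> < a" using e by (simp add: ennreal_plus[symmetric] del: ennreal_plus)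
    finally show ?case .
  qed
qed simp

lemma ennreal_tendsto_0_le:
  fixes f g :: "nat \<Rightarrow> ennreal"
  assumes "g \<longlonglongrightarrow> 0" "\<And>n. f n \<le> g n"
  shows "f \<longlonglongrightarrow> 0"
  by (rule tendsto_sandwich[OF _ _ tendsto_const assms(1)]) (use assms(2) in auto)

text \<open>A point of an open set stays in it under a small translation, so the part of \<open>U\<close> that leaves \<open>U\<close> tends to 0
by dominated convergence; the part that enters \<open>U\<close> has the same measure as the part that leaves it under the
opposite translation.\<close>

lemma shift_diff_open:
  fixes z :: "nat \<Rightarrow> real"
  assumes U: "open U" "emeasure lborel U < \<infinity>" and z: "z \<longlonglongrightarrow> 0"
  shows "(\<lambda>n. shift_diff (indicator U) (z n)) \<longlonglongrightarrow> 0"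
proof -
  have [measurable]: "U \<in> sets borel" using U(1) by simp
  let ?J = "\<lambda>z. \<integral>\<^sup>+x. indicator U x * indicator (-U) (x + z) \<partial>lborel"
  have J: "(\<lambda>n. ?J (w n)) \<longlonglongrightarrow> 0" if w: "w \<longlonglongrightarrow> 0" for w :: "nat \<Rightarrow> real"
  proof -
    have "(\<lambda>n. ?J (w n)) \<longlonglongrightarrow> (\<integral>\<^sup>+x. 0 \<partial>(lborel::real measure))"
    proof (rule nn_integral_dominated_convergence[where w="indicator U"])
      show "AE x in lborel. (\<lambda>i. indicator U x * indicator (- U) (x + w i) :: ennreal) \<longlonglongrightarrow> 0"
      proof (rule AE_I2)
        fix x :: real
        show "(\<lambda>i. indicator U x * indicator (- U) (x + w i) :: ennreal) \<longlonglongrightarrow> 0"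
        proof (cases "x \<in> U")
          case True
          have "(\<lambda>i. x + w i) \<longlonglongrightarrow> x" using tendsto_add[OF tendsto_const w] by auto
          then have "eventually (\<lambda>i. x + w i \<in> U) sequentially" using U(1) True by (rule topological_tendstoD)
          then have "eventually (\<lambda>i. (indicator U x * indicator (- U) (x + w i) :: ennreal) = 0) sequentially"
            by eventually_elim simp
          then show ?thesis by (rule tendsto_eventually)
        qed simp
      qed
    qed (use U in \<open>auto split: split_indicator\<close>)
    then show ?thesis by simp
  qed
  have eq: "shift_diff (indicator U) z = ?J z + ?J (- z)" for z
  proof -
    have "shift_diff (indicator U) z = (\<integral>\<^sup>+x. indicator U x * indicator (-U) (x + z) + indicator (-U) x * indicator U (x + z) \<partial>lborel)"
      unfolding shift_diff_def by (intro nn_integral_cong) (auto split: split_indicator)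
    also have "\<dots> = ?J z + (\<integral>\<^sup>+x. indicator (-U) x * indicator U (x + z) \<partial>lborel)"
      by (rule nn_integral_add) auto
    also have "(\<integral>\<^sup>+x. indicator (-U) x * indicator U (x + z) \<partial>lborel) = ?J (- z)"
      using nn_integral_shift[of "\<lambda>x. indicator (-U) x * indicator U (x + z)" "-z"] by (simp add: mult.commute)
    finally show ?thesis .
  qed
  have "(\<lambda>n. ?J (z n) + ?J (- z n)) \<longlonglongrightarrow> 0 + 0"
    using tendsto_minus[OF z] by (intro tendsto_add J z) simp
  then show ?thesis unfolding eq by simp
qed

text \<open>Translations act continuously on \<open>L\<^sup>1\<close>. Indicators are approximated from outside by open sets, and the general case
follows from the density of simple functions.\<close>

lemma shift_diff_tendsto_0:
  fixes z :: "nat \<Rightarrow> real"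
  assumes F: "integrable lborel F" and z: "z \<longlonglongrightarrow> 0"
  shows "(\<lambda>n. shift_diff F (z n)) \<longlonglongrightarrow> 0"
  using F
proof (induction rule: integrable_induct)
  case (base A c)
  then have [measurable]: "A \<in> sets borel" by simp
  have ind: "(\<lambda>n. shift_diff (indicator A) (z n)) \<longlonglongrightarrow> 0"
  proof (rule tendsto_0_ennreal_by_approx)
    fix e :: real assume "0 < e"
    then obtain U where U: "open U" "A \<subseteq> U" "emeasure lborel (U - A) < ennreal (e/2)"
      using outer_regular_lborel[of A "e/2"] by auto
    then have [measurable]: "U \<in> sets borel" by simp
    have "emeasure lborel U = emeasure lborel A + emeasure lborel (U - A)"
      using U(2) by (subst plus_emeasure) (auto simp: Un_absorb1)
    then have fin: "emeasure lborel U < \<infinity>" using base(2) U(3) by (simp add: less_top) (metis ennreal_less_top order_less_trans less_top)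
    have d: "(\<integral>\<^sup>+x. ennreal \<bar>indicator A x - indicator U x\<bar> \<partial>lborel) = emeasure lborel (U - A)"
    proof -
      have "(\<integral>\<^sup>+x. ennreal \<bar>indicator A x - indicator U x\<bar> \<partial>lborel) = (\<integral>\<^sup>+x. indicator (U - A) x \<partial>lborel)"
        using U(2) by (intro nn_integral_cong) (auto split: split_indicator)
      then show ?thesis by simp
    qed
    show "\<exists>g. g \<longlonglongrightarrow> 0 \<and> (\<forall>n. shift_diff (indicator A) (z n) \<le> g n + ennreal e)"
    proof (intro exI conjI allI)
      show "(\<lambda>n. shift_diff (indicator U) (z n)) \<longlonglongrightarrow> 0" by (rule shift_diff_open) fact+
      fix n
      have "shift_diff (indicator A) (z n) \<le> shift_diff (indicator U) (z n) + 2 * emeasure lborel (U - A)"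
        using shift_diff_approx[of "indicator A" "indicator U" "z n"] d by simp
      also have "\<dots> \<le> shift_diff (indicator U) (z n) + ennreal e"
      proof (rule add_left_mono)
        have "2 * emeasure lborel (U - A) \<le> 2 * ennreal (e/2)" using U(3) by (intro mult_left_mono) auto
        also have "\<dots> = ennreal e" using \<open>0<e\<close> by (simp add: mult_2 ennreal_plus[symmetric] del: ennreal_plus)
        finally show "2 * emeasure lborel (U - A) \<le> ennreal e" .
      qed
      finally show "shift_diff (indicator A) (z n) \<le> shift_diff (indicator U) (z n) + ennreal e" .
    qed
  qed
  have "shift_diff (\<lambda>x. indicator A x *\<^sub>R c) w = ennreal \<bar>c\<bar> * shift_diff (indicator A) w" for w
    unfolding shift_diff_def
    by (subst nn_integral_cmult[symmetric])
       (auto intro!: nn_integral_cong simp: ennreal_mult[symmetric] abs_mult[symmetric] algebra_simps)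
  with ennreal_tendsto_cmult[OF _ ind, of "ennreal \<bar>c\<bar>"] show ?case by simp
next
  case (add f g)
  have [measurable]: "f \<in> borel_measurable borel" "g \<in> borel_measurable borel"
    using borel_measurable_integrable[OF add(1)] borel_measurable_integrable[OF add(2)] by simp_all
  have "shift_diff (\<lambda>x. f x + g x) w \<le> shift_diff f w + shift_diff g w" for w
  proof -
    have "shift_diff (\<lambda>x. f x + g x) w \<le> (\<integral>\<^sup>+x. ennreal \<bar>f (x + w) - f x\<bar> + ennreal \<bar>g (x + w) - g x\<bar> \<partial>lborel)"
      unfolding shift_diff_def
      by (intro nn_integral_mono) (simp add: ennreal_plus[symmetric] del: ennreal_plus)
    then show ?thesis unfolding shift_diff_def by (simp add: nn_integral_add)
  qed
  moreover have "(\<lambda>n. shift_diff f (z n) + shift_diff g (z n)) \<longlonglongrightarrow> 0 + 0"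
    by (intro tendsto_add add)
  ultimately show ?case
    using ennreal_tendsto_0_le[of "\<lambda>n. shift_diff f (z n) + shift_diff g (z n)"] by simp
next
  case (lim f s)
  have [measurable]: "f \<in> borel_measurable borel" "\<And>i. s i \<in> borel_measurable borel"
    using borel_measurable_integrable[OF lim(4)] borel_measurable_integrable[OF lim(1)] by simp_all
  show ?case
  proof (rule tendsto_0_ennreal_by_approx)
    fix e :: real assume "0 < e"
    have "(\<lambda>i. \<integral>\<^sup>+x. ennreal \<bar>f x - s i x\<bar> \<partial>lborel) \<longlonglongrightarrow> (\<integral>\<^sup>+x. 0 \<partial>(lborel::real measure))"
    proof (rule nn_integral_dominated_convergence[where w="\<lambda>x. 3 * ennreal \<bar>f x\<bar>"])
      show "AE x in lborel. ennreal \<bar>f x - s j x\<bar> \<le> 3 * ennreal \<bar>f x\<bar>" for j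
      proof (rule AE_I2)
        fix x
        have "\<bar>f x - s j x\<bar> \<le> 3 * \<bar>f x\<bar>" using lim(3)[of x j] by simp
        then show "ennreal \<bar>f x - s j x\<bar> \<le> 3 * ennreal \<bar>f x\<bar>"
          by (metis abs_ge_zero ennreal_leI ennreal_mult'' ennreal_numeral)
      qed
      show "(\<integral>\<^sup>+x. 3 * ennreal \<bar>f x\<bar> \<partial>lborel) < \<infinity>"
        using lim(4) by (simp add: nn_integral_cmult integrable_iff_bounded ennreal_mult_less_top)
      show "AE x in lborel. (\<lambda>i. ennreal \<bar>f x - s i x\<bar>) \<longlonglongrightarrow> 0"
      proof (rule AE_I2)
        fix x
        have "(\<lambda>i. \<bar>f x - s i x\<bar>) \<longlonglongrightarrow> \<bar>f x - f x\<bar>" using lim(2)[of x] by (intro tendsto_intros) simp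
        then show "(\<lambda>i. ennreal \<bar>f x - s i x\<bar>) \<longlonglongrightarrow> 0" using tendsto_ennrealI by fastforce
      qed
    qed auto
    then have "eventually (\<lambda>i. (\<integral>\<^sup>+x. ennreal \<bar>f x - s i x\<bar> \<partial>lborel) < ennreal (e/2)) sequentially"
      using \<open>0 < e\<close> by (intro order_tendstoD(2)) auto
    then obtain i where i: "(\<integral>\<^sup>+x. ennreal \<bar>f x - s i x\<bar> \<partial>lborel) < ennreal (e/2)"
      by (auto simp: eventually_sequentially)
    show "\<exists>g. g \<longlonglongrightarrow> 0 \<and> (\<forall>n. shift_diff f (z n) \<le> g n + ennreal e)"
    proof (intro exI conjI allI)
      show "(\<lambda>n. shift_diff (s i) (z n)) \<longlonglongrightarrow> 0" by (rule lim)
      fix n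
      have "shift_diff f (z n) \<le> shift_diff (s i) (z n) + 2 * (\<integral>\<^sup>+x. ennreal \<bar>f x - s i x\<bar> \<partial>lborel)"
        by (rule shift_diff_approx) auto
      also have "\<dots> \<le> shift_diff (s i) (z n) + ennreal e"
      proof (rule add_left_mono)
        have "2 * (\<integral>\<^sup>+x. ennreal \<bar>f x - s i x\<bar> \<partial>lborel) \<le> 2 * ennreal (e/2)" using i by (intro mult_left_mono) auto
        also have "\<dots> = ennreal e" using \<open>0<e\<close> by (simp add: mult_2 ennreal_plus[symmetric] del: ennreal_plus)
        finally show "2 * (\<integral>\<^sup>+x. ennreal \<bar>f x - s i x\<bar> \<partial>lborel) \<le> ennreal e" .
      qed
      finally show "shift_diff f (z n) \<le> shift_diff (s i) (z n) + ennreal e" .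
    qed
  qed
qed

text \<open>For non-negative numbers \<open>(p - q)\<^sup>2 \<le> \<bar>p\<^sup>2 - q\<^sup>2\<bar>\<close>, so continuity of translations in \<open>L\<^sup>2\<close> follows from continuity
in \<open>L\<^sup>1\<close>, applied to \<open>f\<^sup>2\<close>.\<close>

lemma sqint_shift_nonneg:
  fixes z :: "nat \<Rightarrow> real"
  assumes [measurable]: "f \<in> borel_measurable borel" and nn: "\<And>x. 0 \<le> f x"
    and f: "sqint f < top" and z: "z \<longlonglongrightarrow> 0"
  shows "(\<lambda>n. sqint (\<lambda>x. f (x + z n) - f x)) \<longlonglongrightarrow> 0"
proof -
  have "integrable lborel (\<lambda>x. (f x)\<^sup>2)" using f by (simp add: sqint_finite_iff)
  then have *: "(\<lambda>n. shift_diff (\<lambda>x. (f x)\<^sup>2) (z n)) \<longlonglongrightarrow> 0" using z by (rule shift_diff_tendsto_0)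
  have "sqint (\<lambda>x. f (x + w) - f x) \<le> shift_diff (\<lambda>x. (f x)\<^sup>2) w" for w
    unfolding sqint_def shift_diff_def
  proof (intro nn_integral_mono ennreal_leI)
    fix x
    have "(f (x + w) - f x)\<^sup>2 \<le> \<bar>f (x + w) - f x\<bar> * (f (x + w) + f x)"
    proof -
      have "(f (x + w) - f x)\<^sup>2 = \<bar>f (x + w) - f x\<bar> * \<bar>f (x + w) - f x\<bar>" by (simp add: power2_eq_square)
      also have "\<dots> \<le> \<bar>f (x + w) - f x\<bar> * (f (x + w) + f x)"
        using nn[of x] nn[of "x+w"] by (intro mult_left_mono) auto
      finally show ?thesis .
    qed
    also have "\<dots> = \<bar>(f (x + w))\<^sup>2 - (f x)\<^sup>2\<bar>"
      using nn[of x] nn[of "x+w"] by (simp add: power2_eq_square square_diff_square_factored abs_mult mult.commute)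
    finally show "(f (x + w) - f x)\<^sup>2 \<le> \<bar>(f (x + w))\<^sup>2 - (f x)\<^sup>2\<bar>" .
  qed
  then show ?thesis by (rule ennreal_tendsto_0_le[OF *])
qed

lemma sqint_mono: "(\<And>x. \<bar>f x\<bar> \<le> \<bar>g x\<bar>) \<Longrightarrow> sqint f \<le> sqint g"
  unfolding sqint_def by (intro nn_integral_mono ennreal_leI) (simp add: abs_le_square_iff)

lemma sqint_shift:
  fixes z :: "nat \<Rightarrow> real"
  assumes [measurable]: "f \<in> borel_measurable borel"
    and f: "sqint f < top" and z: "z \<longlonglongrightarrow> 0"
  shows "(\<lambda>n. sqint (\<lambda>x. f (x + z n) - f x)) \<longlonglongrightarrow> 0"
proof -
  have "sqint (\<lambda>x. max 0 (f x)) \<le> sqint f" "sqint (\<lambda>x. max 0 (- f x)) \<le> sqint f"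
    by (auto intro!: sqint_mono)
  with f have "sqint (\<lambda>x. max 0 (f x)) < top" "sqint (\<lambda>x. max 0 (- f x)) < top" by auto
  then have *: "(\<lambda>n. 2 * sqint (\<lambda>x. max 0 (f (x + z n)) - max 0 (f x)) + 2 * sqint (\<lambda>x. max 0 (- f x) - max 0 (- f (x + z n)))) \<longlonglongrightarrow> 2 * 0 + 2 * 0"
  proof (intro tendsto_add ennreal_tendsto_cmult)
    show "(\<lambda>n. sqint (\<lambda>x. max 0 (f (x + z n)) - max 0 (f x))) \<longlonglongrightarrow> 0"
      using sqint_shift_nonneg[of "\<lambda>x. max 0 (f x)" z] \<open>sqint (\<lambda>x. max 0 (f x)) < top\<close> z by simp
    have "(\<lambda>n. sqint (\<lambda>x. max 0 (- f (x + z n)) - max 0 (- f x))) \<longlonglongrightarrow> 0"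
      using sqint_shift_nonneg[of "\<lambda>x. max 0 (- f x)" z] \<open>sqint (\<lambda>x. max 0 (- f x)) < top\<close> z by simp
    also have "(\<lambda>n. sqint (\<lambda>x. max 0 (- f (x + z n)) - max 0 (- f x))) = (\<lambda>n. sqint (\<lambda>x. max 0 (- f x) - max 0 (- f (x + z n))))"
      unfolding sqint_def by (subst power2_commute) (rule refl)
    finally show "(\<lambda>n. sqint (\<lambda>x. max 0 (- f x) - max 0 (- f (x + z n)))) \<longlonglongrightarrow> 0" .
  qed simp_all
  have "sqint (\<lambda>x. f (x + z n) - f x) \<le> 2 * sqint (\<lambda>x. max 0 (f (x + z n)) - max 0 (f x)) + 2 * sqint (\<lambda>x. max 0 (- f x) - max 0 (- f (x + z n)))" for n
    by (rule sqint_add_le) (simp_all add: max_def)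
  then show ?thesis by (rule ennreal_tendsto_0_le[OF *[unfolded mult_zero_right add_0_left]])
qed

section \<open>Approximate identities\<close>

lemma integrable_indicator_Icc: "integrable lborel (indicator {a..b::real} :: real \<Rightarrow> real)"
  by (rule integrable_real_indicator) (auto simp: emeasure_lborel_Icc_eq)

lemma sqint_shift_le:
  assumes [measurable]: "f \<in> borel_measurable borel"
  shows "sqint (\<lambda>x. f (x + z) - f x) \<le> 4 * sqint f"
proof -
  have "sqint (\<lambda>x. f (x + z) - f x) \<le> 2 * sqint (\<lambda>x. f (x + z)) + 2 * sqint (\<lambda>x. - f x)"
    by (rule sqint_add_le) simp_all
  also have "sqint (\<lambda>x. f (x + z)) = sqint f"
    unfolding sqint_def using nn_integral_shift[of "\<lambda>x. ennreal ((f x)\<^sup>2)"] by simp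
  also have "sqint (\<lambda>x. - f x) = sqint f" unfolding sqint_def by simp
  also have "2 * sqint f + 2 * sqint f = 4 * sqint f" by (simp add: distrib_right[symmetric])
  finally show ?thesis .
qed

lemma nn_integral_dilate_sub:
  fixes g :: "real \<Rightarrow> ennreal" and J :: "real \<Rightarrow> real"
  assumes [measurable]: "J \<in> borel_measurable borel" "g \<in> borel_measurable borel"
    and even: "\<And>t. J (- t) = J t" and nn: "\<And>t. 0 \<le> J t" and a: "0 < a"
  shows "(\<integral>\<^sup>+y. ennreal (J ((x - y) / a) / a) * g y \<partial>lborel) = (\<integral>\<^sup>+s. ennreal (J s) * g (x + a * s) \<partial>lborel)"
proof -
  have "(\<integral>\<^sup>+y. ennreal (J ((x - y) / a) / a) * g y \<partial>lborel)
      = (\<integral>\<^sup>+s. ennreal a * (ennreal (J ((x - (x + a * s)) / a) / a) * g (x + a * s)) \<partial>lborel)"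
    by (rule nn_integral_scale) (use a in simp_all)
  also have "\<dots> = (\<integral>\<^sup>+s. ennreal (J s) * g (x + a * s) \<partial>lborel)"
  proof (rule nn_integral_cong)
    fix s
    have "(x - (x + a * s)) / a = - s" using a by (simp add: field_simps)
    then have "ennreal a * ennreal (J ((x - (x + a * s)) / a) / a) = ennreal (J s)"
      using a nn[of s] even[of s] by (simp add: ennreal_mult[symmetric])
    then show "ennreal a * (ennreal (J ((x - (x + a * s)) / a) / a) * g (x + a * s)) = ennreal (J s) * g (x + a * s)"
      by (simp add: mult.assoc[symmetric])
  qed
  finally show ?thesis .
qed

text \<open>The mean of \<open>f\<close> against the dilated kernel differs from \<open>f\<close> by a mean of the differences \<open>f (x + b s) - f x\<close> with
weights \<open>J s\<close>. Jensen's inequality bounds its norm by the mean of the moduli of continuity of the translations, and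
these tend to 0 for each fixed \<open>s\<close>.\<close>

lemma approximate_identity:
  fixes a :: "nat \<Rightarrow> real" and f J :: "real \<Rightarrow> real"
  assumes [measurable]: "J \<in> borel_measurable borel" "f \<in> borel_measurable borel"
    and even: "\<And>t. J (- t) = J t" and nn: "\<And>t. 0 \<le> J t" and bdd: "\<And>t. J t \<le> B"
    and mass: "(\<integral>\<^sup>+t. ennreal (J t) \<partial>lborel) = 1"
    and f: "sqint f < top" and a: "\<And>n. 0 < a n" "a \<longlonglongrightarrow> 0"
  shows "(\<lambda>n. sqint (\<lambda>x. (\<integral>y. J ((x - y) / a n) / a n * f y \<partial>lborel) - f x)) \<longlonglongrightarrow> 0"
proof -
  have key: "sqint (\<lambda>x. (\<integral>y. J ((x - y) / b) / b * f y \<partial>lborel) - f x)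
      \<le> (\<integral>\<^sup>+s. ennreal (J s) * sqint (\<lambda>x. f (x + b * s) - f x) \<partial>lborel)" if b: "0 < b" for b
  proof -
    let ?K = "\<lambda>x y. J ((x - y) / b) / b"
    have Kn: "0 \<le> ?K x y" for x y using nn b by simp
    have Km: "(\<integral>\<^sup>+y. ennreal (?K x y) \<partial>lborel) = 1" for x
      using nn_integral_dilate_sub[of J "\<lambda>_. 1" b x] even nn b mass by simp
    have Ki: "integrable lborel (?K x)" for x
      using Km[of x] Kn[of x] by (intro integrableI_nonneg) simp_all
    have Kint: "(\<integral>y. ?K x y \<partial>lborel) = 1" for x
      using Km[of x] Kn by (subst integral_eq_nn_integral) auto
    have K2: "integrable lborel (\<lambda>y. (?K x y)\<^sup>2)" for x
    proof (rule Bochner_Integration.integrable_bound)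
      show "integrable lborel (\<lambda>y. B / b * ?K x y)" by (rule integrable_mult_right) (rule Ki)
      show "AE y in lborel. norm ((?K x y)\<^sup>2) \<le> norm (B / b * ?K x y)"
      proof (rule AE_I2)
        fix y
        have "?K x y * ?K x y \<le> B / b * ?K x y"
          using bdd nn b Kn by (intro mult_right_mono divide_right_mono) auto
        also have "\<dots> \<le> norm (B / b * ?K x y)" unfolding real_norm_def by (rule abs_ge_self)
        finally show "norm ((?K x y)\<^sup>2) \<le> norm (B / b * ?K x y)"
          unfolding power2_eq_square using Kn[of x y] by simp
      qed
    qed simp
    have f2: "integrable lborel (\<lambda>y. (f y)\<^sup>2)" using f by (simp add: sqint_finite_iff)
    have Kf: "integrable lborel (\<lambda>y. ?K x y * f y)" for x
      by (rule integrable_mult_of_squares) (use K2 f2 in simp_all)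
    have diff: "(\<integral>y. ?K x y * f y \<partial>lborel) - f x = (\<integral>y. ?K x y * (f y - f x) \<partial>lborel)" for x
    proof -
      have "(\<integral>y. ?K x y * (f y - f x) \<partial>lborel) = (\<integral>y. ?K x y * f y - ?K x y * f x \<partial>lborel)"
        by (simp only: right_diff_distrib)
      also have "\<dots> = (\<integral>y. ?K x y * f y \<partial>lborel) - (\<integral>y. ?K x y * f x \<partial>lborel)"
        by (rule Bochner_Integration.integral_diff[OF Kf]) (rule integrable_mult_left[OF Ki])
      also have "(\<integral>y. ?K x y * f x \<partial>lborel) = f x"
        using integral_mult_left_zero[of lborel "?K x" "f x"] Kint[of x] by simp
      finally show ?thesis ..
    qed
    have "sqint (\<lambda>x. (\<integral>y. ?K x y * f y \<partial>lborel) - f x)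
        \<le> (\<integral>\<^sup>+x. \<integral>\<^sup>+s. ennreal (J s) * ennreal ((f (x + b * s) - f x)\<^sup>2) \<partial>lborel \<partial>lborel)"
      unfolding sqint_def
    proof (rule nn_integral_mono)
      fix x
      have "ennreal (((\<integral>y. ?K x y * f y \<partial>lborel) - f x)\<^sup>2)
          \<le> (\<integral>\<^sup>+y. ennreal (?K x y) \<partial>lborel) * (\<integral>\<^sup>+y. ennreal (?K x y * (f y - f x)\<^sup>2) \<partial>lborel)"
        unfolding diff by (rule jensen_kernel) (use Kn in simp_all)
      also have "\<dots> = (\<integral>\<^sup>+y. ennreal (?K x y) * ennreal ((f y - f x)\<^sup>2) \<partial>lborel)"
        by (simp only: Km mult_1 ennreal_mult[OF Kn zero_le_power2])
      also have "\<dots> = (\<integral>\<^sup>+s. ennreal (J s) * ennreal ((f (x + b * s) - f x)\<^sup>2) \<partial>lborel)"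
        by (rule nn_integral_dilate_sub) (use even nn b in simp_all)
      finally show "ennreal (((\<integral>y. ?K x y * f y \<partial>lborel) - f x)\<^sup>2)
          \<le> (\<integral>\<^sup>+s. ennreal (J s) * ennreal ((f (x + b * s) - f x)\<^sup>2) \<partial>lborel)" .
    qed
    also have "\<dots> = (\<integral>\<^sup>+s. \<integral>\<^sup>+x. ennreal (J s) * ennreal ((f (x + b * s) - f x)\<^sup>2) \<partial>lborel \<partial>lborel)"
      by (rule lborel_pair.Fubini') simp
    also have "\<dots> = (\<integral>\<^sup>+s. ennreal (J s) * sqint (\<lambda>x. f (x + b * s) - f x) \<partial>lborel)"
      unfolding sqint_def by (simp add: nn_integral_cmult)
    finally show ?thesis .
  qed
  have meas: "(\<lambda>s. sqint (\<lambda>x. f (x + b * s) - f x)) \<in> borel_measurable borel" for b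
    unfolding sqint_def by measurable
  have "(\<lambda>n. \<integral>\<^sup>+s. ennreal (J s) * sqint (\<lambda>x. f (x + a n * s) - f x) \<partial>lborel) \<longlonglongrightarrow> (\<integral>\<^sup>+s. 0 \<partial>(lborel::real measure))"
  proof (rule nn_integral_dominated_convergence[where w="\<lambda>s. ennreal (J s) * (4 * sqint f)"])
    show "AE s in lborel. ennreal (J s) * sqint (\<lambda>x. f (x + a j * s) - f x) \<le> ennreal (J s) * (4 * sqint f)" for j
      by (intro AE_I2 mult_left_mono sqint_shift_le) auto
    show "(\<integral>\<^sup>+s. ennreal (J s) * (4 * sqint f) \<partial>lborel) < \<infinity>"
      using f by (simp add: nn_integral_multc mass ennreal_mult_less_top)
    show "AE s in lborel. (\<lambda>i. ennreal (J s) * sqint (\<lambda>x. f (x + a i * s) - f x)) \<longlonglongrightarrow> 0"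
    proof (rule AE_I2)
      fix s
      have "(\<lambda>i. a i * s) \<longlonglongrightarrow> 0" using tendsto_mult_right[OF a(2), of s] by simp
      then have "(\<lambda>i. sqint (\<lambda>x. f (x + a i * s) - f x)) \<longlonglongrightarrow> 0" using f by (intro sqint_shift) auto
      from ennreal_tendsto_cmult[OF _ this, of "ennreal (J s)"]
      show "(\<lambda>i. ennreal (J s) * sqint (\<lambda>x. f (x + a i * s) - f x)) \<longlonglongrightarrow> 0" by simp
    qed
  qed (use meas in simp_all)
  then have "(\<lambda>n. \<integral>\<^sup>+s. ennreal (J s) * sqint (\<lambda>x. f (x + a n * s) - f x) \<partial>lborel) \<longlonglongrightarrow> 0" by simp
  then show ?thesis by (rule ennreal_tendsto_0_le) (rule key[OF a(1)])
qed

section \<open>The Poisson kernel\<close>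

definition poisson :: "real \<Rightarrow> real \<Rightarrow> real" where
  "poisson s z = s / (pi * (s\<^sup>2 + z\<^sup>2))"

text \<open>The profile of the kernel \<open>(P\<^sub>a - K\<^sub>a) / a\<close> near the diagonal, normalised to mass 1, where \<open>P\<^sub>a\<close> is the Poisson kernel and \<open>K\<^sub>a\<close> its
perturbation below.\<close>

definition cauchy_square :: "real \<Rightarrow> real" where
  "cauchy_square t = 2 / (pi * (1 + t\<^sup>2)\<^sup>2)"

lemma poisson_measurable [measurable]: "(\<lambda>(s, z). poisson s z) \<in> borel_measurable (borel \<Otimes>\<^sub>M borel)"
  unfolding poisson_def by measurable

lemma cauchy_square_measurable [measurable]: "cauchy_square \<in> borel_measurable borel"
  unfolding cauchy_square_def by measurable

lemma one_plus_square_pos: "0 < 1 + (t::real)\<^sup>2"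
  by (simp add: add_pos_nonneg)

lemma poisson_nonneg: "0 \<le> s \<Longrightarrow> 0 \<le> poisson s z"
  unfolding poisson_def by simp

lemma poisson_pos: "0 < s \<Longrightarrow> 0 < poisson s z"
  unfolding poisson_def by (simp add: add_pos_nonneg)

lemma poisson_dilate: "0 < s \<Longrightarrow> poisson s z = poisson 1 (z / s) / s"
proof -
  assume s: "0 < s"
  then have "s\<^sup>2 + z\<^sup>2 = s * (s * (1\<^sup>2 + (z / s)\<^sup>2))" by (simp add: field_simps power2_eq_square)
  with s show ?thesis unfolding poisson_def by simp
qed

lemma nn_integral_poisson_1: "(\<integral>\<^sup>+t. ennreal (poisson 1 t) \<partial>lborel) = 1"
proof -
  have i: "integrable lborel (\<lambda>x::real. inverse (1 + x\<^sup>2))" and v: "(\<integral>x. inverse (1 + x\<^sup>2) \<partial>lborel) = pi"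
    using integrable_inverse_1_plus_square LBINT_inverse_1_plus_square
    unfolding interval_lebesgue_integral_def einterval_eq_UNIV set_integrable_def set_lebesgue_integral_def by simp_all
  have eq: "poisson 1 t = inverse pi * inverse (1 + t\<^sup>2)" for t
    unfolding poisson_def by (simp add: field_simps)
  have "(\<integral>\<^sup>+t. ennreal (poisson 1 t) \<partial>lborel) = ennreal (\<integral>t. poisson 1 t \<partial>lborel)"
    by (rule nn_integral_eq_integral) (use i in \<open>auto simp: eq intro: poisson_nonneg\<close>)
  also have "(\<integral>t. poisson 1 t \<partial>lborel) = 1"
    unfolding eq using v by simp
  finally show ?thesis by simp
qed

lemma nn_integral_cauchy_square: "(\<integral>\<^sup>+t. ennreal (cauchy_square t) \<partial>lborel) = 1"
proof -
  let ?F = "\<lambda>t::real. (t / (1 + t\<^sup>2) + arctan t) / pi"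
  have D: "(?F has_real_derivative cauchy_square t) (at t)" for t
  proof -
    have nz: "1 + t\<^sup>2 \<noteq> 0" using one_plus_square_pos[of t] by simp
    have "(?F has_real_derivative ((1 * (1 + t\<^sup>2) - t * (2 * t)) / ((1 + t\<^sup>2) * (1 + t\<^sup>2)) + inverse (1 + t\<^sup>2)) / pi) (at t)"
      using nz by (auto intro!: derivative_eq_intros)
    also have "((1 * (1 + t\<^sup>2) - t * (2 * t)) / ((1 + t\<^sup>2) * (1 + t\<^sup>2)) + inverse (1 + t\<^sup>2)) / pi = cauchy_square t"
      unfolding cauchy_square_def using nz by (simp add: divide_simps) (simp add: power2_eq_square algebra_simps)
    finally show ?thesis .
  qed
  have lim0: "((\<lambda>t::real. t / (1 + t\<^sup>2)) \<longlongrightarrow> 0) at_top" "((\<lambda>t::real. t / (1 + t\<^sup>2)) \<longlongrightarrow> 0) at_bot"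
    by real_asymp+
  have limT: "(?F \<longlongrightarrow> 1/2) at_top"
    using tendsto_divide[OF tendsto_add[OF lim0(1) tendsto_arctan_at_top] tendsto_const[of pi]] by simp
  have limB: "(?F \<longlongrightarrow> - 1/2) at_bot"
    using tendsto_divide[OF tendsto_add[OF lim0(2) tendsto_arctan_at_bot] tendsto_const[of pi]] by simp
  have nn: "0 \<le> cauchy_square t" for t unfolding cauchy_square_def by simp
  have cont: "isCont cauchy_square t" for t
    unfolding cauchy_square_def using one_plus_square_pos[of t] by (intro continuous_intros) auto
  have A: "((?F \<circ> real_of_ereal) \<longlongrightarrow> -1/2) (at_right (-\<infinity>))"
    unfolding ereal_tendsto_simps using limB by simp
  have B: "((?F \<circ> real_of_ereal) \<longlongrightarrow> 1/2) (at_left \<infinity>)"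
    unfolding ereal_tendsto_simps using limT by simp
  have nn': "AE x in lborel. -\<infinity> < ereal x \<longrightarrow> ereal x < \<infinity> \<longrightarrow> 0 \<le> cauchy_square x" using nn by simp
  note FTC = interval_integral_FTC_nonneg[of "-\<infinity>" "\<infinity>" ?F cauchy_square "-1/2" "1/2", OF _ D cont nn' A B]
  have "set_integrable lborel (einterval (-\<infinity>) \<infinity>) cauchy_square" "(LBINT x=-\<infinity>..\<infinity>. cauchy_square x) = 1/2 - (-1/2)"
    using FTC by simp_all
  then have i: "integrable lborel cauchy_square" and v: "(\<integral>t. cauchy_square t \<partial>lborel) = 1"
    unfolding interval_lebesgue_integral_def einterval_eq_UNIV set_integrable_def set_lebesgue_integral_def by simp_all
  show ?thesis using nn_integral_eq_integral[OF i] nn v by simp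
qed

lemma poisson_1_even: "poisson 1 (- t) = poisson 1 t" and poisson_1_le: "poisson 1 t \<le> 1"
proof -
  show "poisson 1 (- t) = poisson 1 t" unfolding poisson_def by simp
  have "1 \<le> pi * (1 + t\<^sup>2)" using pi_ge_two mult_mono[of 1 pi 1 "1 + t\<^sup>2"] by simp
  then show "poisson 1 t \<le> 1" unfolding poisson_def by (simp add: divide_le_eq)
qed

lemma nn_integral_poisson:
  assumes "0 < s"
  shows "(\<integral>\<^sup>+y. ennreal (poisson s (x - y)) \<partial>lborel) = 1"
  unfolding poisson_dilate[OF assms]
  using nn_integral_dilate_sub[of "poisson 1" "\<lambda>_. 1" s x] poisson_1_even poisson_nonneg[of 1] assms nn_integral_poisson_1
  by simp

lemma integrable_poisson: "0 < s \<Longrightarrow> integrable lborel (\<lambda>y. poisson s (x - y))"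
  using nn_integral_poisson[of s x] poisson_nonneg[of s] by (intro integrableI_nonneg) simp_all

lemma integrable_poisson_square: 
  assumes s: "0 < s"
  shows "integrable lborel (\<lambda>y. (poisson s (x - y))\<^sup>2)"
proof (rule Bochner_Integration.integrable_bound)
  show "integrable lborel (\<lambda>y. 1 / s * poisson s (x - y))" using integrable_poisson[OF s] by simp
  show "AE y in lborel. norm ((poisson s (x - y))\<^sup>2) \<le> norm (1 / s * poisson s (x - y))"
  proof (rule AE_I2)
    fix y
    have "poisson s (x - y) \<le> 1 / s" using poisson_1_le s by (subst poisson_dilate) (auto intro: divide_right_mono)
    then have "poisson s (x - y) * poisson s (x - y) \<le> 1 / s * poisson s (x - y)"
      using poisson_nonneg[of s] s by (intro mult_right_mono) auto
    then show "norm ((poisson s (x - y))\<^sup>2) \<le> norm (1 / s * poisson s (x - y))"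
      using poisson_nonneg[of s "x - y"] s by (simp add: power2_eq_square)
  qed
qed simp

section \<open>Fourier representation of Poisson means\<close>

text \<open>The fundamental theorem of calculus on \<open>{0..n}\<close>, followed by \<open>n \<rightarrow> \<infinity>\<close>.\<close>

lemma half_line_exp_integral:
  fixes c :: complex
  assumes c: "0 < Re c"
  shows "integrable lborel (\<lambda>t::real. indicator {0..} t *\<^sub>R exp (- c * complex_of_real t))"
    and "(\<integral>t. indicator {0..} t *\<^sub>R exp (- c * complex_of_real t) \<partial>lborel) = 1 / c"
proof -
  let ?f = "\<lambda>t::real. indicator {0..} t *\<^sub>R exp (- c * complex_of_real t)"
  have nz: "c \<noteq> 0" using c by auto
  have dom: "integrable lborel (\<lambda>t::real. indicator {0..} t * exp (- Re c * t))"
  proof (rule integrableI_nonneg)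
    have "(\<integral>\<^sup>+t. ennreal (indicator {0..} t * exp (- Re c * t)) \<partial>lborel) = (\<integral>\<^sup>+t. ennreal (exp (- Re c * t)) * indicator {0..} t \<partial>lborel)"
      by (intro nn_integral_cong) (auto split: split_indicator)
    also have "\<dots> = ennreal (0 - (- exp (- Re c * 0) / Re c))"
    proof (rule nn_integral_FTC_atLeast)
      show "((\<lambda>t. - exp (- Re c * t) / Re c) has_real_derivative exp (- Re c * t)) (at t)" for t
        using c by (auto intro!: derivative_eq_intros)
      show "((\<lambda>t. - exp (- Re c * t) / Re c) \<longlongrightarrow> 0) at_top"
        using c by real_asymp
    qed auto
    finally show "(\<integral>\<^sup>+t. ennreal (indicator {0..} t * exp (- Re c * t)) \<partial>lborel) < \<infinity>" by simp
  qed auto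
  show i: "integrable lborel ?f"
  proof (rule Bochner_Integration.integrable_bound[OF dom])
    show "AE t in lborel. norm (?f t) \<le> norm (indicator {0..} t * exp (- Re c * t))"
      by (auto split: split_indicator)
  qed simp
  have "(\<lambda>n. \<integral>t. indicator {0..real n} t *\<^sub>R exp (- c * complex_of_real t) \<partial>lborel) \<longlonglongrightarrow> (\<integral>t. ?f t \<partial>lborel)"
  proof (rule integral_dominated_convergence[where w="\<lambda>t. indicator {0..} t * exp (- Re c * t)"])
    show "AE t in lborel. (\<lambda>n. indicator {0..real n} t *\<^sub>R exp (- c * complex_of_real t)) \<longlonglongrightarrow> ?f t"
    proof (rule AE_I2)
      fix t :: real
      obtain N :: nat where "t \<le> real N" using real_arch_simple by blast
      then have "eventually (\<lambda>n. indicator {0..real n} t *\<^sub>R exp (- c * complex_of_real t) = ?f t) sequentially"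
        unfolding eventually_sequentially by (intro exI[of _ N]) (auto split: split_indicator)
      then show "(\<lambda>n. indicator {0..real n} t *\<^sub>R exp (- c * complex_of_real t)) \<longlonglongrightarrow> ?f t" by (rule tendsto_eventually)
    qed
    show "AE t in lborel. norm (indicator {0..real n} t *\<^sub>R exp (- c * complex_of_real t)) \<le> indicator {0..} t * exp (- Re c * t)" for n
      by (auto split: split_indicator)
  qed (use dom in simp_all)
  moreover have "(\<integral>t. indicator {0..real n} t *\<^sub>R exp (- c * complex_of_real t) \<partial>lborel) = - exp (- c * complex_of_real (real n)) / c + 1 / c" for n
  proof -
    have "(\<integral>t. indicator {0..real n} t *\<^sub>R exp (- c * complex_of_real t) \<partial>lborel) = - exp (- c * complex_of_real (real n)) / c - (- exp (- c * complex_of_real 0) / c)"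
    proof (rule integral_FTC_atLeastAtMost)
      fix x :: real
      have "((\<lambda>z. - exp (- c * z) / c) has_field_derivative exp (- c * complex_of_real x)) (at (complex_of_real x))"
        using nz by (auto intro!: derivative_eq_intros)
      then have "((\<lambda>t. - exp (- c * complex_of_real t) / c) has_vector_derivative exp (- c * complex_of_real x)) (at x)"
        by (rule has_vector_derivative_real_field)
      then show "((\<lambda>t. - exp (- c * complex_of_real t) / c) has_vector_derivative exp (- c * complex_of_real x)) (at x within {0..real n})"
        by (rule has_vector_derivative_at_within)
    qed (auto intro!: continuous_intros)
    then show ?thesis by simp
  qed
  moreover have "(\<lambda>n. - exp (- c * complex_of_real (real n)) / c + 1 / c) \<longlonglongrightarrow> 0 + 1 / c"
  proof (intro tendsto_add tendsto_const)
    have *: "(\<lambda>n. exp (- r * real n)) \<longlonglongrightarrow> 0" if "0 < r" for r :: real using that by real_asymp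
    have "(\<lambda>n. exp (- Re c * real n) / norm c) \<longlonglongrightarrow> 0" by (rule tendsto_divide_zero) (rule *[OF c])
    then show "(\<lambda>n. - exp (- c * complex_of_real (real n)) / c) \<longlonglongrightarrow> 0"
      by (rule Lim_null_comparison[rotated]) (simp add: norm_divide)
  qed
  ultimately show "(\<integral>t. ?f t \<partial>lborel) = 1 / c"
    by (metis (no_types, lifting) LIMSEQ_unique add_0 ext)
qed

text \<open>Up to a factor, the Poisson kernel is the inverse Fourier transform of the multiplier of the semigroup
\<open>exp (- s \<bar>D\<bar>)\<close>. The integral over each half line is elementary.\<close>

lemma exp_abs_fourier:
  assumes s: "0 < s"
  shows "integrable lborel (\<lambda>t. exp (- s * \<bar>t\<bar>))"
    and "(\<integral>t. complex_of_real (exp (- s * \<bar>t\<bar>)) * exp (\<i> * complex_of_real (z * t)) \<partial>lborel) = complex_of_real (2 * pi * poisson s z)"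
proof -
  let ?h = "\<lambda>z t. indicator {0..} t *\<^sub>R exp (- Complex s (- z) * complex_of_real t)"
  have hi: "integrable lborel (?h z)" "(\<integral>t. ?h z t \<partial>lborel) = 1 / Complex s (- z)" for z
    using half_line_exp_integral[of "Complex s (- z)"] s by simp_all
  have hm: "integrable lborel (\<lambda>t. ?h (- z) (- t))" "(\<integral>t. ?h (- z) (- t) \<partial>lborel) = 1 / Complex s z" for z
    using lborel_integrable_real_affine[OF hi(1)[of "-z"], of "-1" 0] lborel_integral_real_affine[of "-1" "?h (- z)" 0] hi(2)[of "-z"]
    by simp_all
  have eq: "AE t in lborel. complex_of_real (exp (- s * \<bar>t\<bar>)) * exp (\<i> * complex_of_real (z * t)) = ?h z t + ?h (- z) (- t)" for z
  proof -
    have "AE t in lborel. t \<noteq> (0::real)" by (rule AE_lborel_singleton)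
    then show ?thesis
    proof eventually_elim
      case (elim t)
      have e: "- Complex s (- z) * complex_of_real t = - complex_of_real (s * t) + \<i> * complex_of_real (z * t)"
        "- Complex s z * complex_of_real (- t) = complex_of_real (s * t) + \<i> * complex_of_real (z * t)"
        by (simp_all add: complex_eq_iff)
      have m: "complex_of_real (exp (- s * \<bar>t\<bar>)) * exp (\<i> * complex_of_real (z * t)) = exp (complex_of_real (- s * \<bar>t\<bar>) + \<i> * complex_of_real (z * t))"
        by (simp only: exp_add exp_of_real)
      show ?case
      proof (cases "0 < t")
        case True
        then show ?thesis unfolding m e(1) by simp
      next
        case False
        with elim have "t < 0" by simp
        then show ?thesis unfolding m minus_minus e(2) by simp
      qed
    qed
  qed
  have "integrable lborel (\<lambda>t. complex_of_real (exp (- s * \<bar>t\<bar>)) * exp (\<i> * complex_of_real (0 * t)))"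
    using Bochner_Integration.integrable_add[OF hi(1)[of 0] hm(1)[of 0]]
    by (subst integrable_cong_AE[OF _ _ eq]) auto
  then have "integrable lborel (\<lambda>t. norm (complex_of_real (exp (- s * \<bar>t\<bar>)) * exp (\<i> * complex_of_real (0 * t))))" by (rule integrable_norm)
  then show "integrable lborel (\<lambda>t. exp (- s * \<bar>t\<bar>))" by simp
  have "(\<integral>t. complex_of_real (exp (- s * \<bar>t\<bar>)) * exp (\<i> * complex_of_real (z * t)) \<partial>lborel) = (\<integral>t. ?h z t + ?h (- z) (- t) \<partial>lborel)"
    using eq by (intro integral_cong_AE) auto
  also have "\<dots> = 1 / Complex s (- z) + 1 / Complex s z"
    using hi hm by simp
  also have "\<dots> = complex_of_real (2 * pi * poisson s z)"
  proof -
    have n: "Complex s z \<noteq> 0" "Complex s (- z) \<noteq> 0" using s by (auto simp: complex_eq_iff)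
    have "1 / Complex s (- z) + 1 / Complex s z = (Complex s z + Complex s (- z)) / (Complex s (- z) * Complex s z)"
      using n by (simp add: field_simps)
    also have "Complex s (- z) * Complex s z = complex_of_real (s\<^sup>2 + z\<^sup>2)"
      by (simp add: complex_eq_iff power2_eq_square)
    also have "Complex s z + Complex s (- z) = complex_of_real (2 * s)"
      by (simp add: complex_eq_iff)
    also have "complex_of_real (2 * s) / complex_of_real (s\<^sup>2 + z\<^sup>2) = complex_of_real (2 * pi * poisson s z)"
      unfolding poisson_def of_real_divide[symmetric] by simp
    finally show ?thesis .
  qed
  finally show "(\<integral>t. complex_of_real (exp (- s * \<bar>t\<bar>)) * exp (\<i> * complex_of_real (z * t)) \<partial>lborel) = complex_of_real (2 * pi * poisson s z)" .
qed

lemma complex_borel_version: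
  fixes f :: "'a::euclidean_space \<Rightarrow> complex"
  assumes [measurable]: "f \<in> borel_measurable lebesgue"
  obtains f' where "f' \<in> borel_measurable borel" "AE x in lborel. f x = f' x"
proof -
  have "(\<lambda>x. Re (f x)) \<in> borel_measurable lebesgue" "(\<lambda>x. Im (f x)) \<in> borel_measurable lebesgue"
    by measurable
  from this[THEN completion_ex_borel_measurable_real]
  obtain r i where [measurable]: "r \<in> borel_measurable borel" "i \<in> borel_measurable borel"
    and ae: "AE x in lborel. Re (f x) = r x" "AE x in lborel. Im (f x) = i x" by auto
  show thesis
  proof (rule that)
    show "(\<lambda>x. Complex (r x) (i x)) \<in> borel_measurable borel"
      unfolding Complex_eq by measurable
    show "AE x in lborel. f x = Complex (r x) (i x)"
      using ae by eventually_elim (simp add: complex_eq_iff)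
  qed
qed

lemma integral_lebesgue_cong_AE:
  fixes f g :: "real \<Rightarrow> 'b::{banach, second_countable_topology}"
  assumes "AE x in lborel. f x = g x" and [measurable]: "g \<in> borel_measurable borel"
  shows "integral\<^sup>L lebesgue f = integral\<^sup>L lborel g"
    and "f \<in> borel_measurable lebesgue"
    and "integrable lebesgue f \<longleftrightarrow> integrable lborel g"
proof -
  have g: "g \<in> borel_measurable lebesgue" by (rule measurable_completion) simp
  have ae: "AE x in lebesgue. f x = g x" using assms(1) by (rule AE_completion)
  show m: "f \<in> borel_measurable lebesgue"
  proof (rule measurableI)
    fix A :: "'b set" assume "A \<in> sets borel"
    with g have B: "g -` A \<inter> space lebesgue \<in> sets lebesgue" by (rule measurable_sets)
    show "f -` A \<inter> space lebesgue \<in> sets lebesgue"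
      by (rule completion.in_sets_AE[OF _ B]) (use ae in \<open>auto simp: elim: eventually_mono\<close>)
  qed simp
  show "integral\<^sup>L lebesgue f = integral\<^sup>L lborel g"
    using integral_cong_AE[OF m g ae] integral_completion[of g lborel] by simp
  show "integrable lebesgue f \<longleftrightarrow> integrable lborel g"
    using integrable_cong_AE[OF m g ae] integrable_completion[of g lborel] by simp
qed

lemma integrable_product_bound:
  fixes f :: "real \<times> real \<Rightarrow> 'b::{banach, second_countable_topology}" and g h :: "real \<Rightarrow> real"
  assumes f[measurable]: "f \<in> borel_measurable (lborel \<Otimes>\<^sub>M lborel)"
    and g: "integrable lborel g" and h: "integrable lborel h"
    and bound: "\<And>x y. norm (f (x, y)) \<le> g x * h y"
  shows "integrable (lborel \<Otimes>\<^sub>M lborel) f"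
proof -
  have [measurable]: "g \<in> borel_measurable borel" "h \<in> borel_measurable borel"
    using borel_measurable_integrable[OF g] borel_measurable_integrable[OF h] by simp_all
  have gh: "integrable (lborel \<Otimes>\<^sub>M lborel) (\<lambda>(x, y). g x * h y)"
  proof (rule lborel_pair.Fubini_integrable)
    show "integrable lborel (\<lambda>x. \<integral>y. norm (case (x, y) of (x, y) \<Rightarrow> g x * h y) \<partial>lborel)"
      using integrable_mult_left[OF integrable_norm[OF g], of "\<integral>y. \<bar>h y\<bar> \<partial>lborel"] by (simp add: abs_mult)
    show "AE x in lborel. integrable lborel (\<lambda>y. case (x, y) of (x, y) \<Rightarrow> g x * h y)"
      using h by simp
  qed simp
  show ?thesis
  proof (rule Bochner_Integration.integrable_bound[OF gh])
    show "AE p in lborel \<Otimes>\<^sub>M lborel. norm (f p) \<le> norm (case p of (x, y) \<Rightarrow> g x * h y)"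
      using bound by (intro AE_I2) (auto intro: order_trans[OF _ abs_ge_self])
  qed simp
qed

lemma complex_integrable_mult_of_squares:
  fixes f g :: "real \<Rightarrow> complex"
  assumes [measurable]: "f \<in> borel_measurable borel" "g \<in> borel_measurable borel"
    and f: "integrable lborel (\<lambda>x. (cmod (f x))\<^sup>2)" and g: "integrable lborel (\<lambda>x. (cmod (g x))\<^sup>2)"
  shows "integrable lborel (\<lambda>x. f x * g x)"
    and "cmod (\<integral>x. f x * g x \<partial>lborel) \<le> sqrt (\<integral>x. (cmod (f x))\<^sup>2 \<partial>lborel) * sqrt (\<integral>x. (cmod (g x))\<^sup>2 \<partial>lborel)"
proof -
  have i: "integrable lborel (\<lambda>x. cmod (f x) * cmod (g x))"
    by (rule integrable_mult_of_squares) (use f g in simp_all)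
  then have "integrable lborel (\<lambda>x. norm (f x * g x))" by (simp add: norm_mult)
  then show i2: "integrable lborel (\<lambda>x. f x * g x)" by (subst (asm) integrable_norm_iff) simp_all
  have "cmod (\<integral>x. f x * g x \<partial>lborel) \<le> (\<integral>x. cmod (f x) * cmod (g x) \<partial>lborel)"
    using integral_norm_bound[of lborel "\<lambda>x. f x * g x"] by (simp add: norm_mult)
  also have "\<dots> \<le> sqrt ((\<integral>x. (cmod (f x))\<^sup>2 \<partial>lborel) * (\<integral>x. (cmod (g x))\<^sup>2 \<partial>lborel))"
    by (rule real_le_rsqrt, rule integral_mult_le_sqrt) (use f g in simp_all)
  finally show "cmod (\<integral>x. f x * g x \<partial>lborel) \<le> sqrt (\<integral>x. (cmod (f x))\<^sup>2 \<partial>lborel) * sqrt (\<integral>x. (cmod (g x))\<^sup>2 \<partial>lborel)"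
    by (simp add: real_sqrt_mult)
qed

lemma integrable_cmod_diff_square:
  fixes f g :: "real \<Rightarrow> complex"
  assumes [measurable]: "f \<in> borel_measurable borel" "g \<in> borel_measurable borel"
    and f: "integrable lborel (\<lambda>x. (cmod (f x))\<^sup>2)" and g: "integrable lborel (\<lambda>x. (cmod (g x))\<^sup>2)"
  shows "integrable lborel (\<lambda>x. (cmod (f x - g x))\<^sup>2)"
proof (rule Bochner_Integration.integrable_bound)
  show "integrable lborel (\<lambda>x. 2 * (cmod (f x))\<^sup>2 + 2 * (cmod (g x))\<^sup>2)" using f g by simp
  have "(cmod (f x - g x))\<^sup>2 \<le> 2 * (cmod (f x))\<^sup>2 + 2 * (cmod (g x))\<^sup>2" for x
  proof -
    have "(cmod (f x - g x))\<^sup>2 \<le> (cmod (f x) + cmod (g x))\<^sup>2" by (intro power_mono norm_triangle_ineq4) simp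
    also have "\<dots> \<le> 2 * (cmod (f x))\<^sup>2 + 2 * (cmod (g x))\<^sup>2" by (rule square_add_le)
    finally show ?thesis .
  qed
  then show "AE x in lborel. norm ((cmod (f x - g x))\<^sup>2) \<le> norm (2 * (cmod (f x))\<^sup>2 + 2 * (cmod (g x))\<^sup>2)"
    by (intro AE_I2) (simp add: order_trans[OF _ abs_ge_self])
qed simp

lemma exp_weight_square:
  fixes x s :: real
  assumes "0 < s"
  shows "integrable lborel (\<lambda>\<xi>. (cmod (complex_of_real (exp (- s * \<bar>\<xi>\<bar>)) * exp (\<i> * complex_of_real (x * \<xi>))))\<^sup>2)"
proof -
  have "(cmod (complex_of_real (exp (- s * \<bar>\<xi>\<bar>)) * exp (\<i> * complex_of_real (x * \<xi>))))\<^sup>2 = exp (- (2 * s) * \<bar>\<xi>\<bar>)" for \<xi>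
    by (simp add: norm_mult power2_eq_square exp_add[symmetric])
  then show ?thesis using exp_abs_fourier(1)[of "2 * s"] assms by simp
qed

lemma L2_iff_borel:
  assumes "AE x in lborel. f x = g x" and [measurable]: "g \<in> borel_measurable borel"
  shows "f \<in> L2 \<longleftrightarrow> integrable lborel (\<lambda>x. (cmod (g x))\<^sup>2)"
    and "L2_norm f = sqrt (\<integral>x. (cmod (g x))\<^sup>2 \<partial>lborel)"
proof -
  have ae: "AE x in lborel. (cmod (f x))\<^sup>2 = (cmod (g x))\<^sup>2" using assms(1) by eventually_elim simp
  show "f \<in> L2 \<longleftrightarrow> integrable lborel (\<lambda>x. (cmod (g x))\<^sup>2)"
    unfolding L2_def using integral_lebesgue_cong_AE(2)[OF assms] integral_lebesgue_cong_AE(3)[OF ae] by simp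
  show "L2_norm f = sqrt (\<integral>x. (cmod (g x))\<^sup>2 \<partial>lborel)"
    unfolding L2_norm_def using integral_lebesgue_cong_AE(1)[OF ae] by simp
qed

definition poisson_conv :: "real \<Rightarrow> (real \<Rightarrow> complex) \<Rightarrow> real \<Rightarrow> complex" where
  "poisson_conv s u x = (\<integral>y. complex_of_real (poisson s (x - y)) * u y \<partial>lborel)"

text \<open>For truncated \<open>u\<close> this is Fubini's theorem together with the transform of \<open>exp (- s \<bar>\<xi>\<bar>)\<close>. Both sides are continuous
in the \<open>L\<^sup>2\<close> norm, since the Poisson kernel and its transform are square integrable, so the truncation can be removed;
the formula holds at every point \<open>x\<close>.\<close>

lemma poisson_conv_fourier:
  fixes u v u' v' :: "real \<Rightarrow> complex"
  assumes F: "L2_fourier u v" and s: "0 < s"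
    and u': "AE x in lborel. u x = u' x" and [measurable]: "u' \<in> borel_measurable borel"
    and v': "AE x in lborel. v x = v' x" and [measurable]: "v' \<in> borel_measurable borel"
  shows "poisson_conv s u' x = complex_of_real (1 / sqrt (2 * pi)) *
    (\<integral>\<xi>. complex_of_real (exp (- s * \<bar>\<xi>\<bar>)) * exp (\<i> * complex_of_real (x * \<xi>)) * v' \<xi> \<partial>lborel)"
proof -
  let ?c = "complex_of_real (1 / sqrt (2 * pi))"
  let ?E = "\<lambda>\<xi>. complex_of_real (exp (- s * \<bar>\<xi>\<bar>)) * exp (\<i> * complex_of_real (x * \<xi>))"
  define U where "U R \<xi> = ?c * (\<integral>y. indicator {-R..R} y *\<^sub>R (exp (- \<i> * complex_of_real (\<xi> * y)) * u' y) \<partial>lborel)" for R \<xi> :: real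
  have [measurable]: "U R \<in> borel_measurable borel" for R
    unfolding U_def by measurable
  have U: "?c * (LINT x:{-R..R}|lebesgue. exp (- \<i> * complex_of_real (\<xi> * x)) * u x) = U R \<xi>" for R \<xi>
    unfolding U_def set_lebesgue_integral_def
    by (subst integral_lebesgue_cong_AE(1)[where g="\<lambda>y. indicator {-R..R} y *\<^sub>R (exp (- \<i> * complex_of_real (\<xi> * y)) * u' y)"])
       (use u' in \<open>auto elim: eventually_mono\<close>)
  have uL: "u \<in> L2" and vL: "v \<in> L2" and ev: "\<forall>\<^sub>F R in at_top. U R \<in> L2" and lim: "((\<lambda>R. L2_norm (\<lambda>\<xi>. U R \<xi> - v \<xi>)) \<longlongrightarrow> 0) at_top"
    using F unfolding L2_fourier_def L2_tendsto_def U by auto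
  have u2: "integrable lborel (\<lambda>x. (cmod (u' x))\<^sup>2)" using uL L2_iff_borel(1)[OF u'] by simp
  have v2: "integrable lborel (\<lambda>x. (cmod (v' x))\<^sup>2)" using vL L2_iff_borel(1)[OF v'] by simp
  have E2: "integrable lborel (\<lambda>\<xi>. (cmod (?E \<xi>))\<^sup>2)" using exp_weight_square[OF s, of x] .
  have U2: "\<forall>\<^sub>F R in at_top. integrable lborel (\<lambda>x. (cmod (U R x))\<^sup>2)"
    using ev by eventually_elim (simp add: L2_iff_borel(1)[OF AE_I2[OF refl]])
  let ?A = "sqrt (\<integral>\<xi>. (cmod (?E \<xi>))\<^sup>2 \<partial>lborel)"
  have "((\<lambda>R. (\<integral>\<xi>. ?E \<xi> * U R \<xi> \<partial>lborel) - (\<integral>\<xi>. ?E \<xi> * v' \<xi> \<partial>lborel)) \<longlongrightarrow> 0) at_top"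
  proof (rule Lim_null_comparison)
    show "((\<lambda>R. ?A * L2_norm (\<lambda>\<xi>. U R \<xi> - v \<xi>)) \<longlongrightarrow> 0) at_top"
      using tendsto_mult_left[OF lim, of ?A] by simp
    show "\<forall>\<^sub>F R in at_top. norm ((\<integral>\<xi>. ?E \<xi> * U R \<xi> \<partial>lborel) - (\<integral>\<xi>. ?E \<xi> * v' \<xi> \<partial>lborel)) \<le> ?A * L2_norm (\<lambda>\<xi>. U R \<xi> - v \<xi>)"
      using U2
    proof eventually_elim
      case (elim R)
      have i: "integrable lborel (\<lambda>\<xi>. ?E \<xi> * U R \<xi>)" "integrable lborel (\<lambda>\<xi>. ?E \<xi> * v' \<xi>)"
        by (rule complex_integrable_mult_of_squares; use E2 elim v2 in simp)+
      have d2: "integrable lborel (\<lambda>x. (cmod (U R x - v' x))\<^sup>2)"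
        by (rule integrable_cmod_diff_square) (use elim v2 in simp_all)
      have "(\<integral>\<xi>. ?E \<xi> * U R \<xi> \<partial>lborel) - (\<integral>\<xi>. ?E \<xi> * v' \<xi> \<partial>lborel) = (\<integral>\<xi>. ?E \<xi> * (U R \<xi> - v' \<xi>) \<partial>lborel)"
        by (simp only: right_diff_distrib Bochner_Integration.integral_diff[OF i])
      also have "norm \<dots> \<le> ?A * sqrt (\<integral>\<xi>. (cmod (U R \<xi> - v' \<xi>))\<^sup>2 \<partial>lborel)"
        by (rule complex_integrable_mult_of_squares(2)) (use E2 d2 in simp_all)
      also have "sqrt (\<integral>\<xi>. (cmod (U R \<xi> - v' \<xi>))\<^sup>2 \<partial>lborel) = L2_norm (\<lambda>\<xi>. U R \<xi> - v \<xi>)"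
        using v' by (intro L2_iff_borel(2)[symmetric]) (auto elim: eventually_mono)
      finally show ?case .
    qed
  qed
  then have lim1: "((\<lambda>R. (\<integral>\<xi>. ?E \<xi> * U R \<xi> \<partial>lborel)) \<longlongrightarrow> (\<integral>\<xi>. ?E \<xi> * v' \<xi> \<partial>lborel)) at_top"
    by (rule Lim_transform[OF tendsto_const])
  have eq: "(\<integral>\<xi>. ?E \<xi> * U R \<xi> \<partial>lborel) = ?c * (2 * pi) * (\<integral>y. indicator {-R..R} y *\<^sub>R (complex_of_real (poisson s (x - y)) * u' y) \<partial>lborel)" for R
  proof -
    let ?f = "\<lambda>\<xi> y. ?E \<xi> * (indicator {-R..R} y *\<^sub>R (exp (- \<i> * complex_of_real (\<xi> * y)) * u' y))"
    have "integrable lborel (\<lambda>y. indicator {-R..R} y * cmod (u' y))"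
    proof (rule integrable_mult_of_squares)
      have "integrable lborel (indicator {-R..R} :: real \<Rightarrow> real)" by (rule integrable_indicator_Icc)
      also have "(indicator {-R..R} :: real \<Rightarrow> real) = (\<lambda>y. (indicator {-R..R} y)\<^sup>2)" by (auto split: split_indicator)
      finally show "integrable lborel (\<lambda>y. (indicator {-R..R} y :: real)\<^sup>2)" .
    qed (use u2 in simp_all)
    then have fi: "integrable (lborel \<Otimes>\<^sub>M lborel) (\<lambda>(\<xi>, y). ?f \<xi> y)"
      by (intro integrable_product_bound[OF _ exp_abs_fourier(1)[OF s]]) (simp, auto simp: norm_mult split: split_indicator)
    have "(\<integral>\<xi>. ?E \<xi> * U R \<xi> \<partial>lborel) = (\<integral>\<xi>. ?c * (\<integral>y. ?f \<xi> y \<partial>lborel) \<partial>lborel)"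
      unfolding U_def by (intro Bochner_Integration.integral_cong refl) (simp only: integral_mult_right_zero mult.left_commute)
    also have "\<dots> = ?c * (\<integral>\<xi>. (\<integral>y. ?f \<xi> y \<partial>lborel) \<partial>lborel)" by (rule integral_mult_right_zero)
    also have "(\<integral>\<xi>. (\<integral>y. ?f \<xi> y \<partial>lborel) \<partial>lborel) = (\<integral>y. (\<integral>\<xi>. ?f \<xi> y \<partial>lborel) \<partial>lborel)"
      by (rule lborel_pair.Fubini_integral[OF fi, symmetric])
    also have "\<dots> = (\<integral>y. (2 * pi) * (indicator {-R..R} y *\<^sub>R (complex_of_real (poisson s (x - y)) * u' y)) \<partial>lborel)"
    proof (rule Bochner_Integration.integral_cong[OF refl])
      fix y
      have "(\<integral>\<xi>. ?f \<xi> y \<partial>lborel) = (\<integral>\<xi>. (indicator {-R..R} y *\<^sub>R u' y) * (complex_of_real (exp (- s * \<bar>\<xi>\<bar>)) * exp (\<i> * complex_of_real ((x - y) * \<xi>))) \<partial>lborel)"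
      proof (intro Bochner_Integration.integral_cong refl)
        fix \<xi>
        have "exp (\<i> * complex_of_real ((x - y) * \<xi>)) = exp (\<i> * complex_of_real (x * \<xi>)) * exp (- \<i> * complex_of_real (\<xi> * y))"
          by (simp add: exp_add[symmetric] algebra_simps)
        then show "?f \<xi> y = (indicator {-R..R} y *\<^sub>R u' y) * (complex_of_real (exp (- s * \<bar>\<xi>\<bar>)) * exp (\<i> * complex_of_real ((x - y) * \<xi>)))"
          by (simp add: scaleR_conv_of_real algebra_simps)
      qed
      also have "\<dots> = (indicator {-R..R} y *\<^sub>R u' y) * complex_of_real (2 * pi * poisson s (x - y))"
        by (simp only: integral_mult_right_zero exp_abs_fourier(2)[OF s])
      finally show "(\<integral>\<xi>. ?f \<xi> y \<partial>lborel) = (2 * pi) * (indicator {-R..R} y *\<^sub>R (complex_of_real (poisson s (x - y)) * u' y))"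
        by (simp add: scaleR_conv_of_real algebra_simps)
    qed
    finally show ?thesis by (simp only: integral_mult_right_zero mult.assoc)
  qed
  have pu: "integrable lborel (\<lambda>y. complex_of_real (poisson s (x - y)) * u' y)"
    by (rule complex_integrable_mult_of_squares) (use u2 integrable_poisson_square[OF s, of x] in simp_all)
  have lim2: "((\<lambda>R. \<integral>y. indicator {-R..R} y *\<^sub>R (complex_of_real (poisson s (x - y)) * u' y) \<partial>lborel) \<longlongrightarrow> poisson_conv s u' x) at_top"
    unfolding poisson_conv_def
  proof (rule integral_dominated_convergence_at_top[where w="\<lambda>y. cmod (complex_of_real (poisson s (x - y)) * u' y)"])
    show "AE y in lborel. ((\<lambda>R. indicator {-R..R} y *\<^sub>R (complex_of_real (poisson s (x - y)) * u' y)) \<longlongrightarrow> complex_of_real (poisson s (x - y)) * u' y) at_top"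
    proof (rule AE_I2)
      fix y :: real
      have "\<forall>\<^sub>F R in at_top. indicator {-R..R} y *\<^sub>R (complex_of_real (poisson s (x - y)) * u' y) = complex_of_real (poisson s (x - y)) * u' y"
        using eventually_ge_at_top[of "\<bar>y\<bar>"] by eventually_elim (auto split: split_indicator)
      then show "((\<lambda>R. indicator {-R..R} y *\<^sub>R (complex_of_real (poisson s (x - y)) * u' y)) \<longlongrightarrow> complex_of_real (poisson s (x - y)) * u' y) at_top"
        by (rule tendsto_eventually)
    qed
    show "\<forall>\<^sub>F R in at_top. AE y in lborel. norm (indicator {-R..R} y *\<^sub>R (complex_of_real (poisson s (x - y)) * u' y)) \<le> cmod (complex_of_real (poisson s (x - y)) * u' y)"
      by (intro always_eventually allI AE_I2) (auto split: split_indicator)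
  qed (use pu in simp_all)
  have "(\<integral>\<xi>. ?E \<xi> * v' \<xi> \<partial>lborel) = ?c * (2 * pi) * poisson_conv s u' x"
    using tendsto_unique[OF _ lim1[unfolded eq] tendsto_mult_left[OF lim2]] by simp
  moreover have "?c * (?c * (2 * pi)) = 1"
    by (simp add: of_real_mult[symmetric] del: of_real_mult of_real_divide)
  ultimately show ?thesis by (simp add: mult.assoc[symmetric])
qed

section \<open>The generator of the Poisson semigroup\<close>

text \<open>The integrated form of \<open>d/ds (P\<^sub>s u) = - P\<^sub>s \<bar>D\<bar>u\<close>. On the Fourier side it says that \<open>\<bar>\<xi>\<bar> exp (- s \<bar>\<xi>\<bar>)\<close> integrates to
\<open>exp (- a \<bar>\<xi>\<bar>) - exp (- b \<bar>\<xi>\<bar>)\<close> over the interval from \<open>a\<close> to \<open>b\<close>.\<close>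

lemma abs_D_semigroup:
  fixes u g u' g' :: "real \<Rightarrow> complex"
  assumes D: "abs_D u g" and ab: "0 < a" "a \<le> b"
    and u': "AE x in lborel. u x = u' x" and [measurable]: "u' \<in> borel_measurable borel"
    and g': "AE x in lborel. g x = g' x" and [measurable]: "g' \<in> borel_measurable borel"
  shows "poisson_conv a u' x - poisson_conv b u' x = (\<integral>s. indicator {a..b} s *\<^sub>R poisson_conv s g' x \<partial>lborel)"
proof -
  let ?c = "complex_of_real (1 / sqrt (2 * pi))"
  obtain v where v: "L2_fourier u v" "L2_fourier g (\<lambda>\<xi>. complex_of_real \<bar>\<xi>\<bar> * v \<xi>)"
    using D unfolding abs_D_def by blast
  then have vL: "v \<in> L2" "(\<lambda>\<xi>. complex_of_real \<bar>\<xi>\<bar> * v \<xi>) \<in> L2"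
    unfolding L2_fourier_def L2_tendsto_def by auto
  then have "v \<in> borel_measurable lebesgue" unfolding L2_def by simp
  then obtain v' where v'[measurable]: "v' \<in> borel_measurable borel" and vv: "AE x in lborel. v x = v' x"
    using complex_borel_version by blast
  have vv2: "AE \<xi> in lborel. complex_of_real \<bar>\<xi>\<bar> * v \<xi> = complex_of_real \<bar>\<xi>\<bar> * v' \<xi>"
    using vv by eventually_elim simp
  let ?E = "\<lambda>s \<xi>. complex_of_real (exp (- s * \<bar>\<xi>\<bar>)) * exp (\<i> * complex_of_real (x * \<xi>))"
  have Pu: "poisson_conv s u' x = ?c * (\<integral>\<xi>. ?E s \<xi> * v' \<xi> \<partial>lborel)" if "0 < s" for s
    by (rule poisson_conv_fourier[OF v(1) that u' _ vv]) simp_all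
  have Pg: "poisson_conv s g' x = ?c * (\<integral>\<xi>. ?E s \<xi> * (complex_of_real \<bar>\<xi>\<bar> * v' \<xi>) \<partial>lborel)" if "0 < s" for s
    by (rule poisson_conv_fourier[OF v(2) that g' _ vv2]) simp_all
  have v2: "integrable lborel (\<lambda>x. (cmod (v' x))\<^sup>2)" using vL(1) L2_iff_borel(1)[OF vv] by simp
  have w2: "integrable lborel (\<lambda>\<xi>. (cmod (complex_of_real \<bar>\<xi>\<bar> * v' \<xi>))\<^sup>2)" using vL(2) L2_iff_borel(1)[OF vv2] by simp
  have i: "integrable lborel (\<lambda>\<xi>. ?E s \<xi> * v' \<xi>)" if "0 < s" for s
    by (rule complex_integrable_mult_of_squares) (use exp_weight_square[OF that, of x] v2 in simp_all)
  have "integrable lborel (\<lambda>\<xi>. ?E a \<xi> * (complex_of_real \<bar>\<xi>\<bar> * v' \<xi>))"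
    by (rule complex_integrable_mult_of_squares) (use exp_weight_square[OF ab(1), of x] w2 in simp_all)
  then have h: "integrable lborel (\<lambda>\<xi>. cmod (?E a \<xi> * (complex_of_real \<bar>\<xi>\<bar> * v' \<xi>)))" by (rule integrable_norm)
  let ?f = "\<lambda>s \<xi>. indicator {a..b} s *\<^sub>R (?E s \<xi> * (complex_of_real \<bar>\<xi>\<bar> * v' \<xi>))"
  have ind: "integrable lborel (indicator {a..b} :: real \<Rightarrow> real)" by (rule integrable_indicator_Icc)
  have f: "integrable (lborel \<Otimes>\<^sub>M lborel) (\<lambda>(s, \<xi>). ?f s \<xi>)"
  proof (rule integrable_product_bound[OF _ ind h])
    fix s \<xi>
    have "a \<le> s \<Longrightarrow> exp (- (s * \<bar>\<xi>\<bar>)) \<le> exp (- (a * \<bar>\<xi>\<bar>))" by (simp add: mult_right_mono)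
    then show "norm (case (s, \<xi>) of (s, \<xi>) \<Rightarrow> ?f s \<xi>) \<le> indicator {a..b} s * cmod (?E a \<xi> * (complex_of_real \<bar>\<xi>\<bar> * v' \<xi>))"
      by (auto simp: norm_mult mult_right_mono split: split_indicator)
  qed measurable
  have "(\<integral>s. indicator {a..b} s *\<^sub>R poisson_conv s g' x \<partial>lborel) = (\<integral>s. ?c * (\<integral>\<xi>. ?f s \<xi> \<partial>lborel) \<partial>lborel)"
    using ab by (intro Bochner_Integration.integral_cong refl) (simp add: Pg split: split_indicator)
  also have "\<dots> = ?c * (\<integral>s. (\<integral>\<xi>. ?f s \<xi> \<partial>lborel) \<partial>lborel)" by (rule integral_mult_right_zero)
  also have "(\<integral>s. (\<integral>\<xi>. ?f s \<xi> \<partial>lborel) \<partial>lborel) = (\<integral>\<xi>. (\<integral>s. ?f s \<xi> \<partial>lborel) \<partial>lborel)"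
    by (rule lborel_pair.Fubini_integral[OF f, symmetric])
  also have "\<dots> = (\<integral>\<xi>. ?E a \<xi> * v' \<xi> - ?E b \<xi> * v' \<xi> \<partial>lborel)"
  proof (rule Bochner_Integration.integral_cong[OF refl])
    fix \<xi> :: real
    have "(\<integral>s. ?f s \<xi> \<partial>lborel) = (\<integral>s. complex_of_real (indicator {a..b} s *\<^sub>R (\<bar>\<xi>\<bar> * exp (- s * \<bar>\<xi>\<bar>))) * (exp (\<i> * complex_of_real (x * \<xi>)) * v' \<xi>) \<partial>lborel)"
      by (intro Bochner_Integration.integral_cong refl) (simp add: scaleR_conv_of_real algebra_simps)
    also have "\<dots> = complex_of_real (\<integral>s. indicator {a..b} s *\<^sub>R (\<bar>\<xi>\<bar> * exp (- s * \<bar>\<xi>\<bar>)) \<partial>lborel) * (exp (\<i> * complex_of_real (x * \<xi>)) * v' \<xi>)"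
      by (simp only: integral_mult_left_zero integral_complex_of_real)
    also have "(\<integral>s. indicator {a..b} s *\<^sub>R (\<bar>\<xi>\<bar> * exp (- s * \<bar>\<xi>\<bar>)) \<partial>lborel) = - exp (- b * \<bar>\<xi>\<bar>) - (- exp (- a * \<bar>\<xi>\<bar>))"
    proof (rule integral_FTC_atLeastAtMost[OF ab(2)])
      fix s
      have "((\<lambda>s. - exp (- s * \<bar>\<xi>\<bar>)) has_real_derivative \<bar>\<xi>\<bar> * exp (- s * \<bar>\<xi>\<bar>)) (at s within {a..b})"
        by (auto intro!: derivative_eq_intros)
      then show "((\<lambda>s. - exp (- s * \<bar>\<xi>\<bar>)) has_vector_derivative \<bar>\<xi>\<bar> * exp (- s * \<bar>\<xi>\<bar>)) (at s within {a..b})"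
        by (simp add: has_real_derivative_iff_has_vector_derivative)
    qed (auto intro!: continuous_intros)
    finally show "(\<integral>s. ?f s \<xi> \<partial>lborel) = ?E a \<xi> * v' \<xi> - ?E b \<xi> * v' \<xi>"
      by (simp add: algebra_simps)
  qed
  also have "?c * \<dots> = poisson_conv a u' x - poisson_conv b u' x"
    using Bochner_Integration.integral_diff[OF i[of a] i[of b]] Pu[of a] Pu[of b] ab by (simp add: right_diff_distrib)
  finally show ?thesis ..
qed

definition poisson_mean :: "real \<Rightarrow> (real \<Rightarrow> real) \<Rightarrow> real \<Rightarrow> real" where
  "poisson_mean s f x = (\<integral>y. poisson s (x - y) * f y \<partial>lborel)"

lemma poisson_conv_of_real: "poisson_conv s (\<lambda>y. complex_of_real (f y)) x = complex_of_real (poisson_mean s f x)"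
  unfolding poisson_conv_def poisson_mean_def by (simp only: of_real_mult[symmetric] integral_complex_of_real)

lemma poisson_mean_measurable [measurable]:
  assumes [measurable]: "f \<in> borel_measurable borel"
  shows "(\<lambda>(s, x). poisson_mean s f x) \<in> borel_measurable (borel \<Otimes>\<^sub>M borel)"
  unfolding poisson_mean_def by measurable

lemma poisson_mean_tendsto:
  fixes a :: "nat \<Rightarrow> real"
  assumes [measurable]: "f \<in> borel_measurable borel"
    and f: "sqint f < top" and a: "\<And>n. 0 < a n" "a \<longlonglongrightarrow> 0"
  shows "(\<lambda>n. sqint (\<lambda>x. poisson_mean (a n) f x - f x)) \<longlonglongrightarrow> 0"
proof -
  have eq: "poisson_mean (a n) f x = (\<integral>y. poisson 1 ((x - y) / a n) / a n * f y \<partial>lborel)" for n x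
    unfolding poisson_mean_def poisson_dilate[OF a(1)] ..
  show ?thesis unfolding eq
    by (rule approximate_identity[where B=1]) (use poisson_1_even poisson_1_le nn_integral_poisson_1 poisson_nonneg[of 1] f a in simp_all)
qed

text \<open>The integral is the mean over \<open>s\<close> of the functions \<open>P\<^sub>s g - g\<close>, all of which are small, so Jensen's inequality applies.\<close>

lemma poisson_mean_defect_integral:
  assumes [measurable]: "g \<in> borel_measurable borel"
    and g: "sqint g < top" and ab: "0 < a" "a \<le> b" 
    and close: "\<And>s. 0 < s \<Longrightarrow> s \<le> b \<Longrightarrow> sqint (\<lambda>x. poisson_mean s g x - g x) \<le> \<epsilon>"
  shows "sqint (\<lambda>x. (\<integral>s. indicator {a..b} s * poisson_mean s g x \<partial>lborel) - (b - a) * g x) \<le> ennreal ((b - a)\<^sup>2) * \<epsilon>"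
proof -
  have ind: "integrable lborel (indicator {a..b} :: real \<Rightarrow> real)" by (rule integrable_indicator_Icc)
  have indv: "(\<integral>\<^sup>+s. ennreal (indicator {a..b} s) \<partial>lborel) = ennreal (b - a)"
    using ab by (simp add: ennreal_indicator)
  have g2: "integrable lborel (\<lambda>x. (g x)\<^sup>2)" using g by (simp add: sqint_finite_iff)
  have i: "integrable lborel (\<lambda>s. indicator {a..b} s * poisson_mean s g x)" for x
  proof -
    have "integrable lborel (\<lambda>y. poisson a (x - y) * g y)"
      by (rule integrable_mult_of_squares) (use integrable_poisson_square[OF ab(1)] g2 in simp_all)
    then have h: "integrable lborel (\<lambda>y. b / a * \<bar>poisson a (x - y) * g y\<bar>)" by (intro integrable_mult_right integrable_abs)
    have "integrable (lborel \<Otimes>\<^sub>M lborel) (\<lambda>(s, y). indicator {a..b} s * (poisson s (x - y) * g y))"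
    proof (rule integrable_product_bound[OF _ ind h])
      fix s y
      have "poisson s z \<le> b / a * poisson a z" if "a \<le> s" "s \<le> b" for z
      proof -
        have "s / (pi * (s\<^sup>2 + z\<^sup>2)) \<le> b / (pi * (a\<^sup>2 + z\<^sup>2))"
          using that ab by (intro frac_le mult_left_mono add_right_mono power_mono mult_pos_pos add_pos_nonneg) auto
        then show ?thesis using ab unfolding poisson_def by simp
      qed
      then have "poisson s (x - y) * \<bar>g y\<bar> \<le> b / a * poisson a (x - y) * \<bar>g y\<bar>" if "a \<le> s" "s \<le> b"
        using that by (intro mult_right_mono) auto
      then show "norm (case (s, y) of (s, y) \<Rightarrow> indicator {a..b} s * (poisson s (x - y) * g y)) \<le> indicator {a..b} s * (b / a * \<bar>poisson a (x - y) * g y\<bar>)"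
        using ab poisson_nonneg[of a "x - y"] poisson_nonneg[of s "x - y"]
        by (auto simp: abs_mult split: split_indicator)
    qed measurable
    from lborel_pair.integrable_fst'[OF this] show ?thesis
      unfolding poisson_mean_def by simp
  qed
  have diff: "(\<integral>s. indicator {a..b} s * poisson_mean s g x \<partial>lborel) - (b - a) * g x
      = (\<integral>s. indicator {a..b} s * (poisson_mean s g x - g x) \<partial>lborel)" for x
  proof -
    have "(\<integral>s. indicator {a..b} s * (poisson_mean s g x - g x) \<partial>lborel) = (\<integral>s. indicator {a..b} s * poisson_mean s g x - indicator {a..b} s * g x \<partial>lborel)"
      by (simp only: right_diff_distrib)
    also have "\<dots> = (\<integral>s. indicator {a..b} s * poisson_mean s g x \<partial>lborel) - (\<integral>s. indicator {a..b} s * g x \<partial>lborel)"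
      by (rule Bochner_Integration.integral_diff[OF i]) (use ind in simp)
    also have "(\<integral>s. indicator {a..b} s * g x \<partial>lborel) = (b - a) * g x"
      using ab integral_mult_left_zero[of lborel "indicator {a..b}" "g x"] by simp
    finally show ?thesis ..
  qed
  have "sqint (\<lambda>x. (\<integral>s. indicator {a..b} s * poisson_mean s g x \<partial>lborel) - (b - a) * g x)
     \<le> (\<integral>\<^sup>+x. ennreal (b - a) * (\<integral>\<^sup>+s. ennreal (indicator {a..b} s * (poisson_mean s g x - g x)\<^sup>2) \<partial>lborel) \<partial>lborel)"
    unfolding sqint_def diff indv[symmetric]
    by (intro nn_integral_mono jensen_kernel) simp_all
  also have "\<dots> = ennreal (b - a) * (\<integral>\<^sup>+x. (\<integral>\<^sup>+s. ennreal (indicator {a..b} s * (poisson_mean s g x - g x)\<^sup>2) \<partial>lborel) \<partial>lborel)"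
    by (rule nn_integral_cmult) simp
  also have "(\<integral>\<^sup>+x. (\<integral>\<^sup>+s. ennreal (indicator {a..b} s * (poisson_mean s g x - g x)\<^sup>2) \<partial>lborel) \<partial>lborel)
      = (\<integral>\<^sup>+s. (\<integral>\<^sup>+x. ennreal (indicator {a..b} s * (poisson_mean s g x - g x)\<^sup>2) \<partial>lborel) \<partial>lborel)"
    by (rule lborel_pair.Fubini') simp
  also have "\<dots> \<le> (\<integral>\<^sup>+s. ennreal (indicator {a..b} s) * \<epsilon> \<partial>lborel)"
  proof (rule nn_integral_mono)
    fix s
    show "(\<integral>\<^sup>+x. ennreal (indicator {a..b} s * (poisson_mean s g x - g x)\<^sup>2) \<partial>lborel) \<le> ennreal (indicator {a..b} s) * \<epsilon>"
      using close[of s] ab unfolding sqint_def by (auto split: split_indicator)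
  qed
  also have "\<dots> = ennreal (b - a) * \<epsilon>" by (simp add: nn_integral_multc indv)
  finally show ?thesis
    using ab by (simp add: mult_left_mono power2_eq_square ennreal_mult mult.assoc)
qed

text \<open>\<open>\<bar>D\<bar>\<close> is minus the generator of the Poisson semigroup: the difference quotient of \<open>k\<close> is the average of \<open>P\<^sub>s g\<close> over
\<open>0 < s < b\<close>, where \<open>g = \<bar>D\<bar>k\<close>, and \<open>P\<^sub>s g\<close> tends to \<open>g\<close>.\<close>

lemma poisson_generator_limit:
  fixes a :: "nat \<Rightarrow> real"
  assumes [measurable]: "k \<in> borel_measurable borel" "g \<in> borel_measurable borel"
    and k: "sqint k < top" and g: "sqint g < top"
    and semi: "\<And>a b x. 0 < a \<Longrightarrow> a \<le> b \<Longrightarrow>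
      poisson_mean a k x - poisson_mean b k x = (\<integral>s. indicator {a..b} s * poisson_mean s g x \<partial>lborel)"
    and a: "\<And>n. 0 < a n" "a \<longlonglongrightarrow> 0"
  shows "(\<lambda>n. sqint (\<lambda>x. (k x - poisson_mean (a n) k x) / a n - g x)) \<longlonglongrightarrow> 0"
proof -
  have atr: "((\<lambda>s. sqint (\<lambda>x. poisson_mean s g x - g x)) \<longlongrightarrow> 0) (at_right 0)"
    unfolding tendsto_at_iff_sequentially comp_def
    using poisson_mean_tendsto[of g] g by auto
  have bound: "sqint (\<lambda>x. (k x - poisson_mean b k x) / b - g x) \<le> 2 * \<epsilon>"
    if b: "0 < b" and close: "\<And>s. 0 < s \<Longrightarrow> s \<le> b \<Longrightarrow> sqint (\<lambda>x. poisson_mean s g x - g x) \<le> \<epsilon>" for b \<epsilon>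
  proof -
    \<comment> \<open>The semigroup identity needs a positive lower limit; it is sent to 0 along \<open>c\<close>.\<close>
    define c where "c j = b / real (Suc j)" for j
    have c: "0 < c j" "c j \<le> b" for j using b by (auto simp: c_def divide_le_eq)
    have clim: "c \<longlonglongrightarrow> 0" unfolding c_def by (rule LIMSEQ_Suc) (rule lim_const_over_n)
    have step: "sqint (\<lambda>x. k x - poisson_mean b k x - b * g x)
        \<le> 4 * sqint (\<lambda>x. poisson_mean (c j) k x - k x) + 4 * (ennreal ((c j)\<^sup>2) * sqint g) + 2 * (ennreal (b\<^sup>2) * \<epsilon>)" for j
    proof -
      have "sqint (\<lambda>x. k x - poisson_mean b k x - b * g x)
        \<le> 2 * sqint (\<lambda>x. k x - poisson_mean (c j) k x - c j * g x)
        + 2 * sqint (\<lambda>x. (\<integral>s. indicator {c j..b} s * poisson_mean s g x \<partial>lborel) - (b - c j) * g x)"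
        unfolding semi[OF c, symmetric]
        by (rule sqint_add_le) (simp_all add: algebra_simps)
      also have "\<dots> \<le> 2 * (2 * sqint (\<lambda>x. poisson_mean (c j) k x - k x) + 2 * (ennreal ((c j)\<^sup>2) * sqint g)) + 2 * (ennreal (b\<^sup>2) * \<epsilon>)"
      proof (intro add_mono mult_left_mono)
        have "sqint (\<lambda>x. k x - poisson_mean (c j) k x - c j * g x)
          \<le> 2 * sqint (\<lambda>x. (-1) * (poisson_mean (c j) k x - k x)) + 2 * sqint (\<lambda>x. (- c j) * g x)"
          by (rule sqint_add_le) simp_all
        also have "\<dots> = 2 * sqint (\<lambda>x. poisson_mean (c j) k x - k x) + 2 * (ennreal ((c j)\<^sup>2) * sqint g)"
          by (subst (1 2) sqint_cmult) simp_all
        finally show "sqint (\<lambda>x. k x - poisson_mean (c j) k x - c j * g x)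
          \<le> 2 * sqint (\<lambda>x. poisson_mean (c j) k x - k x) + 2 * (ennreal ((c j)\<^sup>2) * sqint g)" .
        have "sqint (\<lambda>x. (\<integral>s. indicator {c j..b} s * poisson_mean s g x \<partial>lborel) - (b - c j) * g x) \<le> ennreal ((b - c j)\<^sup>2) * \<epsilon>"
          by (rule poisson_mean_defect_integral) (use g c close in simp_all)
        also have "\<dots> \<le> ennreal (b\<^sup>2) * \<epsilon>"
          using c[of j] by (intro mult_right_mono ennreal_leI power_mono) auto
        finally show "sqint (\<lambda>x. (\<integral>s. indicator {c j..b} s * poisson_mean s g x \<partial>lborel) - (b - c j) * g x) \<le> ennreal (b\<^sup>2) * \<epsilon>" .
      qed simp_all
      also have "\<dots> = 4 * sqint (\<lambda>x. poisson_mean (c j) k x - k x) + 4 * (ennreal ((c j)\<^sup>2) * sqint g) + 2 * (ennreal (b\<^sup>2) * \<epsilon>)"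
        by (simp add: distrib_left mult.assoc[symmetric])
      finally show ?thesis .
    qed
    have l1: "(\<lambda>j. sqint (\<lambda>x. poisson_mean (c j) k x - k x)) \<longlonglongrightarrow> 0"
      by (rule poisson_mean_tendsto) (use k c clim in simp_all)
    have l2: "(\<lambda>j. sqint g * ennreal ((c j)\<^sup>2)) \<longlonglongrightarrow> sqint g * ennreal (0\<^sup>2)"
      using g by (intro ennreal_tendsto_cmult tendsto_ennrealI tendsto_power clim) auto
    have l2': "(\<lambda>j. ennreal ((c j)\<^sup>2) * sqint g) \<longlonglongrightarrow> 0" using l2 by (simp add: mult.commute)
    have "(\<lambda>j. 4 * sqint (\<lambda>x. poisson_mean (c j) k x - k x) + 4 * (ennreal ((c j)\<^sup>2) * sqint g) + 2 * (ennreal (b\<^sup>2) * \<epsilon>))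
       \<longlonglongrightarrow> 4 * 0 + 4 * 0 + 2 * (ennreal (b\<^sup>2) * \<epsilon>)"
      by (intro tendsto_add ennreal_tendsto_cmult l1 l2' tendsto_const) simp_all
    then have fin: "sqint (\<lambda>x. k x - poisson_mean b k x - b * g x) \<le> 2 * (ennreal (b\<^sup>2) * \<epsilon>)"
      using step by (intro LIMSEQ_le_const[of _ "2 * (ennreal (b\<^sup>2) * \<epsilon>)"]) auto
    have "sqint (\<lambda>x. (k x - poisson_mean b k x) / b - g x) = sqint (\<lambda>x. (1 / b) * (k x - poisson_mean b k x - b * g x))"
      using b by (intro arg_cong[where f=sqint] ext) (simp add: field_simps)
    also have "\<dots> = ennreal ((1 / b)\<^sup>2) * sqint (\<lambda>x. k x - poisson_mean b k x - b * g x)"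
      by (rule sqint_cmult) simp
    also have "\<dots> \<le> ennreal ((1 / b)\<^sup>2) * (2 * (ennreal (b\<^sup>2) * \<epsilon>))" by (rule mult_left_mono[OF fin]) simp
    also have "\<dots> = 2 * ((ennreal ((1 / b)\<^sup>2) * ennreal (b\<^sup>2)) * \<epsilon>)" by (simp only: mult_ac)
    also have "ennreal ((1 / b)\<^sup>2) * ennreal (b\<^sup>2) = 1"
      using b by (simp add: ennreal_mult[symmetric] power_divide)
    finally show ?thesis by simp
  qed
  show ?thesis
  proof (rule tendsto_0_ennreal_by_approx)
    fix e :: real assume "0 < e"
    then have "\<forall>\<^sub>F s in at_right 0. sqint (\<lambda>x. poisson_mean s g x - g x) < ennreal (e / 2)"
      using atr by (intro order_tendstoD(2)) auto
    then obtain d where d: "0 < d" "\<And>s. 0 < s \<Longrightarrow> s < d \<Longrightarrow> sqint (\<lambda>x. poisson_mean s g x - g x) < ennreal (e / 2)"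
      unfolding eventually_at_right_field by auto
    have ev: "\<forall>\<^sub>F n in sequentially. sqint (\<lambda>x. (k x - poisson_mean (a n) k x) / a n - g x) \<le> ennreal e"
      using order_tendstoD(2)[OF a(2) d(1)]
    proof eventually_elim
      case (elim n)
      have "sqint (\<lambda>x. (k x - poisson_mean (a n) k x) / a n - g x) \<le> 2 * ennreal (e / 2)"
        by (rule bound[OF a(1)]) (use d elim in \<open>auto intro: less_imp_le\<close>)
      also have "\<dots> = ennreal e" using \<open>0 < e\<close> by (simp add: mult_2 ennreal_plus[symmetric] del: ennreal_plus)
      finally show ?case .
    qed
    \<comment> \<open>The bound holds only eventually; the finitely many other terms are absorbed by a sequence that is eventually 0.\<close>
    let ?g = "\<lambda>n. if sqint (\<lambda>x. (k x - poisson_mean (a n) k x) / a n - g x) \<le> ennreal e then 0 else top"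
    have "?g \<longlonglongrightarrow> 0" using ev by (intro tendsto_eventually) (erule eventually_mono, simp)
    then show "\<exists>g'. g' \<longlonglongrightarrow> 0 \<and> (\<forall>n. sqint (\<lambda>x. (k x - poisson_mean (a n) k x) / a n - g x) \<le> g' n + ennreal e)"
      by (intro exI[of _ ?g]) auto
  qed
qed

section \<open>The perturbed Poisson kernel\<close>

text \<open>A Borel version of the symbol makes iterated integrals meaningful, but it is homogeneous only almost everywhere. Growth of
order \<open>\<gamma>\<close> from above and below and continuity at the diagonal off the origin survive in pointwise form.\<close>

locale homogeneous_perturbation =
  fixes T :: "real \<Rightarrow> real \<Rightarrow> real" and c C \<gamma> :: real
  assumes T_measurable [measurable]: "(\<lambda>(x, y). T x y) \<in> borel_measurable (borel \<Otimes>\<^sub>M borel)"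
    and T_sym: "T x y = T y x"
    and c_pos: "0 < c" and C_pos: "0 < C" and \<gamma>_pos: "0 < \<gamma>"
    and T_lower: "c * \<bar>x\<bar> powr \<gamma> \<le> T x y"
    and T_upper: "T x y \<le> C * (\<bar>x\<bar> + \<bar>y\<bar>) powr \<gamma>"
    and T_diag: "x \<noteq> 0 \<Longrightarrow> isCont (\<lambda>z. T (x + z) x) 0"
begin

lemma T_nonneg: "0 \<le> T x y"
  using T_lower[of x y] c_pos by (meson less_imp_le mult_nonneg_nonneg order_trans powr_ge_zero)

definition K :: "real \<Rightarrow> real \<Rightarrow> real \<Rightarrow> real" where
  "K a x y = a / (pi * (a\<^sup>2 + (x - y)\<^sup>2 + a ^ 3 * T x y))"

lemma K_measurable [measurable]: "(\<lambda>(x, y). K a x y) \<in> borel_measurable (borel \<Otimes>\<^sub>M borel)"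
  unfolding K_def by measurable

lemma K_sym: "K a x y = K a y x"
  unfolding K_def by (simp add: T_sym[of x y] power2_commute)

lemma K_denominator: "0 < a \<Longrightarrow> 0 < a\<^sup>2 + (x - y)\<^sup>2 + a ^ 3 * T x y"
  using T_nonneg[of x y] by (simp add: add_pos_nonneg)

lemma K_pos: "0 < a \<Longrightarrow> 0 < K a x y"
  unfolding K_def using K_denominator[of a x y] by simp

lemma K_le_poisson: 
  assumes "0 < a" shows "K a x y \<le> poisson a (x - y)"
proof -
  have "a\<^sup>2 + (x - y)\<^sup>2 \<le> a\<^sup>2 + (x - y)\<^sup>2 + a ^ 3 * T x y" "0 < a\<^sup>2 + (x - y)\<^sup>2"
    using assms T_nonneg[of x y] by (simp_all add: add_pos_nonneg)
  then show ?thesis unfolding K_def poisson_def using assms by (intro divide_left_mono mult_left_mono mult_pos_pos) auto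
qed

definition K_mean :: "real \<Rightarrow> (real \<Rightarrow> real) \<Rightarrow> real \<Rightarrow> real" where
  "K_mean a w x = (\<integral>y. K a x y * w y \<partial>lborel)"

lemma K_mean_measurable [measurable]:
  assumes [measurable]: "w \<in> borel_measurable borel"
  shows "K_mean a w \<in> borel_measurable borel"
  unfolding K_mean_def by measurable

lemma integrable_K_square:
  assumes a: "0 < a"
  shows "integrable lborel (\<lambda>y. (K a x y)\<^sup>2)"
proof (rule Bochner_Integration.integrable_bound[OF integrable_poisson_square[OF a, of x]])
  show "AE y in lborel. norm ((K a x y)\<^sup>2) \<le> norm ((poisson a (x - y))\<^sup>2)"
    using K_le_poisson[OF a] K_pos[OF a] by (intro AE_I2) (simp add: power_mono less_imp_le)
qed simp

lemma integrable_K_mult: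
  assumes "0 < a" and [measurable]: "w \<in> borel_measurable borel" and "integrable lborel (\<lambda>y. (w y)\<^sup>2)"
  shows "integrable lborel (\<lambda>y. K a x y * w y)"
  by (rule integrable_mult_of_squares) (use assms integrable_K_square in simp_all)

lemma integrable_K: "0 < a \<Longrightarrow> integrable lborel (K a x)"
  by (rule Bochner_Integration.integrable_bound[OF integrable_poisson[of a x]])
     (use K_le_poisson[of a x] K_pos[of a x] in \<open>auto intro!: AE_I2 simp: less_imp_le poisson_nonneg\<close>)

text \<open>A weight that dominates all remainders of the kernel expansion below.\<close>

definition W :: "real \<Rightarrow> real" where
  "W y = 2 + 2 * (C * 2 powr \<gamma> * (1 + \<bar>y\<bar>) powr \<gamma>)"

lemma W_measurable [measurable]: "W \<in> borel_measurable borel"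
  unfolding W_def by measurable

lemma T_le_near:
  assumes "\<bar>x - y\<bar> \<le> 1"
  shows "T x y \<le> C * 2 powr \<gamma> * (1 + \<bar>y\<bar>) powr \<gamma>"
proof -
  have "T x y \<le> C * (\<bar>x\<bar> + \<bar>y\<bar>) powr \<gamma>" by (rule T_upper)
  also have "\<dots> \<le> C * (2 * (1 + \<bar>y\<bar>)) powr \<gamma>"
    using assms C_pos \<gamma>_pos by (intro mult_left_mono powr_mono2) auto
  also have "\<dots> = C * 2 powr \<gamma> * (1 + \<bar>y\<bar>) powr \<gamma>"
    by (subst powr_mult) simp_all
  finally show ?thesis .
qed

text \<open>After division by \<open>a\<close>, the loss of mass of the Poisson kernel is the sum of a dilated kernel of mass 1 weighted
by half the diagonal value of the symbol, a remainder near the diagonal, and a remainder far from it. Near the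
diagonal the natural scale is \<open>a\<close>; far from it the kernel is compared with the Poisson kernel at scale 1, because there
the symbol may outgrow the decay of the dilated kernel, while the loss of mass is always bounded by \<open>P\<^sub>a / a\<close>.\<close>

definition defect :: "real \<Rightarrow> real \<Rightarrow> real \<Rightarrow> real" where
  "defect a x y = (poisson a (x - y) - K a x y) / a"

definition near_remainder :: "real \<Rightarrow> real \<Rightarrow> real \<Rightarrow> real" where
  "near_remainder a x y = (if \<bar>x - y\<bar> \<le> 1
     then T x y / 2 * ((a\<^sup>2 + (x - y)\<^sup>2) / (a\<^sup>2 + (x - y)\<^sup>2 + a ^ 3 * T x y)) - T y y / 2 else 0)"

definition far_remainder :: "real \<Rightarrow> real \<Rightarrow> real \<Rightarrow> real" where
  "far_remainder a x y = (if \<bar>x - y\<bar> \<le> 1 then 0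
     else (defect a x y - cauchy_square ((x - y) / a) / a * (T y y / 2)) / poisson 1 (x - y))"

lemma T_diag_measurable [measurable]: "(\<lambda>y. T y y) \<in> borel_measurable borel"
  using measurable_compose[of "\<lambda>y. (y, y)" borel "borel \<Otimes>\<^sub>M borel" "\<lambda>(x, y). T x y" borel] by simp

lemma remainder_measurable [measurable]:
  "(\<lambda>(x, y). defect a x y) \<in> borel_measurable (borel \<Otimes>\<^sub>M borel)"
  "(\<lambda>(x, y). near_remainder a x y) \<in> borel_measurable (borel \<Otimes>\<^sub>M borel)"
  "(\<lambda>(x, y). far_remainder a x y) \<in> borel_measurable (borel \<Otimes>\<^sub>M borel)"
proof -
  show [measurable]: "(\<lambda>(x, y). defect a x y) \<in> borel_measurable (borel \<Otimes>\<^sub>M borel)"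
    unfolding defect_def by measurable
  show "(\<lambda>(x, y). near_remainder a x y) \<in> borel_measurable (borel \<Otimes>\<^sub>M borel)"
    unfolding near_remainder_def by measurable
  show "(\<lambda>(x, y). far_remainder a x y) \<in> borel_measurable (borel \<Otimes>\<^sub>M borel)"
    unfolding far_remainder_def by measurable
qed

lemma cauchy_square_dilate: "0 < a \<Longrightarrow> cauchy_square (z / a) / a = 2 * a ^ 3 / (pi * (a\<^sup>2 + z\<^sup>2)\<^sup>2)"
proof -
  assume a: "0 < a"
  then have e: "a\<^sup>2 + z\<^sup>2 = a\<^sup>2 * (1 + (z / a)\<^sup>2)" by (simp add: field_simps)
  have "2 / (pi * q\<^sup>2) / a = 2 * a ^ 3 / (pi * (a\<^sup>2 * q)\<^sup>2)" for q
    using a by (simp add: power_mult_distrib power2_eq_square power3_eq_cube)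
  then show ?thesis unfolding cauchy_square_def e .
qed

lemma defect_eq:
  assumes a: "0 < a"
  shows "defect a x y = a ^ 3 * T x y / (pi * ((a\<^sup>2 + (x - y)\<^sup>2) * (a\<^sup>2 + (x - y)\<^sup>2 + a ^ 3 * T x y)))"
proof -
  have u: "a\<^sup>2 + (x - y)\<^sup>2 \<noteq> 0" using a by (simp add: add_nonneg_eq_0_iff)
  have v: "a\<^sup>2 + (x - y)\<^sup>2 + a ^ 3 * T x y \<noteq> 0" using K_denominator[OF a, of x y] by simp
  have "(a / (pi * p) - a / (pi * (p + q))) / a = q / (pi * (p * (p + q)))" if "p \<noteq> 0" "p + q \<noteq> 0" for p q
    using that a by (simp add: divide_simps) (simp add: algebra_simps)
  from this[OF u v] show ?thesis unfolding defect_def K_def poisson_def .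
qed

lemma defect_nonneg: "0 < a \<Longrightarrow> 0 \<le> defect a x y"
  unfolding defect_def using K_le_poisson[of a x y] by simp

lemma defect_split:
  assumes a: "0 < a"
  shows "defect a x y = cauchy_square ((x - y) / a) / a * (T y y / 2)
     + cauchy_square ((x - y) / a) / a * near_remainder a x y + poisson 1 (x - y) * far_remainder a x y"
proof (cases "\<bar>x - y\<bar> \<le> 1")
  case True
  let ?p = "a\<^sup>2 + (x - y)\<^sup>2" and ?r = "a\<^sup>2 + (x - y)\<^sup>2 + a ^ 3 * T x y"
  have p: "?p \<noteq> 0" using a by (simp add: add_nonneg_eq_0_iff)
  have "defect a x y = cauchy_square ((x - y) / a) / a * (T x y / 2 * (?p / ?r))"
  proof -
    have "u * t / (pi * (p * r)) = 2 * u / (pi * p\<^sup>2) * (t / 2 * (p / r))" if "p \<noteq> 0" for u t p r :: real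
      using that by (simp add: power2_eq_square)
    from this[OF p] show ?thesis unfolding defect_eq[OF a] cauchy_square_dilate[OF a] .
  qed
  then show ?thesis using True unfolding near_remainder_def far_remainder_def by (simp add: algebra_simps)
next
  case False
  then show ?thesis using poisson_pos[of 1 "x - y"] unfolding near_remainder_def far_remainder_def by simp
qed

lemma near_remainder_le: 
  assumes a: "0 < a" shows "\<bar>near_remainder a x y\<bar> \<le> W y"
proof (cases "\<bar>x - y\<bar> \<le> 1")
  case True
  let ?B = "C * 2 powr \<gamma> * (1 + \<bar>y\<bar>) powr \<gamma>"
  let ?q = "(a\<^sup>2 + (x - y)\<^sup>2) / (a\<^sup>2 + (x - y)\<^sup>2 + a ^ 3 * T x y)"
  have q: "0 \<le> ?q" "?q \<le> 1" using K_denominator[OF a, of x y] T_nonneg[of x y] a by (simp_all add: divide_le_eq)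
  have t: "T x y \<le> ?B" "T y y \<le> ?B" using T_le_near[OF True] T_le_near[of y y] by simp_all
  have "0 \<le> T x y / 2 * ?q" using q T_nonneg[of x y] by (intro mult_nonneg_nonneg) auto
  moreover have "T x y / 2 * ?q \<le> T x y / 2 * 1" using q T_nonneg[of x y] by (intro mult_left_mono) auto
  ultimately have "\<bar>T x y / 2 * ?q - T y y / 2\<bar> \<le> 2 + 2 * ?B"
    using t T_nonneg[of x y] T_nonneg[of y y] by linarith
  then show ?thesis using True unfolding near_remainder_def W_def by simp
next
  case False
  have "0 \<le> C * 2 powr \<gamma> * (1 + \<bar>y\<bar>) powr \<gamma>" using C_pos by simp
  then show ?thesis using False unfolding near_remainder_def W_def by simp
qed

lemma far_remainder_le:
  assumes a: "0 < a" "a \<le> 1" shows "\<bar>far_remainder a x y\<bar> \<le> W y"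
proof (cases "\<bar>x - y\<bar> \<le> 1")
  case True
  have "0 \<le> C * 2 powr \<gamma> * (1 + \<bar>y\<bar>) powr \<gamma>" using C_pos by simp
  then show ?thesis using True unfolding far_remainder_def W_def by simp
next
  case False
  let ?z = "x - y" and ?B = "C * 2 powr \<gamma> * (1 + \<bar>y\<bar>) powr \<gamma>"
  have z1: "1 < ?z\<^sup>2" 
  proof -
    have "1 < \<bar>?z\<bar> ^ 2" using False by (intro one_less_power) auto
    then show ?thesis by simp
  qed
  have z0: "0 < ?z\<^sup>2" using z1 by linarith
  have az: "0 < a\<^sup>2 + ?z\<^sup>2" using z0 by (intro add_nonneg_pos) simp
  have p: "2 * poisson 1 ?z = 2 / (pi * (1 + ?z\<^sup>2))" unfolding poisson_def by simp
  have le: "1 / (pi * ?z\<^sup>2) \<le> 2 * poisson 1 ?z"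
    unfolding p using z1 by (simp add: divide_simps)
  have "defect a x y \<le> poisson a ?z / a"
    unfolding defect_def using a K_pos[OF a(1), of x y] by (intro divide_right_mono) auto
  also have "\<dots> = 1 / (pi * (a\<^sup>2 + ?z\<^sup>2))" using a unfolding poisson_def by simp
  also have "\<dots> \<le> 1 / (pi * ?z\<^sup>2)" using z0 az by (intro divide_left_mono mult_left_mono mult_pos_pos) auto
  also note le
  finally have d: "defect a x y \<le> 2 * poisson 1 ?z" .
  have "cauchy_square (?z / a) / a \<le> 2 * 1 / (pi * ?z\<^sup>2)"
    unfolding cauchy_square_dilate[OF a(1)]
  proof (intro frac_le mult_left_mono)
    show "a ^ 3 \<le> 1" using a by (simp add: power_le_one)
    have "?z\<^sup>2 = ?z\<^sup>2 * 1" by simp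
    also have "\<dots> \<le> ?z\<^sup>2 * ?z\<^sup>2" using z1 by (intro mult_left_mono) simp_all
    also have "\<dots> \<le> (a\<^sup>2 + ?z\<^sup>2) * (a\<^sup>2 + ?z\<^sup>2)" by (intro mult_mono) auto
    finally show "?z\<^sup>2 \<le> (a\<^sup>2 + ?z\<^sup>2)\<^sup>2" by (simp add: power2_eq_square)
  qed (use z0 z1 a in auto)
  then have q: "cauchy_square (?z / a) / a \<le> 4 * poisson 1 ?z" using le by simp
  have q0: "0 \<le> cauchy_square (?z / a) / a" using a unfolding cauchy_square_def by simp
  have t: "T y y \<le> ?B" using T_le_near[of y y] by simp
  have "cauchy_square (?z / a) / a * (T y y / 2) \<le> 4 * poisson 1 ?z * (?B / 2)"
    using q q0 t T_nonneg[of y y] by (intro mult_mono) auto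
  moreover have "0 \<le> cauchy_square (?z / a) / a * (T y y / 2)"
    by (rule mult_nonneg_nonneg[OF q0]) (simp add: T_nonneg)
  ultimately have "\<bar>defect a x y - cauchy_square (?z / a) / a * (T y y / 2)\<bar> \<le> 2 * poisson 1 ?z + 2 * poisson 1 ?z * ?B"
  proof -
    have "0 \<le> 2 * poisson 1 ?z * ?B" "4 * poisson 1 ?z * (?B / 2) = 2 * poisson 1 ?z * ?B"
      using C_pos poisson_pos[of 1 ?z] by simp_all
    moreover assume "cauchy_square (?z / a) / a * (T y y / 2) \<le> 4 * poisson 1 ?z * (?B / 2)"
      "0 \<le> cauchy_square (?z / a) / a * (T y y / 2)"
    ultimately show ?thesis
      using d defect_nonneg[OF a(1), of x y] poisson_pos[of 1 ?z] unfolding abs_le_iff by linarith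
  qed
  also have "\<dots> = W y * poisson 1 ?z" unfolding W_def by (simp add: algebra_simps)
  finally show ?thesis using False poisson_pos[of 1 ?z] unfolding far_remainder_def by (simp add: abs_divide divide_le_eq)
qed

text \<open>At distance \<open>a s\<close> from the diagonal the quotient in the remainder equals
\<open>(1 + s\<^sup>2) / (1 + s\<^sup>2 + a T)\<close> and tends to 1.\<close>

lemma near_remainder_tendsto:
  fixes a :: "nat \<Rightarrow> real"
  assumes a: "\<And>n. 0 < a n" "a \<longlonglongrightarrow> 0" and y: "y \<noteq> 0"
  shows "(\<lambda>n. near_remainder (a n) (y + a n * s) y) \<longlonglongrightarrow> 0"
proof -
  let ?t = "\<lambda>n. T (y + a n * s) y"
  have as: "(\<lambda>n. a n * s) \<longlonglongrightarrow> 0" using tendsto_mult_right[OF a(2), of s] by simp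
  have t: "?t \<longlonglongrightarrow> T y y"
    using isCont_tendsto_compose[OF T_diag[OF y] as] by simp
  have "(\<lambda>n. ?t n / 2 * ((1 + s\<^sup>2) / (1 + s\<^sup>2 + a n * ?t n)) - T y y / 2) \<longlonglongrightarrow> T y y / 2 * ((1 + s\<^sup>2) / (1 + s\<^sup>2 + 0 * T y y)) - T y y / 2"
    using one_plus_square_pos[of s] by (intro tendsto_intros t a) auto
  then have lim: "(\<lambda>n. ?t n / 2 * ((1 + s\<^sup>2) / (1 + s\<^sup>2 + a n * ?t n)) - T y y / 2) \<longlonglongrightarrow> 0"
    using one_plus_square_pos[of s] by simp
  have "\<forall>\<^sub>F n in sequentially. \<bar>a n * s\<bar> < 1"
    using tendsto_rabs[OF as] by (intro order_tendstoD(2)) auto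
  then have "\<forall>\<^sub>F n in sequentially. ?t n / 2 * ((1 + s\<^sup>2) / (1 + s\<^sup>2 + a n * ?t n)) - T y y / 2 = near_remainder (a n) (y + a n * s) y"
  proof eventually_elim
    case (elim n)
    have "(a n)\<^sup>2 + (y + a n * s - y)\<^sup>2 = (a n)\<^sup>2 * (1 + s\<^sup>2)"
      by (simp add: algebra_simps power_mult_distrib)
    moreover have "(a n)\<^sup>2 + (y + a n * s - y)\<^sup>2 + (a n) ^ 3 * ?t n = (a n)\<^sup>2 * (1 + s\<^sup>2 + a n * ?t n)"
      by (simp add: algebra_simps power_mult_distrib power3_eq_cube power2_eq_square)
    ultimately show ?case using elim a(1)[of n] unfolding near_remainder_def by simp
  qed
  then show ?thesis using lim by (rule Lim_transform_eventually[rotated])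
qed

lemma far_remainder_tendsto:
  fixes a :: "nat \<Rightarrow> real"
  assumes a: "\<And>n. 0 < a n" "a \<longlonglongrightarrow> 0"
  shows "(\<lambda>n. far_remainder (a n) x y) \<longlonglongrightarrow> 0"
proof (cases "\<bar>x - y\<bar> \<le> 1")
  case False
  then have z: "(x - y)\<^sup>2 \<noteq> 0" by auto
  have "(\<lambda>n. (a n ^ 3 * T x y / (pi * (((a n)\<^sup>2 + (x - y)\<^sup>2) * ((a n)\<^sup>2 + (x - y)\<^sup>2 + a n ^ 3 * T x y)))
       - 2 * a n ^ 3 / (pi * ((a n)\<^sup>2 + (x - y)\<^sup>2)\<^sup>2) * (T y y / 2)) / poisson 1 (x - y)) \<longlonglongrightarrow>
      (0 ^ 3 * T x y / (pi * ((0\<^sup>2 + (x - y)\<^sup>2) * (0\<^sup>2 + (x - y)\<^sup>2 + 0 ^ 3 * T x y)))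
       - 2 * 0 ^ 3 / (pi * (0\<^sup>2 + (x - y)\<^sup>2)\<^sup>2) * (T y y / 2)) / poisson 1 (x - y)"
    using z poisson_pos[of 1 "x - y"] by (intro tendsto_intros a) auto
  then show ?thesis using False unfolding far_remainder_def by (simp add: defect_eq[OF a(1)] cauchy_square_dilate[OF a(1)])
qed (simp add: far_remainder_def)

section \<open>First order expansion on the ground state\<close>

text \<open>Jensen's inequality with weights \<open>cauchy_square\<close>, then dominated convergence in \<open>y\<close> and in the rescaled distance \<open>s\<close>.\<close>

lemma near_remainder_sqint:
  fixes a :: "nat \<Rightarrow> real"
  assumes [measurable]: "k \<in> borel_measurable borel"
    and Wk: "sqint (\<lambda>y. W y * k y) < top"
    and a: "\<And>n. 0 < a n" "\<And>n. a n \<le> 1" "a \<longlonglongrightarrow> 0"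
  shows "(\<lambda>n. sqint (\<lambda>x. \<integral>y. cauchy_square ((x - y) / a n) / a n * (near_remainder (a n) x y * k y) \<partial>lborel)) \<longlonglongrightarrow> 0"
proof -
  have even: "cauchy_square (- t) = cauchy_square t" and nn: "0 \<le> cauchy_square t" for t
    unfolding cauchy_square_def by simp_all
  have key: "sqint (\<lambda>x. \<integral>y. cauchy_square ((x - y) / b) / b * (near_remainder b x y * k y) \<partial>lborel)
     \<le> (\<integral>\<^sup>+p. (case p of (y, s) \<Rightarrow> ennreal (cauchy_square s * (near_remainder b (y + b * s) y * k y)\<^sup>2)) \<partial>(lborel \<Otimes>\<^sub>M lborel))"
    if b: "0 < b" for b
  proof -
    have mass: "(\<integral>\<^sup>+y. ennreal (cauchy_square ((x - y) / b) / b) \<partial>lborel) = 1" for x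
      using nn_integral_dilate_sub[of cauchy_square "\<lambda>_. 1" b x] even nn b nn_integral_cauchy_square by simp
    have "sqint (\<lambda>x. \<integral>y. cauchy_square ((x - y) / b) / b * (near_remainder b x y * k y) \<partial>lborel)
      \<le> (\<integral>\<^sup>+x. \<integral>\<^sup>+y. ennreal (cauchy_square ((x - y) / b) / b * (near_remainder b x y * k y)\<^sup>2) \<partial>lborel \<partial>lborel)"
      unfolding sqint_def
    proof (rule nn_integral_mono)
      fix x
      show "ennreal ((\<integral>y. cauchy_square ((x - y) / b) / b * (near_remainder b x y * k y) \<partial>lborel)\<^sup>2)
        \<le> (\<integral>\<^sup>+y. ennreal (cauchy_square ((x - y) / b) / b * (near_remainder b x y * k y)\<^sup>2) \<partial>lborel)"
        using jensen_kernel[of "\<lambda>y. cauchy_square ((x - y) / b) / b" lborel "\<lambda>y. near_remainder b x y * k y"] nn b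
        unfolding mass by simp
    qed
    also have "\<dots> = (\<integral>\<^sup>+y. \<integral>\<^sup>+x. ennreal (cauchy_square ((x - y) / b) / b * (near_remainder b x y * k y)\<^sup>2) \<partial>lborel \<partial>lborel)"
      by (rule lborel_pair.Fubini') simp
    also have "\<dots> = (\<integral>\<^sup>+y. \<integral>\<^sup>+s. ennreal (cauchy_square s * (near_remainder b (y + b * s) y * k y)\<^sup>2) \<partial>lborel \<partial>lborel)"
    proof (rule nn_integral_cong)
      fix y
      have "(\<integral>\<^sup>+x. ennreal (cauchy_square ((x - y) / b) / b * (near_remainder b x y * k y)\<^sup>2) \<partial>lborel)
          = (\<integral>\<^sup>+x. ennreal (cauchy_square ((y - x) / b) / b) * ennreal ((near_remainder b x y * k y)\<^sup>2) \<partial>lborel)"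
      proof (rule nn_integral_cong)
        fix x
        have "cauchy_square ((x - y) / b) = cauchy_square ((y - x) / b)"
          using even[of "(y - x) / b"] by (simp add: minus_divide_left)
        then show "ennreal (cauchy_square ((x - y) / b) / b * (near_remainder b x y * k y)\<^sup>2)
           = ennreal (cauchy_square ((y - x) / b) / b) * ennreal ((near_remainder b x y * k y)\<^sup>2)"
          using nn b by (simp only: ennreal_mult divide_nonneg_pos zero_le_power2)
      qed
      also have "\<dots> = (\<integral>\<^sup>+s. ennreal (cauchy_square s) * ennreal ((near_remainder b (y + b * s) y * k y)\<^sup>2) \<partial>lborel)"
        by (rule nn_integral_dilate_sub) (use even nn b in simp_all)
      also have "\<dots> = (\<integral>\<^sup>+s. ennreal (cauchy_square s * (near_remainder b (y + b * s) y * k y)\<^sup>2) \<partial>lborel)"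
        using nn by (simp add: ennreal_mult)
      finally show "(\<integral>\<^sup>+x. ennreal (cauchy_square ((x - y) / b) / b * (near_remainder b x y * k y)\<^sup>2) \<partial>lborel)
        = (\<integral>\<^sup>+s. ennreal (cauchy_square s * (near_remainder b (y + b * s) y * k y)\<^sup>2) \<partial>lborel)" .
    qed
    also have "\<dots> = (\<integral>\<^sup>+p. (case p of (y, s) \<Rightarrow> ennreal (cauchy_square s * (near_remainder b (y + b * s) y * k y)\<^sup>2)) \<partial>(lborel \<Otimes>\<^sub>M lborel))"
      by (subst lborel.nn_integral_fst[symmetric]) simp_all
    finally show ?thesis .
  qed
  have "(\<lambda>n. \<integral>\<^sup>+p. (case p of (y, s) \<Rightarrow> ennreal (cauchy_square s * (near_remainder (a n) (y + a n * s) y * k y)\<^sup>2)) \<partial>(lborel \<Otimes>\<^sub>M lborel))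
     \<longlonglongrightarrow> (\<integral>\<^sup>+p. 0 \<partial>(lborel \<Otimes>\<^sub>M (lborel :: real measure) :: (real \<times> real) measure))"
  proof (rule nn_integral_dominated_convergence[where w="\<lambda>(y, s). ennreal ((W y * k y)\<^sup>2) * ennreal (cauchy_square s)"])
    show "AE p in lborel \<Otimes>\<^sub>M lborel. (case p of (y, s) \<Rightarrow> ennreal (cauchy_square s * (near_remainder (a n) (y + a n * s) y * k y)\<^sup>2))
       \<le> (case p of (y, s) \<Rightarrow> ennreal ((W y * k y)\<^sup>2) * ennreal (cauchy_square s))" for n
    proof (rule AE_I2, clarify)
      fix y s
      have "(near_remainder (a n) (y + a n * s) y * k y)\<^sup>2 \<le> (W y * k y)\<^sup>2"
        using near_remainder_le[OF a(1), of n "y + a n * s" y]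
        by (simp add: power_mult_distrib abs_le_square_iff[symmetric] mult_right_mono)
      then have "cauchy_square s * (near_remainder (a n) (y + a n * s) y * k y)\<^sup>2 \<le> cauchy_square s * (W y * k y)\<^sup>2"
        using nn[of s] by (rule mult_left_mono)
      also have "\<dots> = (W y * k y)\<^sup>2 * cauchy_square s" by (rule mult.commute)
      finally show "ennreal (cauchy_square s * (near_remainder (a n) (y + a n * s) y * k y)\<^sup>2) \<le> ennreal ((W y * k y)\<^sup>2) * ennreal (cauchy_square s)"
        unfolding ennreal_mult[OF zero_le_power2 nn, symmetric] by (rule ennreal_leI)
    qed
    have "(\<integral>\<^sup>+p. (case p of (y, s) \<Rightarrow> ennreal ((W y * k y)\<^sup>2) * ennreal (cauchy_square s)) \<partial>(lborel \<Otimes>\<^sub>M lborel)) = sqint (\<lambda>y. W y * k y)"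
      by (subst lborel.nn_integral_fst[symmetric])
         (simp_all add: nn_integral_cmult nn_integral_cauchy_square sqint_def)
    then show "(\<integral>\<^sup>+p. (case p of (y, s) \<Rightarrow> ennreal ((W y * k y)\<^sup>2) * ennreal (cauchy_square s)) \<partial>(lborel \<Otimes>\<^sub>M lborel)) < \<infinity>"
      using Wk by simp
    show "AE p in lborel \<Otimes>\<^sub>M lborel. (\<lambda>n. case p of (y, s) \<Rightarrow> ennreal (cauchy_square s * (near_remainder (a n) (y + a n * s) y * k y)\<^sup>2)) \<longlonglongrightarrow> 0"
    proof (rule lborel_pair.AE_pair_measure)
      have "AE y in lborel. y \<noteq> (0::real)" by (rule AE_lborel_singleton)
      then show "AE y in lborel. AE s in lborel. (\<lambda>n. case (y, s) of (y, s) \<Rightarrow> ennreal (cauchy_square s * (near_remainder (a n) (y + a n * s) y * k y)\<^sup>2)) \<longlonglongrightarrow> 0"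
      proof eventually_elim
        case (elim y)
        have "(\<lambda>n. cauchy_square s * (near_remainder (a n) (y + a n * s) y * k y)\<^sup>2) \<longlonglongrightarrow> cauchy_square s * (0 * k y)\<^sup>2" for s
          by (intro tendsto_intros near_remainder_tendsto a elim)
        then have "(\<lambda>n. ennreal (cauchy_square s * (near_remainder (a n) (y + a n * s) y * k y)\<^sup>2)) \<longlonglongrightarrow> ennreal 0" for s
          by (intro tendsto_ennrealI) simp
        then show ?case by simp
      qed
    qed measurable
  qed measurable
  then have "(\<lambda>n. \<integral>\<^sup>+p. (case p of (y, s) \<Rightarrow> ennreal (cauchy_square s * (near_remainder (a n) (y + a n * s) y * k y)\<^sup>2)) \<partial>(lborel \<Otimes>\<^sub>M lborel)) \<longlonglongrightarrow> 0" by simp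
  then show ?thesis by (rule ennreal_tendsto_0_le) (rule key[OF a(1)])
qed

text \<open>Here the weights come from the Poisson kernel at scale 1, which does not depend on \<open>n\<close>.\<close>

lemma far_remainder_sqint:
  fixes a :: "nat \<Rightarrow> real"
  assumes [measurable]: "k \<in> borel_measurable borel"
    and Wk: "sqint (\<lambda>y. W y * k y) < top"
    and a: "\<And>n. 0 < a n" "\<And>n. a n \<le> 1" "a \<longlonglongrightarrow> 0"
  shows "(\<lambda>n. sqint (\<lambda>x. \<integral>y. poisson 1 (x - y) * (far_remainder (a n) x y * k y) \<partial>lborel)) \<longlonglongrightarrow> 0"
proof -
  have nn: "0 \<le> poisson 1 z" for z by (rule poisson_nonneg) simp
  have even: "poisson 1 (x - y) = poisson 1 (y - x)" for x y unfolding poisson_def by (simp add: power2_commute)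
  have key: "sqint (\<lambda>x. \<integral>y. poisson 1 (x - y) * (far_remainder b x y * k y) \<partial>lborel)
     \<le> (\<integral>\<^sup>+p. (case p of (x, y) \<Rightarrow> ennreal (poisson 1 (x - y) * (far_remainder b x y * k y)\<^sup>2)) \<partial>(lborel \<Otimes>\<^sub>M lborel))" for b
  proof -
    have "sqint (\<lambda>x. \<integral>y. poisson 1 (x - y) * (far_remainder b x y * k y) \<partial>lborel)
      \<le> (\<integral>\<^sup>+x. \<integral>\<^sup>+y. ennreal (poisson 1 (x - y) * (far_remainder b x y * k y)\<^sup>2) \<partial>lborel \<partial>lborel)"
      unfolding sqint_def
    proof (rule nn_integral_mono)
      fix x
      show "ennreal ((\<integral>y. poisson 1 (x - y) * (far_remainder b x y * k y) \<partial>lborel)\<^sup>2)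
        \<le> (\<integral>\<^sup>+y. ennreal (poisson 1 (x - y) * (far_remainder b x y * k y)\<^sup>2) \<partial>lborel)"
        using jensen_kernel[of "\<lambda>y. poisson 1 (x - y)" lborel "\<lambda>y. far_remainder b x y * k y"] nn nn_integral_poisson[of 1 x]
        by simp
    qed
    also have "\<dots> = (\<integral>\<^sup>+p. (case p of (x, y) \<Rightarrow> ennreal (poisson 1 (x - y) * (far_remainder b x y * k y)\<^sup>2)) \<partial>(lborel \<Otimes>\<^sub>M lborel))"
      by (subst lborel.nn_integral_fst[symmetric]) simp_all
    finally show ?thesis .
  qed
  have "(\<lambda>n. \<integral>\<^sup>+p. (case p of (x, y) \<Rightarrow> ennreal (poisson 1 (x - y) * (far_remainder (a n) x y * k y)\<^sup>2)) \<partial>(lborel \<Otimes>\<^sub>M lborel))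
     \<longlonglongrightarrow> (\<integral>\<^sup>+p. 0 \<partial>(lborel \<Otimes>\<^sub>M (lborel :: real measure) :: (real \<times> real) measure))"
  proof (rule nn_integral_dominated_convergence[where w="\<lambda>(x, y). ennreal (poisson 1 (x - y)) * ennreal ((W y * k y)\<^sup>2)"])
    show "AE p in lborel \<Otimes>\<^sub>M lborel. (case p of (x, y) \<Rightarrow> ennreal (poisson 1 (x - y) * (far_remainder (a n) x y * k y)\<^sup>2))
       \<le> (case p of (x, y) \<Rightarrow> ennreal (poisson 1 (x - y)) * ennreal ((W y * k y)\<^sup>2))" for n
    proof (rule AE_I2, clarify)
      fix x y
      have "(far_remainder (a n) x y * k y)\<^sup>2 \<le> (W y * k y)\<^sup>2"
        using far_remainder_le[OF a(1,2), of n x y]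
        by (simp add: power_mult_distrib abs_le_square_iff[symmetric] mult_right_mono)
      then show "ennreal (poisson 1 (x - y) * (far_remainder (a n) x y * k y)\<^sup>2) \<le> ennreal (poisson 1 (x - y)) * ennreal ((W y * k y)\<^sup>2)"
        using nn[of "x - y"] by (simp add: ennreal_mult[symmetric] mult_left_mono ennreal_leI)
    qed
    have "(\<integral>\<^sup>+p. (case p of (x, y) \<Rightarrow> ennreal (poisson 1 (x - y)) * ennreal ((W y * k y)\<^sup>2)) \<partial>(lborel \<Otimes>\<^sub>M lborel))
       = (\<integral>\<^sup>+y. \<integral>\<^sup>+x. ennreal (poisson 1 (y - x)) * ennreal ((W y * k y)\<^sup>2) \<partial>lborel \<partial>lborel)"
      by (subst lborel_pair.nn_integral_snd[symmetric]) (simp_all add: even)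
    also have "\<dots> = sqint (\<lambda>y. W y * k y)"
      by (simp add: nn_integral_multc nn_integral_poisson sqint_def)
    finally show "(\<integral>\<^sup>+p. (case p of (x, y) \<Rightarrow> ennreal (poisson 1 (x - y)) * ennreal ((W y * k y)\<^sup>2)) \<partial>(lborel \<Otimes>\<^sub>M lborel)) < \<infinity>"
      using Wk by simp
    show "AE p in lborel \<Otimes>\<^sub>M lborel. (\<lambda>n. case p of (x, y) \<Rightarrow> ennreal (poisson 1 (x - y) * (far_remainder (a n) x y * k y)\<^sup>2)) \<longlonglongrightarrow> 0"
    proof (rule AE_I2, clarify)
      fix x y
      have "(\<lambda>n. poisson 1 (x - y) * (far_remainder (a n) x y * k y)\<^sup>2) \<longlonglongrightarrow> poisson 1 (x - y) * (0 * k y)\<^sup>2"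
        by (intro tendsto_intros far_remainder_tendsto a)
      then show "(\<lambda>n. ennreal (poisson 1 (x - y) * (far_remainder (a n) x y * k y)\<^sup>2)) \<longlonglongrightarrow> 0"
        using tendsto_ennrealI by fastforce
    qed
  qed measurable
  then have "(\<lambda>n. \<integral>\<^sup>+p. (case p of (x, y) \<Rightarrow> ennreal (poisson 1 (x - y) * (far_remainder (a n) x y * k y)\<^sup>2)) \<partial>(lborel \<Otimes>\<^sub>M lborel)) \<longlonglongrightarrow> 0" by simp
  then show ?thesis by (rule ennreal_tendsto_0_le) (rule key)
qed

text \<open>The perturbation acts on \<open>k\<close>, in first order in \<open>a\<close>, as multiplication by half the diagonal of the symbol.\<close>

lemma potential_limit:
  fixes a :: "nat \<Rightarrow> real"
  assumes [measurable]: "k \<in> borel_measurable borel"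
    and k: "sqint k < top" and Wk: "sqint (\<lambda>y. W y * k y) < top"
    and a: "\<And>n. 0 < a n" "\<And>n. a n \<le> 1" "a \<longlonglongrightarrow> 0"
  shows "(\<lambda>n. sqint (\<lambda>x. (poisson_mean (a n) k x - K_mean (a n) k x) / a n - T x x / 2 * k x)) \<longlonglongrightarrow> 0"
proof -
  let ?f = "\<lambda>y. T y y / 2 * k y"
  let ?q = "\<lambda>b z. cauchy_square (z / b) / b"
  have k2: "integrable lborel (\<lambda>y. (k y)\<^sup>2)" using k by (simp add: sqint_finite_iff)
  have Wk2: "integrable lborel (\<lambda>y. (W y * k y)\<^sup>2)" using Wk by (simp add: sqint_finite_iff)
  have even: "cauchy_square (- t) = cauchy_square t" and nn: "0 \<le> cauchy_square t" for t
    unfolding cauchy_square_def by simp_all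
  have bdd: "cauchy_square t \<le> 1" for t
  proof -
    have "1 \<le> (1 + t\<^sup>2)\<^sup>2" by simp
    then have "2 * 1 \<le> pi * (1 + t\<^sup>2)\<^sup>2" using pi_ge_two by (intro mult_mono) auto
    then show ?thesis unfolding cauchy_square_def using one_plus_square_pos[of t] by (simp add: divide_le_eq)
  qed
  have W_dom: "integrable lborel (\<lambda>y. (r y * k y)\<^sup>2)" if [measurable]: "r \<in> borel_measurable borel" and r: "\<And>y. \<bar>r y\<bar> \<le> W y" for r
  proof (rule Bochner_Integration.integrable_bound[OF Wk2])
    show "AE y in lborel. norm ((r y * k y)\<^sup>2) \<le> norm ((W y * k y)\<^sup>2)"
    proof (rule AE_I2)
      fix y
      have "\<bar>r y\<bar> * \<bar>k y\<bar> \<le> \<bar>W y\<bar> * \<bar>k y\<bar>" using r[of y] by (intro mult_right_mono) auto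
      then show "norm ((r y * k y)\<^sup>2) \<le> norm ((W y * k y)\<^sup>2)"
        by (simp add: abs_le_square_iff[symmetric] abs_mult)
    qed
  qed simp
  have TW: "\<bar>T y y / 2\<bar> \<le> W y" for y
  proof -
    have "T y y \<le> C * 2 powr \<gamma> * (1 + \<bar>y\<bar>) powr \<gamma>" by (rule T_le_near) simp
    then show ?thesis using T_nonneg[of y y] unfolding W_def by linarith
  qed
  have f2: "integrable lborel (\<lambda>y. (?f y)\<^sup>2)"
    by (rule W_dom) (use TW in simp_all)
  have sf: "sqint ?f < top" using f2 by (subst sqint_finite_iff) simp_all
  have main: "(\<lambda>n. sqint (\<lambda>x. (\<integral>y. ?q (a n) (x - y) * ?f y \<partial>lborel) - ?f x)) \<longlonglongrightarrow> 0"
    by (rule approximate_identity[where B=1]) (use even nn bdd nn_integral_cauchy_square sf a in simp_all)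
  have q2: "integrable lborel (\<lambda>y. (?q b (x - y))\<^sup>2)" if b: "0 < b" for b x
  proof -
    have qm: "(\<integral>\<^sup>+y. ennreal (?q b (x - y)) \<partial>lborel) = 1"
      using nn_integral_dilate_sub[of cauchy_square "\<lambda>_. 1" b x] even nn b nn_integral_cauchy_square by simp
    have q1: "integrable lborel (\<lambda>y. ?q b (x - y))"
      using qm nn b by (intro integrableI_nonneg) simp_all
    show ?thesis
    proof (rule Bochner_Integration.integrable_bound)
      show "integrable lborel (\<lambda>y. 1 / b * ?q b (x - y))" by (rule integrable_mult_right[OF q1])
      show "AE y in lborel. norm ((?q b (x - y))\<^sup>2) \<le> norm (1 / b * ?q b (x - y))"
      proof (rule AE_I2)
        fix y
        have "?q b (x - y) * ?q b (x - y) \<le> 1 / b * ?q b (x - y)"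
          using bdd nn b by (intro mult_right_mono divide_right_mono) auto
        also have "\<dots> \<le> norm (1 / b * ?q b (x - y))" unfolding real_norm_def by (rule abs_ge_self)
        finally show "norm ((?q b (x - y))\<^sup>2) \<le> norm (1 / b * ?q b (x - y))"
          unfolding power2_eq_square using nn[of "(x - y) / b"] b by simp
      qed
    qed simp
  qed
  have split: "(poisson_mean b k x - K_mean b k x) / b - ?f x =
      ((\<integral>y. ?q b (x - y) * ?f y \<partial>lborel) - ?f x)
     + ((\<integral>y. ?q b (x - y) * (near_remainder b x y * k y) \<partial>lborel)
     + (\<integral>y. poisson 1 (x - y) * (far_remainder b x y * k y) \<partial>lborel))" if b: "0 < b" "b \<le> 1" for b x
  proof -
    have i1: "integrable lborel (\<lambda>y. ?q b (x - y) * ?f y)"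
      by (rule integrable_mult_of_squares) (use q2[OF b(1)] f2 in simp_all)
    have i2: "integrable lborel (\<lambda>y. ?q b (x - y) * (near_remainder b x y * k y))"
      by (rule integrable_mult_of_squares) (use q2[OF b(1)] W_dom[of "near_remainder b x"] near_remainder_le[OF b(1)] in simp_all)
    have i3: "integrable lborel (\<lambda>y. poisson 1 (x - y) * (far_remainder b x y * k y))"
      by (rule integrable_mult_of_squares) (use integrable_poisson_square[of 1 x] W_dom[of "far_remainder b x"] far_remainder_le[OF b] in simp_all)
    have ip: "integrable lborel (\<lambda>y. poisson b (x - y) * k y)"
      by (rule integrable_mult_of_squares) (use integrable_poisson_square[OF b(1)] k2 in simp_all)
    have iK: "integrable lborel (\<lambda>y. K b x y * k y)" by (rule integrable_K_mult) (use b k2 in simp_all)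
    have "(poisson_mean b k x - K_mean b k x) / b = (\<integral>y. (poisson b (x - y) * k y - K b x y * k y) / b \<partial>lborel)"
      unfolding poisson_mean_def K_mean_def using ip iK by simp
    also have "\<dots> = (\<integral>y. ?q b (x - y) * ?f y + (?q b (x - y) * (near_remainder b x y * k y) + poisson 1 (x - y) * (far_remainder b x y * k y)) \<partial>lborel)"
    proof (intro Bochner_Integration.integral_cong refl)
      fix y
      have "(poisson b (x - y) * k y - K b x y * k y) / b = defect b x y * k y"
        unfolding defect_def by (simp add: left_diff_distrib)
      then show "(poisson b (x - y) * k y - K b x y * k y) / b = ?q b (x - y) * ?f y + (?q b (x - y) * (near_remainder b x y * k y) + poisson 1 (x - y) * (far_remainder b x y * k y))"
        unfolding defect_split[OF b(1)] by (simp only: distrib_right distrib_left mult.assoc add.assoc)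
    qed
    also have "\<dots> = (\<integral>y. ?q b (x - y) * ?f y \<partial>lborel)
       + ((\<integral>y. ?q b (x - y) * (near_remainder b x y * k y) \<partial>lborel) + (\<integral>y. poisson 1 (x - y) * (far_remainder b x y * k y) \<partial>lborel))"
      by (simp only: Bochner_Integration.integral_add[OF i1 Bochner_Integration.integrable_add[OF i2 i3]] Bochner_Integration.integral_add[OF i2 i3])
    finally show ?thesis by simp
  qed
  have "(\<lambda>n. 2 * sqint (\<lambda>x. (\<integral>y. ?q (a n) (x - y) * ?f y \<partial>lborel) - ?f x)
     + 2 * (2 * sqint (\<lambda>x. \<integral>y. ?q (a n) (x - y) * (near_remainder (a n) x y * k y) \<partial>lborel)
          + 2 * sqint (\<lambda>x. \<integral>y. poisson 1 (x - y) * (far_remainder (a n) x y * k y) \<partial>lborel))) \<longlonglongrightarrow> 2 * 0 + 2 * (2 * 0 + 2 * 0)"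
    by (intro tendsto_add ennreal_tendsto_cmult main near_remainder_sqint far_remainder_sqint Wk a) simp_all
  then have lim: "(\<lambda>n. 2 * sqint (\<lambda>x. (\<integral>y. ?q (a n) (x - y) * ?f y \<partial>lborel) - ?f x)
     + 2 * (2 * sqint (\<lambda>x. \<integral>y. ?q (a n) (x - y) * (near_remainder (a n) x y * k y) \<partial>lborel)
          + 2 * sqint (\<lambda>x. \<integral>y. poisson 1 (x - y) * (far_remainder (a n) x y * k y) \<partial>lborel))) \<longlonglongrightarrow> 0" by simp
  show ?thesis
  proof (rule ennreal_tendsto_0_le[OF lim])
    fix n
    have "sqint (\<lambda>x. (poisson_mean (a n) k x - K_mean (a n) k x) / a n - ?f x)
      \<le> 2 * sqint (\<lambda>x. (\<integral>y. ?q (a n) (x - y) * ?f y \<partial>lborel) - ?f x)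
       + 2 * sqint (\<lambda>x. (\<integral>y. ?q (a n) (x - y) * (near_remainder (a n) x y * k y) \<partial>lborel)
          + (\<integral>y. poisson 1 (x - y) * (far_remainder (a n) x y * k y) \<partial>lborel))"
      by (rule sqint_add_le[OF _ _ _ AE_I2]) (use split[OF a(1,2)] in simp_all)
    also have "\<dots> \<le> 2 * sqint (\<lambda>x. (\<integral>y. ?q (a n) (x - y) * ?f y \<partial>lborel) - ?f x)
       + 2 * (2 * sqint (\<lambda>x. \<integral>y. ?q (a n) (x - y) * (near_remainder (a n) x y * k y) \<partial>lborel)
          + 2 * sqint (\<lambda>x. \<integral>y. poisson 1 (x - y) * (far_remainder (a n) x y * k y) \<partial>lborel))"
      by (intro add_left_mono mult_left_mono sqint_add_le) simp_all
    finally show "sqint (\<lambda>x. (poisson_mean (a n) k x - K_mean (a n) k x) / a n - ?f x) \<le> \<dots>" .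
  qed
qed

end

section \<open>Square integrable functions\<close>

definition sq_int :: "(real \<Rightarrow> real) \<Rightarrow> bool" where
  "sq_int f \<longleftrightarrow> f \<in> borel_measurable borel \<and> integrable lborel (\<lambda>x. (f x)\<^sup>2)"

lemma sq_int_measurable: "sq_int f \<Longrightarrow> f \<in> borel_measurable borel"
  unfolding sq_int_def by simp

lemma sq_int_square: "sq_int f \<Longrightarrow> integrable lborel (\<lambda>x. (f x)\<^sup>2)"
  unfolding sq_int_def by simp

lemma sq_int_mult: "sq_int f \<Longrightarrow> sq_int g \<Longrightarrow> integrable lborel (\<lambda>x. f x * g x)"
  unfolding sq_int_def by (intro integrable_mult_of_squares) auto

lemma sq_int_cauchy_schwarz:
  "sq_int f \<Longrightarrow> sq_int g \<Longrightarrow> (\<integral>x. f x * g x \<partial>lborel)\<^sup>2 \<le> (\<integral>x. (f x)\<^sup>2 \<partial>lborel) * (\<integral>x. (g x)\<^sup>2 \<partial>lborel)"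
  unfolding sq_int_def by (intro integral_mult_le_sqrt) auto

lemma sq_int_cmult: "sq_int f \<Longrightarrow> sq_int (\<lambda>x. c * f x)"
  unfolding sq_int_def by (auto simp: power_mult_distrib)

lemma sq_int_dominated:
  assumes "sq_int g" "f \<in> borel_measurable borel" "\<And>x. \<bar>f x\<bar> \<le> \<bar>g x\<bar>"
  shows "sq_int f"
  unfolding sq_int_def
proof
  show "integrable lborel (\<lambda>x. (f x)\<^sup>2)"
    by (rule Bochner_Integration.integrable_bound[OF sq_int_square[OF assms(1)]])
       (use assms in \<open>auto simp: abs_le_square_iff\<close>)
qed fact

lemma sq_int_add:
  assumes "sq_int f" "sq_int g" shows "sq_int (\<lambda>x. f x + g x)"
  unfolding sq_int_def
proof
  have [measurable]: "f \<in> borel_measurable borel" "g \<in> borel_measurable borel"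
    using assms by (auto intro: sq_int_measurable)
  show "(\<lambda>x. f x + g x) \<in> borel_measurable borel" by simp
  have "integrable lborel (\<lambda>x. (f x)\<^sup>2 + (g x)\<^sup>2 + 2 * (f x * g x))"
    using assms by (intro Bochner_Integration.integrable_add integrable_mult_right sq_int_square sq_int_mult)
  then show "integrable lborel (\<lambda>x. (f x + g x)\<^sup>2)" by (simp add: power2_sum mult.assoc)
qed

lemma sq_int_diff: "sq_int f \<Longrightarrow> sq_int g \<Longrightarrow> sq_int (\<lambda>x. f x - g x)"
  using sq_int_add[of f "\<lambda>x. -1 * g x"] sq_int_cmult[of g "-1"] by simp

lemma indicator_square: "(indicator A x :: real)\<^sup>2 = indicator A x"
  by (auto split: split_indicator)

lemma sq_int_indicator_Icc: "sq_int (indicator {a..b})"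
  unfolding sq_int_def indicator_square by (auto intro: integrable_indicator_Icc)

lemma sq_int_local: "sq_int f \<Longrightarrow> integrable lborel (\<lambda>x. indicator {a..b} x * f x)"
  by (rule sq_int_mult) (auto intro: sq_int_indicator_Icc)

lemma sq_int_iff_sqint: "f \<in> borel_measurable borel \<Longrightarrow> sq_int f \<longleftrightarrow> sqint f < top"
  unfolding sq_int_def by (simp add: sqint_finite_iff)

lemma product_integral:
  fixes g h :: "real \<Rightarrow> real"
  assumes g: "integrable lborel g" and h: "integrable lborel h"
  shows "integrable (lborel \<Otimes>\<^sub>M lborel) (\<lambda>(x, y). g x * h y)"
    and "(\<integral>p. (case p of (x, y) \<Rightarrow> g x * h y) \<partial>(lborel \<Otimes>\<^sub>M lborel)) = (\<integral>x. g x \<partial>lborel) * (\<integral>y. h y \<partial>lborel)"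
proof -
  have [measurable]: "g \<in> borel_measurable borel" "h \<in> borel_measurable borel"
    using borel_measurable_integrable[OF g] borel_measurable_integrable[OF h] by simp_all
  show i: "integrable (lborel \<Otimes>\<^sub>M lborel) (\<lambda>(x, y). g x * h y)"
    by (rule integrable_product_bound[OF _ integrable_abs[OF g] integrable_abs[OF h]]) (simp_all add: abs_mult)
  show "(\<integral>p. (case p of (x, y) \<Rightarrow> g x * h y) \<partial>(lborel \<Otimes>\<^sub>M lborel)) = (\<integral>x. g x \<partial>lborel) * (\<integral>y. h y \<partial>lborel)"
    by (subst lborel_pair.integral_fst'[OF i, symmetric]) simp
qed

context homogeneous_perturbation begin

section \<open>The energy form\<close>

text \<open>The defect \<open>1 - mass\<close> acts as a potential in the quadratic form of \<open>1 - K\<^sub>a\<close>.\<close>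

definition mass :: "real \<Rightarrow> real \<Rightarrow> real" where
  "mass a x = (\<integral>y. K a x y \<partial>lborel)"

lemma mass_measurable [measurable]: "mass a \<in> borel_measurable borel"
  unfolding mass_def by measurable

lemma mass_bounds:
  assumes a: "0 < a" shows "0 \<le> mass a x" "mass a x \<le> 1"
proof -
  show "0 \<le> mass a x" unfolding mass_def using K_pos[OF a] by (intro integral_nonneg_AE) (auto intro: less_imp_le)
  have "mass a x \<le> (\<integral>y. poisson a (x - y) \<partial>lborel)"
    unfolding mass_def by (intro integral_mono integrable_K integrable_poisson a K_le_poisson)
  also have "\<dots> = 1" using nn_integral_poisson[OF a, of x] poisson_nonneg[of a] a
    by (subst integral_eq_nn_integral) auto
  finally show "mass a x \<le> 1" .
qed

text \<open>If the symbol is at least \<open>\<tau>\<close> along the line through \<open>x\<close>, then \<open>K\<^sub>a\<close> lies below a multiple of a Poisson kernel of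
the larger width \<open>a (1 + a \<tau>)\<^sup>1\<^sup>/\<^sup>2\<close>, whose mass is explicit.\<close>

lemma mass_le:
  assumes a: "0 < a" and t: "0 \<le> \<tau>" "a * \<tau> \<le> 1" "\<tau> \<le> c * \<bar>x\<bar> powr \<gamma>"
  shows "mass a x \<le> 1 - a * \<tau> / 4"
proof -
  define b where "b = a * sqrt (1 + a * \<tau>)"
  have at0: "0 \<le> a * \<tau>" using a t by simp
  have b: "0 < b" using a at0 by (simp add: b_def)
  have b2: "b\<^sup>2 = a\<^sup>2 + a ^ 3 * \<tau>" using at0 unfolding b_def by (simp add: power_mult_distrib algebra_simps power2_eq_square power3_eq_cube)
  have le: "K a x y \<le> a / b * poisson b (x - y)" for y
  proof -
    have "a ^ 3 * \<tau> \<le> a ^ 3 * T x y" using t(3) T_lower[of x y] a by (intro mult_left_mono) auto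
    then have "b\<^sup>2 + (x - y)\<^sup>2 \<le> a\<^sup>2 + (x - y)\<^sup>2 + a ^ 3 * T x y" using b2 by linarith
    moreover have "0 < b\<^sup>2 + (x - y)\<^sup>2" using b by (intro add_pos_nonneg) auto
    ultimately have "K a x y \<le> a / (pi * (b\<^sup>2 + (x - y)\<^sup>2))"
      unfolding K_def using a K_denominator[OF a, of x y]
      by (intro divide_left_mono mult_left_mono mult_pos_pos) auto
    then show ?thesis unfolding poisson_def using b by simp
  qed
  have "mass a x \<le> (\<integral>y. a / b * poisson b (x - y) \<partial>lborel)"
    unfolding mass_def by (intro integral_mono integrable_K integrable_mult_right integrable_poisson a b le)
  also have "\<dots> = a / b * (\<integral>y. poisson b (x - y) \<partial>lborel)" by simp
  also have "(\<integral>y. poisson b (x - y) \<partial>lborel) = 1" using nn_integral_poisson[OF b, of x] poisson_nonneg[of b] b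
    by (subst integral_eq_nn_integral) auto
  also have "a / b * 1 = 1 / sqrt (1 + a * \<tau>)" unfolding b_def using a by simp
  also have "\<dots> \<le> 1 - a * \<tau> / 4"
  proof -
    let ?t = "a * \<tau>"
    have "1 \<le> (1 - t / 4)\<^sup>2 * (1 + t)" if "0 \<le> t" "t \<le> 1" for t :: real
    proof -
      have "(1 - t / 4)\<^sup>2 * (1 + t) = 1 + (t * (1 - t) / 2 + t ^ 2 / 16 + t ^ 3 / 16)"
        by (simp add: power2_eq_square power3_eq_cube field_simps)
      moreover have "0 \<le> t * (1 - t) / 2 + t ^ 2 / 16 + t ^ 3 / 16"
        using that by (intro add_nonneg_nonneg) auto
      ultimately show ?thesis by simp
    qed
    from this[OF at0 t(2)] have "1 \<le> (1 - ?t / 4)\<^sup>2 * (1 + ?t)" .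
    then have "1 \<le> sqrt ((1 - ?t / 4)\<^sup>2 * (1 + ?t))" by simp
    also have "\<dots> = (1 - ?t / 4) * sqrt (1 + ?t)" using t(2) at0 by (simp add: real_sqrt_mult)
    finally show ?thesis using at0 by (simp add: divide_le_eq)
  qed
  finally show ?thesis .
qed

definition form :: "real \<Rightarrow> (real \<Rightarrow> real) \<Rightarrow> (real \<Rightarrow> real) \<Rightarrow> real" where
  "form a f g = (\<integral>p. (case p of (x, y) \<Rightarrow> K a x y * (f x * g y)) \<partial>(lborel \<Otimes>\<^sub>M lborel))"

lemma K_square_integral:
  assumes a: "0 < a" and w: "sq_int w"
  shows "integrable (lborel \<Otimes>\<^sub>M lborel) (\<lambda>(x, y). K a x y * (w x)\<^sup>2)"
    and "(\<integral>p. (case p of (x, y) \<Rightarrow> K a x y * (w x)\<^sup>2) \<partial>(lborel \<Otimes>\<^sub>M lborel)) = (\<integral>x. mass a x * (w x)\<^sup>2 \<partial>lborel)"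
    and "integrable (lborel \<Otimes>\<^sub>M lborel) (\<lambda>(x, y). K a x y * (w y)\<^sup>2)"
    and "(\<integral>p. (case p of (x, y) \<Rightarrow> K a x y * (w y)\<^sup>2) \<partial>(lborel \<Otimes>\<^sub>M lborel)) = (\<integral>x. mass a x * (w x)\<^sup>2 \<partial>lborel)"
    and "integrable lborel (\<lambda>x. mass a x * (w x)\<^sup>2)"
proof -
  have [measurable]: "w \<in> borel_measurable borel" using w by (rule sq_int_measurable)
  show m: "integrable lborel (\<lambda>x. mass a x * (w x)\<^sup>2)"
  proof (rule Bochner_Integration.integrable_bound[OF sq_int_square[OF w]])
    show "AE x in lborel. norm (mass a x * (w x)\<^sup>2) \<le> norm ((w x)\<^sup>2)"
      using mass_bounds[OF a] by (intro AE_I2) (simp add: abs_mult mult_left_le_one_le)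
  qed simp
  show i: "integrable (lborel \<Otimes>\<^sub>M lborel) (\<lambda>(x, y). K a x y * (w x)\<^sup>2)"
  proof (rule lborel_pair.Fubini_integrable)
    show "integrable lborel (\<lambda>x. \<integral>y. norm (case (x, y) of (x, y) \<Rightarrow> K a x y * (w x)\<^sup>2) \<partial>lborel)"
      using m K_pos[OF a] unfolding mass_def by (simp add: abs_mult less_imp_le)
    show "AE x in lborel. integrable lborel (\<lambda>y. case (x, y) of (x, y) \<Rightarrow> K a x y * (w x)\<^sup>2)"
      using integrable_K[OF a] by simp
  qed simp
  show e: "(\<integral>p. (case p of (x, y) \<Rightarrow> K a x y * (w x)\<^sup>2) \<partial>(lborel \<Otimes>\<^sub>M lborel)) = (\<integral>x. mass a x * (w x)\<^sup>2 \<partial>lborel)"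
    by (subst lborel_pair.integral_fst'[OF i, symmetric]) (simp add: mass_def)
  have sw: "(\<lambda>(x, y). K a x y * (w y)\<^sup>2) = (\<lambda>(x, y). (\<lambda>(x, y). K a x y * (w x)\<^sup>2) (y, x))"
    by (auto simp: K_sym fun_eq_iff)
  show "integrable (lborel \<Otimes>\<^sub>M lborel) (\<lambda>(x, y). K a x y * (w y)\<^sup>2)"
    unfolding sw by (rule lborel_pair.integrable_product_swap[OF i])
  show "(\<integral>p. (case p of (x, y) \<Rightarrow> K a x y * (w y)\<^sup>2) \<partial>(lborel \<Otimes>\<^sub>M lborel)) = (\<integral>x. mass a x * (w x)\<^sup>2 \<partial>lborel)"
    unfolding sw e[symmetric] by (rule lborel_pair.integral_product_swap) simp
qed

lemma form_integrable:
  assumes a: "0 < a" and f: "sq_int f" and g: "sq_int g"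
  shows "integrable (lborel \<Otimes>\<^sub>M lborel) (\<lambda>(x, y). K a x y * (f x * g y))"
proof -
  have [measurable]: "f \<in> borel_measurable borel" "g \<in> borel_measurable borel"
    using f g by (auto intro: sq_int_measurable)
  show ?thesis
  proof (rule Bochner_Integration.integrable_bound[OF Bochner_Integration.integrable_add[OF K_square_integral(1)[OF a f] K_square_integral(3)[OF a g]]])
    have "\<bar>K a x y * (f x * g y)\<bar> \<le> K a x y * (f x)\<^sup>2 + K a x y * (g y)\<^sup>2" for x y
    proof -
      have "0 \<le> \<bar>f x\<bar> * \<bar>g y\<bar>" "2 * (\<bar>f x\<bar> * \<bar>g y\<bar>) \<le> (f x)\<^sup>2 + (g y)\<^sup>2"
        using sum_squares_bound[of "\<bar>f x\<bar>" "\<bar>g y\<bar>"] by (auto simp: mult.assoc)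
      then have "\<bar>f x\<bar> * \<bar>g y\<bar> \<le> (f x)\<^sup>2 + (g y)\<^sup>2" by linarith
      then have "K a x y * (\<bar>f x\<bar> * \<bar>g y\<bar>) \<le> K a x y * ((f x)\<^sup>2 + (g y)\<^sup>2)"
        using K_pos[OF a, of x y] by (intro mult_left_mono) auto
      then show ?thesis using K_pos[OF a, of x y] by (simp add: abs_mult distrib_left)
    qed
    then show "AE p in lborel \<Otimes>\<^sub>M lborel. norm (case p of (x, y) \<Rightarrow> K a x y * (f x * g y))
       \<le> norm ((case p of (x, y) \<Rightarrow> K a x y * (f x)\<^sup>2) + (case p of (x, y) \<Rightarrow> K a x y * (g y)\<^sup>2))"
      by (intro AE_I2) (auto intro: order_trans[OF _ abs_ge_self])
  qed simp
qed

lemma form_eq_mean: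
  assumes a: "0 < a" and f: "sq_int f" and g: "sq_int g"
  shows "form a f g = (\<integral>x. f x * K_mean a g x \<partial>lborel)"
proof -
  have "form a f g = (\<integral>x. \<integral>y. K a x y * (f x * g y) \<partial>lborel \<partial>lborel)"
    unfolding form_def by (subst lborel_pair.integral_fst'[OF form_integrable[OF a f g], symmetric]) simp
  also have "\<dots> = (\<integral>x. \<integral>y. f x * (K a x y * g y) \<partial>lborel \<partial>lborel)" by (simp only: mult.left_commute)
  finally show ?thesis unfolding K_mean_def by simp
qed

lemma form_sym:
  assumes a: "0 < a" and f: "sq_int f" and g: "sq_int g"
  shows "form a f g = form a g f"
proof -
  have [measurable]: "f \<in> borel_measurable borel" "g \<in> borel_measurable borel"
    using f g by (auto intro: sq_int_measurable)
  have sw: "(\<lambda>(x, y). K a x y * (f x * g y)) = (\<lambda>(x, y). (\<lambda>(x, y). K a x y * (g x * f y)) (y, x))"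
    by (auto simp: K_sym fun_eq_iff)
  show ?thesis unfolding form_def sw by (rule lborel_pair.integral_product_swap) simp
qed

text \<open>The rows of the kernel have mass at most 1, so by symmetry and Jensen's inequality the operator is a contraction.\<close>

lemma sq_int_K_mean:
  assumes a: "0 < a" and w: "sq_int w" shows "sq_int (K_mean a w)"
proof -
  have [measurable]: "w \<in> borel_measurable borel" using w by (rule sq_int_measurable)
  have m1: "(\<integral>\<^sup>+y. ennreal (K a x y) \<partial>lborel) \<le> 1" for x
    using mass_bounds(2)[OF a, of x] integrable_K[OF a, of x] K_pos[OF a]
    by (subst nn_integral_eq_integral) (auto simp: mass_def less_imp_le)
  have "sqint (K_mean a w) \<le> (\<integral>\<^sup>+x. \<integral>\<^sup>+y. ennreal (K a x y * (w y)\<^sup>2) \<partial>lborel \<partial>lborel)"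
    unfolding sqint_def
  proof (rule nn_integral_mono)
    fix x
    have "ennreal ((K_mean a w x)\<^sup>2) \<le> (\<integral>\<^sup>+y. ennreal (K a x y) \<partial>lborel) * (\<integral>\<^sup>+y. ennreal (K a x y * (w y)\<^sup>2) \<partial>lborel)"
      unfolding K_mean_def using K_pos[OF a] by (intro jensen_kernel) (auto intro: less_imp_le)
    also have "\<dots> \<le> 1 * (\<integral>\<^sup>+y. ennreal (K a x y * (w y)\<^sup>2) \<partial>lborel)" by (intro mult_right_mono m1) simp
    finally show "ennreal ((K_mean a w x)\<^sup>2) \<le> (\<integral>\<^sup>+y. ennreal (K a x y * (w y)\<^sup>2) \<partial>lborel)" by simp
  qed
  also have "\<dots> = (\<integral>\<^sup>+p. ennreal (norm (case p of (x, y) \<Rightarrow> K a x y * (w y)\<^sup>2)) \<partial>(lborel \<Otimes>\<^sub>M lborel))"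
    using K_pos[OF a] by (subst lborel.nn_integral_fst[symmetric]) (auto simp: abs_mult less_imp_le)
  also have "\<dots> < top" using K_square_integral(3)[OF a w] by (simp add: integrable_iff_bounded)
  finally show ?thesis by (subst sq_int_iff_sqint) simp_all
qed

text \<open>The quadratic form of \<open>1 - K\<^sub>a\<close>. It is the sum of a Dirichlet part \<open>1/2 \<integral>\<integral> K\<^sub>a (w x - w y)\<^sup>2\<close> and a potential part
\<open>\<integral> (1 - mass) w\<^sup>2\<close>; the next two lemmas estimate each part separately.\<close>

definition energy :: "real \<Rightarrow> (real \<Rightarrow> real) \<Rightarrow> real" where
  "energy a w = (\<integral>x. (w x)\<^sup>2 \<partial>lborel) - form a w w"

lemma energy_difference_bound:
  assumes a: "0 < a" and w: "sq_int w"
  shows "integrable (lborel \<Otimes>\<^sub>M lborel) (\<lambda>(x, y). K a x y * (w x - w y)\<^sup>2)"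
    and "(\<integral>p. (case p of (x, y) \<Rightarrow> K a x y * (w x - w y)\<^sup>2) \<partial>(lborel \<Otimes>\<^sub>M lborel)) \<le> 2 * energy a w"
proof -
  note i = K_square_integral(1)[OF a w] K_square_integral(3)[OF a w] form_integrable[OF a w w]
  have eq: "(\<lambda>(x, y). K a x y * (w x - w y)\<^sup>2) = (\<lambda>p. (case p of (x, y) \<Rightarrow> K a x y * (w x)\<^sup>2)
      + (case p of (x, y) \<Rightarrow> K a x y * (w y)\<^sup>2) - 2 * (case p of (x, y) \<Rightarrow> K a x y * (w x * w y)))"
    by (auto simp: fun_eq_iff power2_eq_square algebra_simps)
  show "integrable (lborel \<Otimes>\<^sub>M lborel) (\<lambda>(x, y). K a x y * (w x - w y)\<^sup>2)"
    unfolding eq using i by (intro Bochner_Integration.integrable_diff Bochner_Integration.integrable_add integrable_mult_right)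
  have "(\<integral>p. (case p of (x, y) \<Rightarrow> K a x y * (w x - w y)\<^sup>2) \<partial>(lborel \<Otimes>\<^sub>M lborel))
     = 2 * (\<integral>x. mass a x * (w x)\<^sup>2 \<partial>lborel) - 2 * form a w w"
    unfolding eq form_def using i K_square_integral(2)[OF a w] K_square_integral(4)[OF a w] by simp
  also have "(\<integral>x. mass a x * (w x)\<^sup>2 \<partial>lborel) \<le> (\<integral>x. (w x)\<^sup>2 \<partial>lborel)"
    using mass_bounds[OF a] by (intro integral_mono K_square_integral(5)[OF a w] sq_int_square[OF w]) (simp add: mult_left_le_one_le)
  finally show "(\<integral>p. (case p of (x, y) \<Rightarrow> K a x y * (w x - w y)\<^sup>2) \<partial>(lborel \<Otimes>\<^sub>M lborel)) \<le> 2 * energy a w"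
    unfolding energy_def by simp
qed

lemma energy_potential_bound:
  assumes a: "0 < a" and w: "sq_int w"
  shows "(\<integral>x. (1 - mass a x) * (w x)\<^sup>2 \<partial>lborel) \<le> energy a w"
proof -
  note i = K_square_integral(1)[OF a w] K_square_integral(3)[OF a w] form_integrable[OF a w w]
  have "2 * form a w w = (\<integral>p. 2 * (case p of (x, y) \<Rightarrow> K a x y * (w x * w y)) \<partial>(lborel \<Otimes>\<^sub>M lborel))"
    unfolding form_def by simp
  also have "\<dots> \<le> (\<integral>p. (case p of (x, y) \<Rightarrow> K a x y * (w x)\<^sup>2) + (case p of (x, y) \<Rightarrow> K a x y * (w y)\<^sup>2) \<partial>(lborel \<Otimes>\<^sub>M lborel))"
  proof (intro integral_mono Bochner_Integration.integrable_add integrable_mult_right i)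
    fix p :: "real \<times> real"
    obtain x y where p: "p = (x, y)" by (cases p)
    have "K a x y * (2 * w x * w y) \<le> K a x y * ((w x)\<^sup>2 + (w y)\<^sup>2)"
      using K_pos[OF a, of x y] by (intro mult_left_mono sum_squares_bound) auto
    then show "2 * (case p of (x, y) \<Rightarrow> K a x y * (w x * w y)) \<le> (case p of (x, y) \<Rightarrow> K a x y * (w x)\<^sup>2) + (case p of (x, y) \<Rightarrow> K a x y * (w y)\<^sup>2)"
      unfolding p by (simp add: algebra_simps)
  qed
  also have "\<dots> = 2 * (\<integral>x. mass a x * (w x)\<^sup>2 \<partial>lborel)"
    using i K_square_integral(2)[OF a w] K_square_integral(4)[OF a w] by simp
  finally have "form a w w \<le> (\<integral>x. mass a x * (w x)\<^sup>2 \<partial>lborel)" by simp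
  moreover have "(\<integral>x. (1 - mass a x) * (w x)\<^sup>2 \<partial>lborel) = (\<integral>x. (w x)\<^sup>2 \<partial>lborel) - (\<integral>x. mass a x * (w x)\<^sup>2 \<partial>lborel)"
    using Bochner_Integration.integral_diff[OF sq_int_square[OF w] K_square_integral(5)[OF a w]] by (simp add: left_diff_distrib)
  ultimately show ?thesis unfolding energy_def by simp
qed

lemma energy_nonneg:
  assumes a: "0 < a" and w: "sq_int w" shows "0 \<le> energy a w"
proof -
  have "0 \<le> (\<integral>x. (1 - mass a x) * (w x)\<^sup>2 \<partial>lborel)"
    using mass_bounds[OF a] by (intro integral_nonneg_AE) auto
  then show ?thesis using energy_potential_bound[OF assms] by simp
qed

text \<open>The parallelogram law for the non-negative form \<open>energy\<close>.\<close>

lemma energy_diff_le: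
  assumes a: "0 < a" and u: "sq_int u" and k: "sq_int k"
  shows "energy a (\<lambda>x. u x - t * k x) \<le> 2 * energy a u + 2 * t\<^sup>2 * energy a k"
proof -
  \<comment> \<open>The form is non-negative at \<open>?p\<close>, so the energy of \<open>?m\<close> is at most the sum of both.\<close>
  let ?m = "\<lambda>x. u x - t * k x" and ?p = "\<lambda>x. u x + t * k x"
  have tk: "sq_int (\<lambda>x. t * k x)" using k by (rule sq_int_cmult)
  have m: "sq_int ?m" and p: "sq_int ?p" using sq_int_diff[OF u tk] sq_int_add[OF u tk] by auto
  have "form a ?m ?m + form a ?p ?p = (\<integral>q. (case q of (x, y) \<Rightarrow> K a x y * (?m x * ?m y)) + (case q of (x, y) \<Rightarrow> K a x y * (?p x * ?p y)) \<partial>(lborel \<Otimes>\<^sub>M lborel))"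
    unfolding form_def using form_integrable[OF a m m] form_integrable[OF a p p] by simp
  also have "\<dots> = (\<integral>q. 2 * (case q of (x, y) \<Rightarrow> K a x y * (u x * u y)) + 2 * t\<^sup>2 * (case q of (x, y) \<Rightarrow> K a x y * (k x * k y)) \<partial>(lborel \<Otimes>\<^sub>M lborel))"
    by (intro Bochner_Integration.integral_cong refl) (auto simp: power2_eq_square algebra_simps)
  also have "\<dots> = 2 * form a u u + 2 * t\<^sup>2 * form a k k"
    unfolding form_def using form_integrable[OF a u u] form_integrable[OF a k k] by simp
  finally have f: "form a ?m ?m + form a ?p ?p = 2 * form a u u + 2 * t\<^sup>2 * form a k k" .
  have "(\<integral>x. (?m x)\<^sup>2 \<partial>lborel) + (\<integral>x. (?p x)\<^sup>2 \<partial>lborel) = (\<integral>x. (?m x)\<^sup>2 + (?p x)\<^sup>2 \<partial>lborel)"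
    using sq_int_square[OF m] sq_int_square[OF p] by simp
  also have "\<dots> = (\<integral>x. 2 * (u x)\<^sup>2 + 2 * t\<^sup>2 * (k x)\<^sup>2 \<partial>lborel)"
    by (intro Bochner_Integration.integral_cong refl) (simp add: power2_eq_square algebra_simps)
  also have "\<dots> = 2 * (\<integral>x. (u x)\<^sup>2 \<partial>lborel) + 2 * t\<^sup>2 * (\<integral>x. (k x)\<^sup>2 \<partial>lborel)"
    using sq_int_square[OF u] sq_int_square[OF k] by simp
  finally have "energy a ?m + energy a ?p = 2 * energy a u + 2 * t\<^sup>2 * energy a k"
    using f unfolding energy_def by (simp add: algebra_simps)
  then show ?thesis using energy_nonneg[OF a p] by simp
qed

text \<open>The potential part of the energy is at least of order \<open>a \<tau>\<close> where the symbol is at least \<open>\<tau>\<close>.\<close>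

lemma tail_bound:
  assumes a: "0 < a" and w: "sq_int w" and t: "0 < \<tau>" "a * \<tau> \<le> 1"
    and A[measurable]: "A \<in> sets borel" and tail: "\<And>x. x \<in> A \<Longrightarrow> \<tau> \<le> c * \<bar>x\<bar> powr \<gamma>"
  shows "(\<integral>x. indicator A x * (w x)\<^sup>2 \<partial>lborel) \<le> 4 * energy a w / (a * \<tau>)"
proof -
  have [measurable]: "w \<in> borel_measurable borel" using w by (rule sq_int_measurable)
  have i1: "integrable lborel (\<lambda>x. indicator A x * (w x)\<^sup>2)"
    by (rule Bochner_Integration.integrable_bound[OF sq_int_square[OF w]]) (auto split: split_indicator)
  have i2: "integrable lborel (\<lambda>x. (1 - mass a x) * (w x)\<^sup>2)"
    using Bochner_Integration.integrable_diff[OF sq_int_square[OF w] K_square_integral(5)[OF a w]] by (simp add: left_diff_distrib)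
  have "a * \<tau> / 4 * (\<integral>x. indicator A x * (w x)\<^sup>2 \<partial>lborel) = (\<integral>x. a * \<tau> / 4 * (indicator A x * (w x)\<^sup>2) \<partial>lborel)" by simp
  also have "\<dots> \<le> (\<integral>x. (1 - mass a x) * (w x)\<^sup>2 \<partial>lborel)"
  proof (intro integral_mono i2 integrable_mult_right i1)
    fix x
    show "a * \<tau> / 4 * (indicator A x * (w x)\<^sup>2) \<le> (1 - mass a x) * (w x)\<^sup>2"
    proof (cases "x \<in> A")
      case True
      have "a * \<tau> / 4 \<le> 1 - mass a x" using mass_le[OF a _ t(2) tail[OF True]] t(1) by simp
      then have "a * \<tau> / 4 * (w x)\<^sup>2 \<le> (1 - mass a x) * (w x)\<^sup>2" by (rule mult_right_mono) simp
      then show ?thesis using True by simp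
    next
      case False
      then show ?thesis using mass_bounds[OF a, of x] by simp
    qed
  qed
  also have "\<dots> \<le> energy a w" by (rule energy_potential_bound[OF a w])
  finally show ?thesis using a t by (simp add: field_simps)
qed

text \<open>At distance at most \<open>\<delta>\<close> inside the interval, the kernel is at least of order \<open>a / \<delta>\<^sup>2\<close>, so the Dirichlet part of the energy
controls the oscillation of \<open>w\<close> at scale \<open>\<delta>\<close>. What remains of \<open>w\<close> at this scale is controlled by its local \<open>L\<^sup>1\<close> norm.\<close>

lemma local_bound:
  assumes a: "0 < a" and w: "sq_int w" and d: "a \<le> \<delta>" "\<delta> \<le> R" and R: "a * (C * (2 * R) powr \<gamma>) \<le> 1"
  shows "\<delta> * (\<integral>x. indicator {-R..R} x * (w x)\<^sup>2 \<partial>lborel) \<le> 3 * pi * \<delta>\<^sup>2 * (energy a w / a) + (\<integral>x. indicator {-R..R} x * \<bar>w x\<bar> \<partial>lborel)\<^sup>2"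
proof -
  have [measurable]: "w \<in> borel_measurable borel" using w by (rule sq_int_measurable)
  have d0: "0 < \<delta>" "0 < R" using a d by auto
  let ?B = "{-R..R}" let ?P = "lborel \<Otimes>\<^sub>M lborel :: (real \<times> real) measure"
  define X where "X x y = (indicator ?B x * indicator ?B y * (if \<bar>x - y\<bar> \<le> \<delta> then 1 else 0) :: real)" for x y
  have [measurable]: "(\<lambda>(x, y). X x y) \<in> borel_measurable (borel \<Otimes>\<^sub>M borel)" unfolding X_def by measurable
  have Xsym: "X x y = X y x" for x y unfolding X_def by (simp add: abs_minus_commute mult.commute)
  have X01: "0 \<le> X x y" "X x y \<le> indicator ?B x * indicator ?B y" for x y unfolding X_def by (auto split: split_indicator)
  have i1: "integrable ?P (\<lambda>(x, y). X x y * (w x)\<^sup>2)"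
  proof (rule integrable_product_bound[OF _ sq_int_square[OF w] integrable_indicator_Icc[of "-R" R]])
    show "norm (case (x, y) of (x, y) \<Rightarrow> X x y * (w x)\<^sup>2) \<le> (w x)\<^sup>2 * indicator ?B y" for x y
      unfolding X_def by (auto split: split_indicator)
  qed simp
  have sw: "(\<lambda>(x, y). X x y * (w y)\<^sup>2) = (\<lambda>(x, y). (\<lambda>(x, y). X x y * (w x)\<^sup>2) (y, x))"
    by (auto simp: Xsym fun_eq_iff)
  have i2: "integrable ?P (\<lambda>(x, y). X x y * (w y)\<^sup>2)"
    unfolding sw by (rule lborel_pair.integrable_product_swap[OF i1])
  have e2: "(\<integral>p. (case p of (x, y) \<Rightarrow> X x y * (w y)\<^sup>2) \<partial>?P) = (\<integral>p. (case p of (x, y) \<Rightarrow> X x y * (w x)\<^sup>2) \<partial>?P)"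
    unfolding sw by (rule lborel_pair.integral_product_swap) simp
  have wB: "integrable lborel (\<lambda>x. indicator ?B x * \<bar>w x\<bar>)"
    by (rule sq_int_local) (rule sq_int_dominated[OF w]; simp)
  note pB = product_integral[OF wB wB]
  have i3: "integrable ?P (\<lambda>(x, y). X x y * (w x * w y))"
  proof (rule integrable_product_bound[OF _ wB wB])
    show "norm (case (x, y) of (x, y) \<Rightarrow> X x y * (w x * w y)) \<le> indicator ?B x * \<bar>w x\<bar> * (indicator ?B y * \<bar>w y\<bar>)" for x y
      unfolding X_def by (auto simp: abs_mult split: split_indicator)
  qed simp
  have B2: "integrable lborel (\<lambda>x. indicator ?B x * (w x)\<^sup>2)"
    by (rule Bochner_Integration.integrable_bound[OF sq_int_square[OF w]]) (auto split: split_indicator)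
  have low: "\<delta> * (\<integral>x. indicator ?B x * (w x)\<^sup>2 \<partial>lborel) \<le> (\<integral>p. (case p of (x, y) \<Rightarrow> X x y * (w x)\<^sup>2) \<partial>?P)"
  proof -
    have Xi: "integrable lborel (X x)" for x
      by (rule Bochner_Integration.integrable_bound[OF integrable_indicator_Icc[of "-R" R]]) (auto simp: X_def split: split_indicator)
    have Xd: "\<delta> * indicator ?B x \<le> (\<integral>y. X x y \<partial>lborel)" for x
    proof (cases "x \<in> ?B")
      case True
      \<comment> \<open>One of the two halves of the \<open>\<delta>\<close>-neighbourhood of \<open>x\<close> lies in the interval, as \<open>\<delta> \<le> R\<close>.\<close>
      define I where "I = (if x \<le> 0 then {x..x + \<delta>} else {x - \<delta>..x})"
      have "\<delta> = (\<integral>y. indicator I y \<partial>lborel)" using d0 unfolding I_def by auto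
      also have "\<dots> \<le> (\<integral>y. X x y \<partial>lborel)"
      proof (intro integral_mono Xi)
        show "integrable lborel (indicator I :: real \<Rightarrow> real)" unfolding I_def by (auto intro: integrable_indicator_Icc)
        show "indicator I y \<le> X x y" for y
          using True d0 d unfolding I_def X_def by (auto split: split_indicator)
      qed
      finally show ?thesis using True by simp
    next
      case False
      then show ?thesis using X01(1) by (auto intro!: integral_nonneg_AE)
    qed
    have "\<delta> * (\<integral>x. indicator ?B x * (w x)\<^sup>2 \<partial>lborel) = (\<integral>x. \<delta> * indicator ?B x * (w x)\<^sup>2 \<partial>lborel)"
      by (simp add: mult.assoc)
    also have "\<dots> \<le> (\<integral>x. (\<integral>y. X x y \<partial>lborel) * (w x)\<^sup>2 \<partial>lborel)"
    proof (intro integral_mono mult_right_mono Xd)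
      show "integrable lborel (\<lambda>x. \<delta> * indicator ?B x * (w x)\<^sup>2)" using integrable_mult_right[OF B2, of \<delta>] by (simp add: mult.assoc)
      show "integrable lborel (\<lambda>x. (\<integral>y. X x y \<partial>lborel) * (w x)\<^sup>2)" using lborel_pair.integrable_fst'[OF i1] by simp
    qed simp
    also have "\<dots> = (\<integral>p. (case p of (x, y) \<Rightarrow> X x y * (w x)\<^sup>2) \<partial>?P)"
      by (subst lborel_pair.integral_fst'[OF i1, symmetric]) simp
    finally show ?thesis .
  qed
  have KX: "X x y \<le> 3 * pi * \<delta>\<^sup>2 / a * K a x y" for x y
  proof (cases "x \<in> ?B \<and> y \<in> ?B \<and> \<bar>x - y\<bar> \<le> \<delta>")
    case True
    have "T x y \<le> C * (\<bar>x\<bar> + \<bar>y\<bar>) powr \<gamma>" by (rule T_upper)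
    also have "\<dots> \<le> C * (2 * R) powr \<gamma>" using True C_pos \<gamma>_pos by (intro mult_left_mono powr_mono2) auto
    finally have "a * T x y \<le> 1" using R a by (meson less_imp_le mult_left_mono order_trans)
    then have "a\<^sup>2 * (a * T x y) \<le> a\<^sup>2 * 1" by (rule mult_left_mono) simp
    moreover have "a\<^sup>2 \<le> \<delta>\<^sup>2" using a d by (intro power_mono) auto
    moreover have "(x - y)\<^sup>2 \<le> \<delta>\<^sup>2" using True d0 by (intro power2_le_iff_abs_le[THEN iffD2]) auto
    ultimately have "a\<^sup>2 + (x - y)\<^sup>2 + a ^ 3 * T x y \<le> 3 * \<delta>\<^sup>2" by (simp add: power2_eq_square power3_eq_cube mult.assoc)
    then have "1 \<le> 3 * \<delta>\<^sup>2 / (a\<^sup>2 + (x - y)\<^sup>2 + a ^ 3 * T x y)" using K_denominator[OF a, of x y] by simp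
    also have "\<dots> = 3 * pi * \<delta>\<^sup>2 / a * K a x y" unfolding K_def using a by simp
    finally show ?thesis using True unfolding X_def by simp
  next
    case False
    then have "X x y = 0" unfolding X_def by auto
    then show ?thesis using K_pos[OF a, of x y] a by simp
  qed
  have "2 * (\<integral>p. (case p of (x, y) \<Rightarrow> X x y * (w x)\<^sup>2) \<partial>?P)
     = (\<integral>p. (case p of (x, y) \<Rightarrow> X x y * (w x)\<^sup>2) + (case p of (x, y) \<Rightarrow> X x y * (w y)\<^sup>2) \<partial>?P)"
    using i1 i2 e2 by simp
  also have "\<dots> \<le> (\<integral>p. 3 * pi * \<delta>\<^sup>2 / a * (case p of (x, y) \<Rightarrow> K a x y * (w x - w y)\<^sup>2) 
      + 2 * (case p of (x, y) \<Rightarrow> indicator ?B x * \<bar>w x\<bar> * (indicator ?B y * \<bar>w y\<bar>)) \<partial>?P)"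
  proof (intro integral_mono Bochner_Integration.integrable_add integrable_mult_right i1 i2 energy_difference_bound(1)[OF a w] pB(1))
    fix p :: "real \<times> real"
    obtain x y where p: "p = (x, y)" by (cases p)
    have "X x y * (w x)\<^sup>2 + X x y * (w y)\<^sup>2 = X x y * (w x - w y)\<^sup>2 + 2 * (X x y * (w x * w y))"
      by (simp add: power2_eq_square algebra_simps)
    moreover have "X x y * (w x - w y)\<^sup>2 \<le> 3 * pi * \<delta>\<^sup>2 / a * K a x y * (w x - w y)\<^sup>2"
      by (rule mult_right_mono[OF KX]) simp
    moreover have "X x y * (w x * w y) \<le> indicator ?B x * \<bar>w x\<bar> * (indicator ?B y * \<bar>w y\<bar>)"
    proof -
      have "X x y * (w x * w y) \<le> X x y * (\<bar>w x\<bar> * \<bar>w y\<bar>)"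
        using X01(1)[of x y] by (intro mult_left_mono) (auto simp flip: abs_mult)
      also have "\<dots> \<le> indicator ?B x * indicator ?B y * (\<bar>w x\<bar> * \<bar>w y\<bar>)"
        by (intro mult_right_mono X01) simp
      finally show ?thesis by (simp add: mult_ac)
    qed
    ultimately show "(case p of (x, y) \<Rightarrow> X x y * (w x)\<^sup>2) + (case p of (x, y) \<Rightarrow> X x y * (w y)\<^sup>2) \<le>
      3 * pi * \<delta>\<^sup>2 / a * (case p of (x, y) \<Rightarrow> K a x y * (w x - w y)\<^sup>2) 
      + 2 * (case p of (x, y) \<Rightarrow> indicator ?B x * \<bar>w x\<bar> * (indicator ?B y * \<bar>w y\<bar>))"
      unfolding p by simp
  qed
  also have "\<dots> = 3 * pi * \<delta>\<^sup>2 / a * (\<integral>p. (case p of (x, y) \<Rightarrow> K a x y * (w x - w y)\<^sup>2) \<partial>?P) + 2 * (\<integral>x. indicator ?B x * \<bar>w x\<bar> \<partial>lborel)\<^sup>2"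
    using energy_difference_bound(1)[OF a w] pB by (simp add: power2_eq_square)
  also have "\<dots> \<le> 3 * pi * \<delta>\<^sup>2 / a * (2 * energy a w) + 2 * (\<integral>x. indicator ?B x * \<bar>w x\<bar> \<partial>lborel)\<^sup>2"
    using a by (intro add_right_mono mult_left_mono energy_difference_bound(2)[OF a w]) auto
  finally show ?thesis using low by simp
qed

text \<open>A substitute for compactness. Bounded energy rules out escape of mass to infinity by the tail estimate and
concentration of mass at small scales by the local estimate, so nothing but local convergence to 0 in \<open>L\<^sup>1\<close> has to be
checked.\<close>

lemma bounded_energy_vanishing:
  fixes a :: "nat \<Rightarrow> real" and w :: "nat \<Rightarrow> real \<Rightarrow> real"
  assumes a: "\<And>n. 0 < a n" "a \<longlonglongrightarrow> 0" and w: "\<And>n. sq_int (w n)"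
    and E: "\<forall>\<^sub>F n in sequentially. energy (a n) (w n) \<le> E * a n" "0 < E"
    and loc: "\<And>R. 1 \<le> R \<Longrightarrow> (\<lambda>n. \<integral>x. indicator {-R..R} x * \<bar>w n x\<bar> \<partial>lborel) \<longlonglongrightarrow> 0"
  shows "(\<lambda>n. \<integral>x. (w n x)\<^sup>2 \<partial>lborel) \<longlonglongrightarrow> 0"
proof (rule order_tendstoI)
  fix e :: real assume "e < 0"
  have "0 \<le> (\<integral>x. (w n x)\<^sup>2 \<partial>lborel)" for n by simp
  then show "\<forall>\<^sub>F n in sequentially. e < (\<integral>x. (w n x)\<^sup>2 \<partial>lborel)"
    using \<open>e < 0\<close> by (intro always_eventually allI) (meson less_le_trans)
next
  fix e :: real assume e: "0 < e"
  \<comment> \<open>\<open>\<tau>\<close> makes the tail at most \<open>e/4\<close>, and \<open>R\<close> is so large that the symbol is at least \<open>\<tau>\<close> beyond it; \<open>\<delta>\<close> makes the oscillation at most \<open>e/4\<close>.\<close>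
  define \<tau> where "\<tau> = 16 * E / e"
  have t: "0 < \<tau>" using e E(2) by (simp add: \<tau>_def)
  define R where "R = max 1 ((\<tau> / c) powr (1 / \<gamma>))"
  have R1: "1 \<le> R" unfolding R_def by simp
  have Rt: "\<tau> \<le> c * \<bar>x\<bar> powr \<gamma>" if "x \<notin> {-R..R}" for x
  proof -
    have "(\<tau> / c) powr (1 / \<gamma>) \<le> \<bar>x\<bar>" using that unfolding R_def by auto
    then have "((\<tau> / c) powr (1 / \<gamma>)) powr \<gamma> \<le> \<bar>x\<bar> powr \<gamma>" using \<gamma>_pos by (intro powr_mono2) auto
    moreover have "((\<tau> / c) powr (1 / \<gamma>)) powr \<gamma> = \<tau> / c" using \<gamma>_pos t c_pos by (simp add: powr_powr)
    ultimately show ?thesis using c_pos by (simp add: field_simps)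
  qed
  define \<delta> where "\<delta> = min 1 (e / (12 * pi * E))"
  have d: "0 < \<delta>" "\<delta> \<le> R" "3 * pi * \<delta> * E \<le> e / 4"
  proof -
    show "0 < \<delta>" "\<delta> \<le> R" using e E(2) R1 unfolding \<delta>_def by auto
    have "\<delta> \<le> e / (12 * pi * E)" unfolding \<delta>_def by simp
    then have "3 * pi * E * \<delta> \<le> 3 * pi * E * (e / (12 * pi * E))" using E(2) by (intro mult_left_mono) auto
    also have "\<dots> = e / 4" using E(2) by simp
    finally show "3 * pi * \<delta> * E \<le> e / 4" by (simp add: mult_ac)
  qed
  let ?CR = "C * (2 * R) powr \<gamma>"
  have l1: "(\<lambda>n. a n * \<tau>) \<longlonglongrightarrow> 0" "(\<lambda>n. a n * ?CR) \<longlonglongrightarrow> 0"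
    using tendsto_mult_right[OF a(2)] by simp_all
  have l2: "(\<lambda>n. (\<integral>x. indicator {-R..R} x * \<bar>w n x\<bar> \<partial>lborel)\<^sup>2) \<longlonglongrightarrow> 0"
    using tendsto_power[OF loc[OF R1], of 2] by simp
  have de: "0 < \<delta> * (e / 4)" using d e by simp
  show "\<forall>\<^sub>F n in sequentially. (\<integral>x. (w n x)\<^sup>2 \<partial>lborel) < e"
    using E(1) order_tendstoD(2)[OF l1(1) zero_less_one] order_tendstoD(2)[OF l1(2) zero_less_one]
      order_tendstoD(2)[OF a(2) d(1)] order_tendstoD(2)[OF l2 de]
  proof eventually_elim
    case (elim n)
    let ?B = "{-R..R}"
    have [measurable]: "w n \<in> borel_measurable borel" using w by (rule sq_int_measurable)
    have Ea: "energy (a n) (w n) / a n \<le> E" using elim(1) a(1)[of n] by (simp add: divide_le_eq)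
    have i: "integrable lborel (\<lambda>x. indicator A x * (w n x)\<^sup>2)" if [measurable]: "A \<in> sets borel" for A
      by (rule Bochner_Integration.integrable_bound[OF sq_int_square[OF w[of n]]]) (auto split: split_indicator)
    have tail: "(\<integral>x. indicator (- ?B) x * (w n x)\<^sup>2 \<partial>lborel) \<le> e / 4"
    proof -
      have "(\<integral>x. indicator (- ?B) x * (w n x)\<^sup>2 \<partial>lborel) \<le> 4 * energy (a n) (w n) / (a n * \<tau>)"
        by (rule tail_bound) (use a w t elim Rt in auto)
      also have "\<dots> = 4 * (energy (a n) (w n) / a n) / \<tau>" by simp
      also have "\<dots> \<le> 4 * E / \<tau>" using Ea t by (intro divide_right_mono) auto
      also have "\<dots> = e / 4" using E(2) e unfolding \<tau>_def by simp
      finally show ?thesis .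
    qed
    have "\<delta> * (\<integral>x. indicator ?B x * (w n x)\<^sup>2 \<partial>lborel) \<le> 3 * pi * \<delta>\<^sup>2 * (energy (a n) (w n) / a n) + (\<integral>x. indicator ?B x * \<bar>w n x\<bar> \<partial>lborel)\<^sup>2"
      by (rule local_bound) (use a w d elim in auto)
    also have "\<dots> \<le> 3 * pi * \<delta>\<^sup>2 * E + \<delta> * (e / 4)"
      using Ea elim by (intro add_mono mult_left_mono) auto
    also have "3 * pi * \<delta>\<^sup>2 * E = \<delta> * (3 * pi * \<delta> * E)" by (simp add: power2_eq_square)
    also have "\<dots> + \<delta> * (e / 4) \<le> \<delta> * (e / 4) + \<delta> * (e / 4)"
      using d by (intro add_mono mult_left_mono) auto
    finally have "\<delta> * (\<integral>x. indicator ?B x * (w n x)\<^sup>2 \<partial>lborel) \<le> \<delta> * (e / 2)" by (simp add: algebra_simps)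
    then have local: "(\<integral>x. indicator ?B x * (w n x)\<^sup>2 \<partial>lborel) \<le> e / 2" using d(1) by simp
    have "(\<integral>x. (w n x)\<^sup>2 \<partial>lborel) = (\<integral>x. indicator ?B x * (w n x)\<^sup>2 + indicator (- ?B) x * (w n x)\<^sup>2 \<partial>lborel)"
      by (intro Bochner_Integration.integral_cong refl) (auto split: split_indicator)
    also have "\<dots> = (\<integral>x. indicator ?B x * (w n x)\<^sup>2 \<partial>lborel) + (\<integral>x. indicator (- ?B) x * (w n x)\<^sup>2 \<partial>lborel)"
      by (intro Bochner_Integration.integral_add i) auto
    also have "\<dots> < e" using tail local e by linarith
    finally show ?case .
  qed
qed

section \<open>Positive eigenfunctions\<close>

text \<open>Expand the square. Two of the terms are equal by symmetry of the kernel, and integrating out the variable that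
occurs only in \<open>u\<close> produces \<open>K\<^sub>a u = M u\<close>, which cancels the denominator.\<close>

lemma ground_state_identity:
  assumes a: "0 < a" and u: "sq_int u" "\<And>x. 0 < u x" and k: "sq_int k"
    and eig: "AE x in lborel. K_mean a u x = M * u x"
  shows "integrable (lborel \<Otimes>\<^sub>M lborel) (\<lambda>(x, y). K a x y * ((k x * u y - k y * u x)\<^sup>2 / (u x * u y)))"
    and "(\<integral>p. (case p of (x, y) \<Rightarrow> K a x y * ((k x * u y - k y * u x)\<^sup>2 / (u x * u y))) \<partial>(lborel \<Otimes>\<^sub>M lborel))
       = 2 * (M * (\<integral>x. (k x)\<^sup>2 \<partial>lborel) - form a k k)"
proof -
  let ?P = "lborel \<Otimes>\<^sub>M lborel :: (real \<times> real) measure"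
  have [measurable]: "u \<in> borel_measurable borel" "k \<in> borel_measurable borel" using u k by (auto intro: sq_int_measurable)
  let ?A = "\<lambda>x y. K a x y * ((k x)\<^sup>2 / u x * u y)"
  have inner: "(\<integral>y. ?A x y \<partial>lborel) = (k x)\<^sup>2 / u x * K_mean a u x" for x
  proof -
    have "(\<lambda>y. ?A x y) = (\<lambda>y. (k x)\<^sup>2 / u x * (K a x y * u y))" by (rule ext) (simp add: mult_ac)
    then show ?thesis unfolding K_mean_def by (simp only: integral_mult_right_zero)
  qed
  have ae: "AE x in lborel. (k x)\<^sup>2 / u x * K_mean a u x = M * (k x)\<^sup>2"
    using eig
  proof eventually_elim
    case (elim x)
    then show ?case using u(2)[of x] by simp
  qed
  have i: "integrable ?P (\<lambda>(x, y). ?A x y)"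
  proof (rule lborel_pair.Fubini_integrable)
    have nA: "norm (case (x, y) of (x, y) \<Rightarrow> ?A x y) = ?A x y" for x y
      using K_pos[OF a, of x y] u(2)[of x] u(2)[of y] by simp
    have eq: "(\<lambda>x. \<integral>y. norm (case (x, y) of (x, y) \<Rightarrow> ?A x y) \<partial>lborel) = (\<lambda>x. (k x)\<^sup>2 / u x * K_mean a u x)"
      by (simp only: nA inner)
    show "integrable lborel (\<lambda>x. \<integral>y. norm (case (x, y) of (x, y) \<Rightarrow> ?A x y) \<partial>lborel)"
      unfolding eq using integrable_cong_AE[OF _ _ ae] sq_int_square[OF k] by simp
    show "AE x in lborel. integrable lborel (\<lambda>y. case (x, y) of (x, y) \<Rightarrow> ?A x y)"
    proof (rule AE_I2)
      fix x
      have "integrable lborel (\<lambda>y. (k x)\<^sup>2 / u x * (K a x y * u y))"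
        by (intro integrable_mult_right integrable_K_mult a) (use u in \<open>auto simp: sq_int_def\<close>)
      then show "integrable lborel (\<lambda>y. case (x, y) of (x, y) \<Rightarrow> ?A x y)" by (simp add: mult_ac)
    qed
  qed simp
  have e: "(\<integral>p. (case p of (x, y) \<Rightarrow> ?A x y) \<partial>?P) = M * (\<integral>x. (k x)\<^sup>2 \<partial>lborel)"
  proof -
    have "(\<integral>p. (case p of (x, y) \<Rightarrow> ?A x y) \<partial>?P) = (\<integral>x. (k x)\<^sup>2 / u x * K_mean a u x \<partial>lborel)"
      by (subst lborel_pair.integral_fst'[OF i, symmetric]) (simp only: prod.case inner)
    also have "\<dots> = (\<integral>x. M * (k x)\<^sup>2 \<partial>lborel)" using ae by (intro integral_cong_AE) simp_all
    finally show ?thesis by simp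
  qed
  have sw: "(\<lambda>(x, y). ?A y x) = (\<lambda>(x, y). (\<lambda>(x, y). ?A x y) (y, x))" by auto
  have i2: "integrable ?P (\<lambda>(x, y). ?A y x)" unfolding sw by (rule lborel_pair.integrable_product_swap[OF i])
  have e2: "(\<integral>p. (case p of (x, y) \<Rightarrow> ?A y x) \<partial>?P) = M * (\<integral>x. (k x)\<^sup>2 \<partial>lborel)"
    unfolding sw e[symmetric] by (rule lborel_pair.integral_product_swap) simp
  have eq: "(\<lambda>(x, y). K a x y * ((k x * u y - k y * u x)\<^sup>2 / (u x * u y)))
     = (\<lambda>p. (case p of (x, y) \<Rightarrow> ?A x y) + (case p of (x, y) \<Rightarrow> ?A y x) - 2 * (case p of (x, y) \<Rightarrow> K a x y * (k x * k y)))"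
  proof (rule ext, clarify)
    fix x y
    have e: "(k x * u y - k y * u x)\<^sup>2 / (u x * u y) = (k x)\<^sup>2 / u x * u y + (k y)\<^sup>2 / u y * u x - 2 * (k x * k y)"
      using u(2)[of x] u(2)[of y] by (simp add: field_simps power2_eq_square)
    have "q * (r + s - 2 * t) = q * r + q * s - 2 * (q * t)" for q r s t :: real
      by (simp add: algebra_simps)
    then show "K a x y * ((k x * u y - k y * u x)\<^sup>2 / (u x * u y)) = ?A x y + ?A y x - 2 * (K a x y * (k x * k y))"
      unfolding e K_sym[of a y x] .
  qed
  note f = form_integrable[OF a k k]
  show "integrable ?P (\<lambda>(x, y). K a x y * ((k x * u y - k y * u x)\<^sup>2 / (u x * u y)))"
    unfolding eq by (intro Bochner_Integration.integrable_diff Bochner_Integration.integrable_add integrable_mult_right i i2 f)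
  show "(\<integral>p. (case p of (x, y) \<Rightarrow> K a x y * ((k x * u y - k y * u x)\<^sup>2 / (u x * u y))) \<partial>?P)
       = 2 * (M * (\<integral>x. (k x)\<^sup>2 \<partial>lborel) - form a k k)"
    unfolding eq form_def using i i2 f e e2 by simp
qed

text \<open>The integrand in the ground state identity is non-negative: a positive eigenfunction belongs to the top of the spectrum.\<close>

lemma ground_state_maximal:
  assumes a: "0 < a" and u: "sq_int u" "\<And>x. 0 < u x" and k: "sq_int k"
    and eig: "AE x in lborel. K_mean a u x = M * u x"
  shows "form a k k \<le> M * (\<integral>x. (k x)\<^sup>2 \<partial>lborel)"
proof -
  have "0 \<le> (\<integral>p. (case p of (x, y) \<Rightarrow> K a x y * ((k x * u y - k y * u x)\<^sup>2 / (u x * u y))) \<partial>(lborel \<Otimes>\<^sub>M lborel))"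
  proof (rule integral_nonneg_AE, rule AE_I2, clarify)
    fix x y :: real
    show "0 \<le> K a x y * ((k x * u y - k y * u x)\<^sup>2 / (u x * u y))"
      using K_pos[OF a, of x y] u(2)[of x] u(2)[of y] by simp
  qed
  then show ?thesis unfolding ground_state_identity(2)[OF assms] by simp
qed

text \<open>Cauchy--Schwarz in the ground state identity. The left side vanishes exactly if \<open>k\<close> and \<open>u\<close> are proportional on the interval,
and the right side is, up to a constant, the amount by which the Rayleigh quotient of \<open>k\<close> misses the top eigenvalue, on the scale \<open>a\<close>.\<close>

lemma wronskian_bound:
  assumes a: "0 < a" "a \<le> 1" and u: "sq_int u" "\<And>x. 0 < u x" and k: "sq_int k"
    and eig: "AE x in lborel. K_mean a u x = M * u x" and R: "0 < R"
    and nu: "(\<integral>x. (u x)\<^sup>2 \<partial>lborel) = 1"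
  defines "D \<equiv> 1 + 4 * R\<^sup>2 + C * (2 * R) powr \<gamma>"
  shows "integrable (lborel \<Otimes>\<^sub>M lborel) (\<lambda>(x, y). indicator {-R..R} x * indicator {-R..R} y * \<bar>k x * u y - k y * u x\<bar>)"
    and "(\<integral>p. (case p of (x, y) \<Rightarrow> indicator {-R..R} x * indicator {-R..R} y * \<bar>k x * u y - k y * u x\<bar>) \<partial>(lborel \<Otimes>\<^sub>M lborel))\<^sup>2
     \<le> 4 * pi * D * R * ((M * (\<integral>x. (k x)\<^sup>2 \<partial>lborel) - form a k k) / a)"
proof -
  let ?P = "lborel \<Otimes>\<^sub>M lborel :: (real \<times> real) measure" and ?B = "{-R..R}"
  have [measurable]: "u \<in> borel_measurable borel" "k \<in> borel_measurable borel" using u k by (auto intro: sq_int_measurable)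
  define S where "S x y = K a x y * ((k x * u y - k y * u x)\<^sup>2 / (u x * u y))" for x y
  have Si: "integrable ?P (\<lambda>(x, y). S x y)" and Sv: "(\<integral>p. (case p of (x, y) \<Rightarrow> S x y) \<partial>?P) = 2 * (M * (\<integral>x. (k x)\<^sup>2 \<partial>lborel) - form a k k)"
    unfolding S_def using ground_state_identity[OF a(1) u k eig] by auto
  have S0: "0 \<le> S x y" for x y unfolding S_def using K_pos[OF a(1), of x y] u(2)[of x] u(2)[of y] by simp
  define f where "f x y = indicator ?B x * indicator ?B y * \<bar>k x * u y - k y * u x\<bar> / sqrt (u x * u y)" for x y
  define g where "g x y = indicator ?B x * indicator ?B y * sqrt (u x * u y)" for x y
  have [measurable]: "(\<lambda>(x, y). f x y) \<in> borel_measurable ?P" "(\<lambda>(x, y). g x y) \<in> borel_measurable ?P"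
    unfolding f_def g_def by measurable
  have fg: "f x y * g x y = indicator ?B x * indicator ?B y * \<bar>k x * u y - k y * u x\<bar>" for x y
    using u(2)[of x] u(2)[of y] unfolding f_def g_def by (auto split: split_indicator)
  have D: "0 < D" unfolding D_def using C_pos by (intro add_pos_nonneg) auto
  have f2: "(f x y)\<^sup>2 \<le> pi * D / a * S x y" for x y
  proof (cases "x \<in> ?B \<and> y \<in> ?B")
    case True
    have "T x y \<le> C * (\<bar>x\<bar> + \<bar>y\<bar>) powr \<gamma>" by (rule T_upper)
    also have "\<dots> \<le> C * (2 * R) powr \<gamma>" using True C_pos \<gamma>_pos by (intro mult_left_mono powr_mono2) auto
    finally have "T x y \<le> C * (2 * R) powr \<gamma>" .
    moreover have "a ^ 3 * T x y \<le> 1 * T x y" using a T_nonneg[of x y] by (intro mult_right_mono) (auto simp: power_le_one)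
    moreover have "a\<^sup>2 \<le> 1" using a by (simp add: power_le_one)
    moreover have "(x - y)\<^sup>2 \<le> (2 * R)\<^sup>2" using True R by (intro power2_le_iff_abs_le[THEN iffD2]) auto
    ultimately have "a\<^sup>2 + (x - y)\<^sup>2 + a ^ 3 * T x y \<le> D" unfolding D_def by (simp add: power_mult_distrib)
    then have "1 \<le> D / (a\<^sup>2 + (x - y)\<^sup>2 + a ^ 3 * T x y)" using K_denominator[OF a(1), of x y] by simp
    also have "\<dots> = pi * D / a * K a x y" unfolding K_def using a by simp
    finally have *: "1 \<le> pi * D / a * K a x y" .
    have "(f x y)\<^sup>2 = 1 * ((k x * u y - k y * u x)\<^sup>2 / (u x * u y))"
      unfolding f_def using True u(2)[of x] u(2)[of y] by (simp add: power_divide)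
    also have "\<dots> \<le> pi * D / a * K a x y * ((k x * u y - k y * u x)\<^sup>2 / (u x * u y))"
      using u(2)[of x] u(2)[of y] by (intro mult_right_mono *) auto
    finally show ?thesis unfolding S_def by simp
  next
    case False
    then have "f x y = 0" unfolding f_def by auto
    then show ?thesis using S0[of x y] D a by simp
  qed
  have uB: "integrable lborel (\<lambda>x. indicator ?B x * u x)" by (rule sq_int_local[OF u(1)])
  have g2: "(g x y)\<^sup>2 = indicator ?B x * u x * (indicator ?B y * u y)" for x y
    unfolding g_def using u(2)[of x] u(2)[of y] by (auto split: split_indicator)
  have fi: "integrable ?P (\<lambda>p. ((case p of (x, y) \<Rightarrow> f x y))\<^sup>2)"
  proof (rule Bochner_Integration.integrable_bound[OF integrable_mult_right[OF Si, of "pi * D / a"]])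
    show "AE p in ?P. norm ((case p of (x, y) \<Rightarrow> f x y)\<^sup>2) \<le> norm (pi * D / a * (case p of (x, y) \<Rightarrow> S x y))"
    proof (rule AE_I2, clarify)
      fix x y
      have "(f x y)\<^sup>2 \<le> \<bar>pi * D / a * S x y\<bar>" by (rule order_trans[OF f2 abs_ge_self])
      then show "norm ((f x y)\<^sup>2) \<le> norm (pi * D / a * S x y)" by (simp only: real_norm_def abs_of_nonneg zero_le_power2)
    qed
  qed (simp add: S_def)
  have geq: "(\<lambda>p. (case p of (x, y) \<Rightarrow> g x y)\<^sup>2) = (\<lambda>(x, y). indicator ?B x * u x * (indicator ?B y * u y))"
    by (auto simp: g2 fun_eq_iff)
  have fgeq: "(\<lambda>p. (case p of (x, y) \<Rightarrow> f x y) * (case p of (x, y) \<Rightarrow> g x y))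
     = (\<lambda>(x, y). indicator ?B x * indicator ?B y * \<bar>k x * u y - k y * u x\<bar>)"
    by (auto simp: fg fun_eq_iff)
  have gi: "integrable ?P (\<lambda>p. ((case p of (x, y) \<Rightarrow> g x y))\<^sup>2)"
    using product_integral(1)[OF uB uB] unfolding geq .
  show "integrable ?P (\<lambda>(x, y). indicator {-R..R} x * indicator {-R..R} y * \<bar>k x * u y - k y * u x\<bar>)"
    using integrable_mult_of_squares[OF _ _ fi gi] unfolding fgeq by simp
  have "(\<integral>p. (case p of (x, y) \<Rightarrow> indicator ?B x * indicator ?B y * \<bar>k x * u y - k y * u x\<bar>) \<partial>?P)\<^sup>2
     = (\<integral>p. (case p of (x, y) \<Rightarrow> f x y) * (case p of (x, y) \<Rightarrow> g x y) \<partial>?P)\<^sup>2"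
    unfolding fgeq ..
  also have "\<dots> \<le> (\<integral>p. (case p of (x, y) \<Rightarrow> f x y)\<^sup>2 \<partial>?P) * (\<integral>p. (case p of (x, y) \<Rightarrow> g x y)\<^sup>2 \<partial>?P)"
    by (rule integral_mult_le_sqrt) (use fi gi in simp_all)
  also have "\<dots> \<le> (pi * D / a * (2 * (M * (\<integral>x. (k x)\<^sup>2 \<partial>lborel) - form a k k))) * (2 * R)"
  proof (rule mult_mono)
    have "(\<integral>p. (case p of (x, y) \<Rightarrow> f x y)\<^sup>2 \<partial>?P) \<le> (\<integral>p. pi * D / a * (case p of (x, y) \<Rightarrow> S x y) \<partial>?P)"
      by (intro integral_mono fi integrable_mult_right Si) (use f2 in auto)
    also have "\<dots> = pi * D / a * (2 * (M * (\<integral>x. (k x)\<^sup>2 \<partial>lborel) - form a k k))"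
      unfolding Sv[symmetric] by (rule integral_mult_right_zero)
    finally show "(\<integral>p. (case p of (x, y) \<Rightarrow> f x y)\<^sup>2 \<partial>?P) \<le> pi * D / a * (2 * (M * (\<integral>x. (k x)\<^sup>2 \<partial>lborel) - form a k k))" .
    have "(\<integral>p. (case p of (x, y) \<Rightarrow> g x y)\<^sup>2 \<partial>?P) = (\<integral>x. indicator ?B x * u x \<partial>lborel)\<^sup>2"
      unfolding geq product_integral(2)[OF uB uB] by (simp add: power2_eq_square)
    also have "\<dots> \<le> (\<integral>x. (indicator ?B x)\<^sup>2 \<partial>lborel) * (\<integral>x. (u x)\<^sup>2 \<partial>lborel)"
      by (rule sq_int_cauchy_schwarz[OF sq_int_indicator_Icc u(1)])
    also have "\<dots> = 2 * R" unfolding indicator_square using nu R by simp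
    finally show "(\<integral>p. (case p of (x, y) \<Rightarrow> g x y)\<^sup>2 \<partial>?P) \<le> 2 * R" .
    show "0 \<le> pi * D / a * (2 * (M * (\<integral>x. (k x)\<^sup>2 \<partial>lborel) - form a k k))"
      using ground_state_maximal[OF a(1) u k eig] a D by simp
  qed simp
  also have "\<dots> = 4 * pi * D * R * ((M * (\<integral>x. (k x)\<^sup>2 \<partial>lborel) - form a k k) / a)" by simp
  finally show "(\<integral>p. (case p of (x, y) \<Rightarrow> indicator ?B x * indicator ?B y * \<bar>k x * u y - k y * u x\<bar>) \<partial>?P)\<^sup>2
     \<le> 4 * pi * D * R * ((M * (\<integral>x. (k x)\<^sup>2 \<partial>lborel) - form a k k) / a)" .
qed

end

section \<open>Convergence of the rescaled eigenvalues and eigenfunctions\<close>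

text \<open>The situation after rescaling: \<open>k\<close> is the ground state of the limit operator, on which the difference quotients of \<open>K\<^sub>a\<close>
converge, and \<open>u n\<close> is the positive eigenfunction of \<open>K\<^sub>a\<close> at \<open>a = a n\<close>.\<close>

locale ground_state_sequence = homogeneous_perturbation +
  fixes k :: "real \<Rightarrow> real" and lam :: real and a :: "nat \<Rightarrow> real"
    and u :: "nat \<Rightarrow> real \<Rightarrow> real" and M :: "nat \<Rightarrow> real"
  assumes a: "\<And>n. 0 < a n" "\<And>n. a n \<le> 1" "a \<longlonglongrightarrow> 0"
    and k: "sq_int k" "\<And>x. 0 \<le> k x" and k_norm: "(\<integral>x. (k x)\<^sup>2 \<partial>lborel) = 1"
    and k_limit: "(\<lambda>n. sqint (\<lambda>x. (k x - K_mean (a n) k x) / a n - lam * k x)) \<longlonglongrightarrow> 0"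
    and u: "\<And>n. sq_int (u n)" "\<And>n x. 0 < u n x" and u_norm: "\<And>n. (\<integral>x. (u n x)\<^sup>2 \<partial>lborel) = 1"
    and u_eig: "\<And>n. AE x in lborel. K_mean (a n) (u n) x = M n * u n x"
begin

definition residual :: "nat \<Rightarrow> real \<Rightarrow> real" where
  "residual n x = (k x - K_mean (a n) k x) / a n - lam * k x"

definition gap :: "nat \<Rightarrow> real" where
  "gap n = (1 - M n) / a n"

definition overlap :: "nat \<Rightarrow> real" where
  "overlap n = (\<integral>x. u n x * k x \<partial>lborel)"

lemma k_measurable [measurable]: "k \<in> borel_measurable borel"
  using k by (auto intro: sq_int_measurable)

lemma u_measurable [measurable]: "u n \<in> borel_measurable borel"
  using u by (auto intro: sq_int_measurable)

lemma sq_int_residual: "sq_int (residual n)"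
proof -
  have "sq_int (\<lambda>x. (1 / a n) * (k x - K_mean (a n) k x) - lam * k x)"
    by (intro sq_int_diff sq_int_cmult k sq_int_K_mean a)
  then show ?thesis unfolding residual_def[abs_def] by simp
qed

lemma residual_measurable [measurable]: "residual n \<in> borel_measurable borel"
  using sq_int_residual by (rule sq_int_measurable)

lemma residual_tendsto: "(\<lambda>n. \<integral>x. (residual n x)\<^sup>2 \<partial>lborel) \<longlonglongrightarrow> 0"
proof -
  have "sqint (residual n) = ennreal (\<integral>x. (residual n x)\<^sup>2 \<partial>lborel)" for n
    by (rule sqint_eq_integral) (rule sq_int_square[OF sq_int_residual])
  then have "(\<lambda>n. ennreal (\<integral>x. (residual n x)\<^sup>2 \<partial>lborel)) \<longlonglongrightarrow> ennreal 0"
    using k_limit unfolding residual_def[abs_def] by simp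
  then show ?thesis by (subst (asm) tendsto_ennreal_iff) auto
qed

lemma pairing_tendsto:
  assumes w: "\<And>n. sq_int (w n)" "\<And>n. (\<integral>x. (w n x)\<^sup>2 \<partial>lborel) = 1"
  shows "(\<lambda>n. \<integral>x. w n x * residual n x \<partial>lborel) \<longlonglongrightarrow> 0"
proof (rule Lim_null_comparison)
  show "\<forall>\<^sub>F n in sequentially. norm (\<integral>x. w n x * residual n x \<partial>lborel) \<le> sqrt (\<integral>x. (residual n x)\<^sup>2 \<partial>lborel)"
  proof (intro always_eventually allI)
    fix n
    have "(\<integral>x. w n x * residual n x \<partial>lborel)\<^sup>2 \<le> (\<integral>x. (residual n x)\<^sup>2 \<partial>lborel)"
      using sq_int_cauchy_schwarz[OF w(1)[of n] sq_int_residual[of n]] w(2) by simp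
    then show "norm (\<integral>x. w n x * residual n x \<partial>lborel) \<le> sqrt (\<integral>x. (residual n x)\<^sup>2 \<partial>lborel)"
      by (simp add: real_le_rsqrt)
  qed
  show "(\<lambda>n. sqrt (\<integral>x. (residual n x)\<^sup>2 \<partial>lborel)) \<longlonglongrightarrow> 0"
    using tendsto_real_sqrt[OF residual_tendsto] by simp
qed

lemma pairing_eq:
  assumes w: "sq_int w"
  shows "(\<integral>x. w x * residual n x \<partial>lborel) = ((\<integral>x. w x * k x \<partial>lborel) - form (a n) w k) / a n - lam * (\<integral>x. w x * k x \<partial>lborel)"
proof -
  note i = sq_int_mult[OF w k(1)] sq_int_mult[OF w sq_int_K_mean[OF a(1) k(1)], of n]
  have "(\<integral>x. w x * residual n x \<partial>lborel) = (\<integral>x. (w x * k x - w x * K_mean (a n) k x) / a n - lam * (w x * k x) \<partial>lborel)"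
    unfolding residual_def by (intro Bochner_Integration.integral_cong refl) (simp add: right_diff_distrib)
  also have "\<dots> = ((\<integral>x. w x * k x \<partial>lborel) - form (a n) w k) / a n - lam * (\<integral>x. w x * k x \<partial>lborel)"
    unfolding form_eq_mean[OF a(1) w k(1)] using i by simp
  finally show ?thesis .
qed

lemma energy_k_tendsto: "(\<lambda>n. energy (a n) k / a n) \<longlonglongrightarrow> lam"
proof -
  have "(\<integral>x. k x * residual n x \<partial>lborel) = energy (a n) k / a n - lam" for n
    unfolding pairing_eq[OF k(1)] energy_def using k_norm by (simp add: power2_eq_square)
  moreover have "(\<lambda>n. (\<integral>x. k x * residual n x \<partial>lborel) + lam) \<longlonglongrightarrow> 0 + lam"
    by (intro tendsto_add pairing_tendsto tendsto_const k k_norm)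
  ultimately show ?thesis by simp
qed

lemma form_eigen: 
  assumes w: "sq_int w" shows "form (a n) w (u n) = M n * (\<integral>x. u n x * w x \<partial>lborel)"
proof -
  have [measurable]: "w \<in> borel_measurable borel" using w by (rule sq_int_measurable)
  have "form (a n) w (u n) = (\<integral>x. w x * K_mean (a n) (u n) x \<partial>lborel)" by (rule form_eq_mean[OF a(1) w u(1)])
  also have "\<dots> = (\<integral>x. M n * (u n x * w x) \<partial>lborel)"
    using u_eig[of n] by (intro integral_cong_AE) (auto elim!: eventually_mono)
  finally show ?thesis by simp
qed

lemma energy_u: "energy (a n) (u n) = gap n * a n"
  unfolding energy_def gap_def form_eigen[OF u(1)] using u_norm[of n] a(1)[of n] by (simp add: power2_eq_square)

lemma gap_le: "gap n \<le> energy (a n) k / a n"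
proof -
  have "form (a n) k k \<le> M n" using ground_state_maximal[OF a(1) u k(1) u_eig, of n] k_norm by simp
  then show ?thesis unfolding gap_def energy_def using k_norm a(1)[of n] by (intro divide_right_mono) (auto intro: less_imp_le)
qed

lemma lam_nonneg: "0 \<le> lam"
  using energy_k_tendsto by (rule LIMSEQ_le_const) (auto intro!: exI[of _ 0] divide_nonneg_pos energy_nonneg a k)

lemma eventually_energy_le:
  "\<forall>\<^sub>F n in sequentially. energy (a n) k \<le> (lam + 1) * a n"
  "\<forall>\<^sub>F n in sequentially. energy (a n) (u n) \<le> (lam + 1) * a n"
proof -
  have *: "\<forall>\<^sub>F n in sequentially. energy (a n) k / a n < lam + 1"
    by (rule order_tendstoD(2)[OF energy_k_tendsto]) simp
  then show "\<forall>\<^sub>F n in sequentially. energy (a n) k \<le> (lam + 1) * a n"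
    by eventually_elim (use a(1) in \<open>simp add: divide_less_eq less_imp_le\<close>)
  from * show "\<forall>\<^sub>F n in sequentially. energy (a n) (u n) \<le> (lam + 1) * a n"
  proof eventually_elim
    case (elim n)
    then have "gap n \<le> lam + 1" using gap_le[of n] by simp
    then show ?case unfolding energy_u using a(1)[of n] by (intro mult_right_mono) auto
  qed
qed

lemma k_nonzero: "\<not> (AE x in lborel. k x = 0)"
proof
  assume "AE x in lborel. k x = 0"
  then have "(\<integral>x. (k x)\<^sup>2 \<partial>lborel) = (\<integral>x. 0 \<partial>(lborel :: real measure))"
    by (intro integral_cong_AE) (auto elim!: eventually_mono)
  then show False using k_norm by simp
qed

lemma K_mean_1_pos: "0 < K_mean 1 k x"
proof -
  have i: "integrable lborel (\<lambda>y. K 1 x y * k y)" by (rule integrable_K_mult) (use k in \<open>auto simp: sq_int_def\<close>)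
  have nn: "0 \<le> K 1 x y * k y" for y using K_pos[of 1 x y] k(2)[of y] by simp
  have "0 \<le> K_mean 1 k x" unfolding K_mean_def using nn by (intro integral_nonneg_AE) auto
  moreover have "K_mean 1 k x \<noteq> 0"
  proof
    assume "K_mean 1 k x = 0"
    then have "AE y in lborel. K 1 x y * k y = 0"
      unfolding K_mean_def by (subst (asm) integral_nonneg_eq_0_iff_AE[OF i]) (use nn in auto)
    then have "AE y in lborel. k y = 0"
    proof eventually_elim
      case (elim y)
      then show ?case using K_pos[of 1 x y] by simp
    qed
    then show False using k_nonzero by simp
  qed
  ultimately show ?thesis by simp
qed

text \<open>On the zero set of \<open>k\<close> the residual equals \<open>- K\<^sub>a k / a\<close>. The kernels \<open>K\<^sub>a / a\<close> increase as \<open>a\<close> decreases to 0, so its absolute value is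
at least a fixed positive function, whereas the residual tends to 0.\<close>

lemma k_pos_AE: "AE x in lborel. 0 < k x"
proof -
  let ?Z = "{x. k x = 0}"
  have Z[measurable]: "?Z \<in> sets borel" by measurable
  have le: "indicator ?Z x * (K_mean 1 k x)\<^sup>2 \<le> (residual n x)\<^sup>2" for x n
  proof (cases "x \<in> ?Z")
    case True
    have "K 1 x y \<le> K (a n) x y / a n" for y
    proof -
      have "(a n)\<^sup>2 \<le> 1" "a n ^ 3 \<le> 1"
        using a(1,2)[of n] by (auto intro: power_le_one less_imp_le)
      moreover from this(2) have "a n ^ 3 * T x y \<le> 1 * T x y"
        by (rule mult_right_mono) (rule T_nonneg)
      ultimately have "(a n)\<^sup>2 + (x - y)\<^sup>2 + a n ^ 3 * T x y \<le> 1\<^sup>2 + (x - y)\<^sup>2 + 1 ^ 3 * T x y" by simp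
      then have "1 / (pi * (1\<^sup>2 + (x - y)\<^sup>2 + 1 ^ 3 * T x y)) \<le> 1 / (pi * ((a n)\<^sup>2 + (x - y)\<^sup>2 + a n ^ 3 * T x y))"
        using K_denominator[OF a(1), of n x y] K_denominator[of 1 x y]
        by (intro divide_left_mono mult_left_mono mult_pos_pos) auto
      then show ?thesis unfolding K_def using a(1)[of n] by simp
    qed
    then have "K_mean 1 k x \<le> (\<integral>y. K (a n) x y / a n * k y \<partial>lborel)"
      unfolding K_mean_def
    proof (intro integral_mono)
      show "integrable lborel (\<lambda>y. K 1 x y * k y)" by (rule integrable_K_mult) (use k in \<open>auto simp: sq_int_def\<close>)
      have "integrable lborel (\<lambda>y. 1 / a n * (K (a n) x y * k y))"
        by (intro integrable_mult_right integrable_K_mult a) (use k in \<open>auto simp: sq_int_def\<close>)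
      then show "integrable lborel (\<lambda>y. K (a n) x y / a n * k y)" by simp
    qed (intro mult_right_mono k)
    also have "\<dots> = K_mean (a n) k x / a n"
      unfolding K_mean_def by (simp add: mult.commute)
    also have "\<dots> = - residual n x" using True unfolding residual_def by simp
    finally have "(K_mean 1 k x)\<^sup>2 \<le> (- residual n x)\<^sup>2"
      using K_mean_1_pos[of x] by (intro power_mono) auto
    then show ?thesis using True by simp
  qed simp
  have i: "integrable lborel (\<lambda>x. indicator ?Z x * (K_mean 1 k x)\<^sup>2)"
    by (rule Bochner_Integration.integrable_bound[OF sq_int_square[OF sq_int_K_mean[OF zero_less_one k(1)]]])
       (auto split: split_indicator)
  have "(\<integral>x. indicator ?Z x * (K_mean 1 k x)\<^sup>2 \<partial>lborel) \<le> (\<integral>x. (residual n x)\<^sup>2 \<partial>lborel)" for n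
    by (intro integral_mono i sq_int_square[OF sq_int_residual] le)
  then have "(\<integral>x. indicator ?Z x * (K_mean 1 k x)\<^sup>2 \<partial>lborel) \<le> 0"
    by (intro LIMSEQ_le_const[OF residual_tendsto]) auto
  moreover have "0 \<le> (\<integral>x. indicator ?Z x * (K_mean 1 k x)\<^sup>2 \<partial>lborel)" by (intro integral_nonneg_AE) auto
  ultimately have "(\<integral>x. indicator ?Z x * (K_mean 1 k x)\<^sup>2 \<partial>lborel) = 0" by simp
  then have "AE x in lborel. indicator ?Z x * (K_mean 1 k x)\<^sup>2 = 0"
    by (subst (asm) integral_nonneg_eq_0_iff_AE[OF i]) auto
  then show ?thesis
  proof eventually_elim
    case (elim x)
    then have "k x \<noteq> 0" using K_mean_1_pos[of x] by auto
    then show ?case using k(2)[of x] by simp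
  qed
qed

lemma local_integral_k_pos: 
  assumes "0 < R" shows "0 < (\<integral>x. indicator {-R..R} x * k x \<partial>lborel)"
proof -
  have i: "integrable lborel (\<lambda>x. indicator {-R..R} x * k x)" by (rule sq_int_local[OF k(1)])
  have "0 \<le> (\<integral>x. indicator {-R..R} x * k x \<partial>lborel)" using k(2) by (intro integral_nonneg_AE) auto
  moreover have "(\<integral>x. indicator {-R..R} x * k x \<partial>lborel) \<noteq> 0"
  proof
    assume "(\<integral>x. indicator {-R..R} x * k x \<partial>lborel) = 0"
    then have "AE x in lborel. indicator {-R..R} x * k x = 0"
      by (subst (asm) integral_nonneg_eq_0_iff_AE[OF i]) (use k(2) in auto)
    then have "AE x in lborel. x \<notin> {-R..R}"
      using k_pos_AE by eventually_elim (auto split: split_indicator_asm)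
    then have "emeasure lborel {-R..R} = 0" by (subst (asm) AE_iff_null_sets[symmetric]) auto
    then show False using assms by simp
  qed
  ultimately show ?thesis by simp
qed

text \<open>Split the interval into the set where \<open>k < t\<close>, of measure at most \<open>e\<^sup>2\<close> for small \<open>t\<close> since \<open>k\<close> is positive almost
everywhere, and its complement, where \<open>u n\<close> is at most \<open>u n k / t\<close>.\<close>

lemma local_mass_bound:
  assumes R: "0 < R" and e: "0 < e"
  obtains t where "0 < t" "\<And>n. (\<integral>x. indicator {-R..R} x * u n x \<partial>lborel) \<le> e + overlap n / t"
proof -
  let ?B = "{-R..R}"
  define A where "A m = {x. x \<in> ?B \<and> k x < 1 / real (Suc m)}" for m
  have A[measurable]: "A m \<in> sets borel" for m unfolding A_def by measurable
  have Ai: "integrable lborel (indicator (A m) :: real \<Rightarrow> real)" for m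
    by (rule Bochner_Integration.integrable_bound[OF integrable_indicator_Icc[of "-R" R]])
       (auto simp: A_def split: split_indicator)
  have "(\<lambda>m. \<integral>x. indicator (A m) x \<partial>lborel) \<longlonglongrightarrow> (\<integral>x. 0 \<partial>(lborel :: real measure) :: real)"
  proof (rule integral_dominated_convergence[where w="indicator ?B"])
    show "AE x in lborel. (\<lambda>m. indicator (A m) x :: real) \<longlonglongrightarrow> 0"
      using k_pos_AE
    proof eventually_elim
      case (elim x)
      obtain N where N: "1 / real (Suc N) < k x" using elim by (meson nat_approx_posE)
      have "indicator (A m) x = (0 :: real)" if "N \<le> m" for m
      proof -
        have "1 / real (Suc m) \<le> 1 / real (Suc N)" using that by (intro divide_left_mono) auto
        then show ?thesis using N unfolding A_def by simp
      qed
      then show ?case by (intro tendsto_eventually) (auto simp: eventually_sequentially)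
    qed
  qed (use integrable_indicator_Icc in \<open>auto simp: A_def split: split_indicator\<close>)
  then have "\<forall>\<^sub>F m in sequentially. (\<integral>x. indicator (A m) x \<partial>lborel) < e\<^sup>2"
    using e by (intro order_tendstoD(2)) auto
  then obtain m where m: "(\<integral>x. indicator (A m) x \<partial>lborel) < e\<^sup>2" by (auto simp: eventually_sequentially)
  let ?t = "1 / real (Suc m)"
  show thesis
  proof (rule that)
    show "0 < ?t" by simp
    fix n
    have As: "sq_int (indicator (A m))" unfolding sq_int_def indicator_square using Ai by auto
    have i1: "integrable lborel (\<lambda>x. indicator (A m) x * u n x)" by (rule sq_int_mult[OF As u(1)])
    have i2: "integrable lborel (\<lambda>x. u n x * k x / ?t)" using sq_int_mult[OF u(1) k(1), of n] by simp
    have "(\<integral>x. indicator ?B x * u n x \<partial>lborel) \<le> (\<integral>x. indicator (A m) x * u n x + u n x * k x / ?t \<partial>lborel)"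
    proof (intro integral_mono sq_int_local u Bochner_Integration.integrable_add i1 i2)
      fix x
      show "indicator ?B x * u n x \<le> indicator (A m) x * u n x + u n x * k x / ?t"
      proof (cases "x \<in> ?B \<and> x \<notin> A m")
        case True
        then have "?t \<le> k x" unfolding A_def by auto
        then have "u n x * 1 \<le> u n x * (k x / ?t)" using u(2)[of n x] by (intro mult_left_mono) (simp_all add: field_simps)
        then show ?thesis using True by simp
      next
        case False
        have "0 \<le> u n x * k x / ?t" using u(2)[of n x] k(2)[of x] by (simp add: less_imp_le)
        then show ?thesis using False u(2)[of n x] by (auto split: split_indicator)
      qed
    qed
    also have "\<dots> = (\<integral>x. indicator (A m) x * u n x \<partial>lborel) + overlap n / ?t"
      unfolding overlap_def using i1 i2 by (simp add: Bochner_Integration.integral_add)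
    also have "(\<integral>x. indicator (A m) x * u n x \<partial>lborel) \<le> e"
    proof (rule power2_le_imp_le)
      have "(\<integral>x. indicator (A m) x * u n x \<partial>lborel)\<^sup>2 \<le> (\<integral>x. (indicator (A m) x)\<^sup>2 \<partial>lborel) * (\<integral>x. (u n x)\<^sup>2 \<partial>lborel)"
        by (rule sq_int_cauchy_schwarz[OF As u(1)])
      also have "\<dots> \<le> e\<^sup>2" unfolding indicator_square u_norm using m by simp
      finally show "(\<integral>x. indicator (A m) x * u n x \<partial>lborel)\<^sup>2 \<le> e\<^sup>2" .
    qed (use e in simp)
    finally show "(\<integral>x. indicator ?B x * u n x \<partial>lborel) \<le> e + overlap n / ?t" by simp
  qed
qed

lemma overlap_nonneg: "0 \<le> overlap n"
  unfolding overlap_def by (intro integral_nonneg_AE AE_I2 mult_nonneg_nonneg) (simp_all add: u(2) k(2) less_imp_le)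

text \<open>If the overlap tended to 0 along a subsequence, so would the local \<open>L\<^sup>1\<close> norms of the eigenfunctions, and bounded
energy would force their \<open>L\<^sup>2\<close> norms to 0.\<close>

lemma overlap_bounded_below: "\<exists>\<eta>>0. \<forall>\<^sub>F n in sequentially. \<eta> \<le> overlap n"
proof (rule ccontr)
  assume "\<not> ?thesis"
  then have freq: "\<exists>\<^sub>F n in sequentially. overlap n < \<eta>" if "0 < \<eta>" for \<eta>
    using that by (auto simp: not_eventually not_le)
  have "\<exists>n\<ge>j. overlap n < 1 / real (Suc j) \<and> energy (a n) (u n) \<le> (lam + 1) * a n" for j
  proof -
    have "\<exists>\<^sub>F n in sequentially. overlap n < 1 / real (Suc j) \<and> energy (a n) (u n) \<le> (lam + 1) * a n \<and> j \<le> n"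
      using frequently_eventually_frequently[OF freq[of "1 / real (Suc j)"] eventually_conj[OF eventually_energy_le(2) eventually_ge_at_top[of j]]] by simp
    then show ?thesis using frequently_ex by blast
  qed
  then obtain r where r: "\<And>j. j \<le> r j" "\<And>j. overlap (r j) < 1 / real (Suc j)"
      "\<And>j. energy (a (r j)) (u (r j)) \<le> (lam + 1) * a (r j)"
    by metis
  have rtop: "filterlim r at_top sequentially"
    by (rule filterlim_at_top_mono[OF filterlim_ident]) (use r(1) in auto)
  have olim: "(\<lambda>j. overlap (r j)) \<longlonglongrightarrow> 0"
  proof (rule tendsto_sandwich[OF _ _ tendsto_const])
    show "(\<lambda>j. 1 / real (Suc j)) \<longlonglongrightarrow> 0" by (rule LIMSEQ_Suc) (rule lim_const_over_n)
  qed (use r(2) overlap_nonneg in \<open>auto intro!: always_eventually less_imp_le\<close>)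
  have "(\<lambda>j. \<integral>x. (u (r j) x)\<^sup>2 \<partial>lborel) \<longlonglongrightarrow> 0"
  proof (rule bounded_energy_vanishing[where a="\<lambda>j. a (r j)" and E="lam + 1"])
    show "(\<lambda>j. a (r j)) \<longlonglongrightarrow> 0" by (rule filterlim_compose[OF a(3) rtop])
    fix R :: real assume R: "1 \<le> R"
    have "(\<lambda>j. \<integral>x. indicator {-R..R} x * u (r j) x \<partial>lborel) \<longlonglongrightarrow> 0"
    proof (rule order_tendstoI)
      fix e :: real assume "e < 0"
      moreover have "0 \<le> (\<integral>x. indicator {-R..R} x * u n x \<partial>lborel)" for n
        by (intro integral_nonneg_AE AE_I2 mult_nonneg_nonneg) (simp_all add: u(2) less_imp_le)
      ultimately show "\<forall>\<^sub>F j in sequentially. e < (\<integral>x. indicator {-R..R} x * u (r j) x \<partial>lborel)"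
        by (intro always_eventually allI) (meson less_le_trans)
    next
      fix e :: real assume e: "0 < e"
      obtain t where t: "0 < t" "\<And>n. (\<integral>x. indicator {-R..R} x * u n x \<partial>lborel) \<le> e / 2 + overlap n / t"
        using local_mass_bound[of R "e / 2"] R e by auto
      have "\<forall>\<^sub>F j in sequentially. overlap (r j) < t * (e / 2)"
        using t(1) e by (intro order_tendstoD(2)[OF olim]) simp
      then show "\<forall>\<^sub>F j in sequentially. (\<integral>x. indicator {-R..R} x * u (r j) x \<partial>lborel) < e"
      proof eventually_elim
        case (elim j)
        then have "overlap (r j) / t < e / 2" using t(1) by (simp add: divide_less_eq mult.commute)
        then show ?case using t(2)[of "r j"] by linarith
      qed
    qed
    moreover have "\<bar>u n x\<bar> = u n x" for n x using u(2)[of n x] by simp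
    ultimately show "(\<lambda>j. \<integral>x. indicator {-R..R} x * \<bar>u (r j) x\<bar> \<partial>lborel) \<longlonglongrightarrow> 0" by simp
  qed (use a u r lam_nonneg in auto)
  then show False unfolding u_norm by (simp add: LIMSEQ_const_iff)
qed

text \<open>Pairing the residual with the eigenfunction gives \<open>(gap n - lam) * overlap n\<close> by symmetry of the kernel, and the
overlap is bounded below.\<close>

lemma gap_tendsto: "gap \<longlonglongrightarrow> lam"
proof -
  obtain \<eta> where \<eta>: "0 < \<eta>" "\<forall>\<^sub>F n in sequentially. \<eta> \<le> overlap n" using overlap_bounded_below by blast
  have eq: "(\<integral>x. u n x * residual n x \<partial>lborel) = (gap n - lam) * overlap n" for n
  proof -
    have "form (a n) (u n) k = M n * overlap n"
      unfolding form_sym[OF a(1) u(1) k(1)] form_eigen[OF k(1)] overlap_def ..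
    then show ?thesis unfolding pairing_eq[OF u(1)] gap_def overlap_def[symmetric]
      using a(1)[of n] by (simp add: field_simps)
  qed
  have lim: "(\<lambda>n. \<bar>\<integral>x. u n x * residual n x \<partial>lborel\<bar> / \<eta>) \<longlonglongrightarrow> 0"
    using tendsto_divide[OF tendsto_rabs[OF pairing_tendsto[OF u(1) u_norm]] tendsto_const[of \<eta>]] \<eta> by simp
  have "(\<lambda>n. gap n - lam) \<longlonglongrightarrow> 0"
  proof (rule Lim_null_comparison[OF _ lim])
    show "\<forall>\<^sub>F n in sequentially. norm (gap n - lam) \<le> \<bar>\<integral>x. u n x * residual n x \<partial>lborel\<bar> / \<eta>"
      using \<eta>(2)
    proof eventually_elim
      case (elim n)
      have "\<bar>gap n - lam\<bar> * \<eta> \<le> \<bar>gap n - lam\<bar> * overlap n" using elim by (intro mult_left_mono) auto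
      then show ?case unfolding eq using \<eta>(1) overlap_nonneg[of n] by (simp add: abs_mult le_divide_eq)
    qed
  qed
  then show ?thesis by (rule LIM_zero_cancel)
qed

text \<open>The factor of proportionality between \<open>u n\<close> and \<open>k\<close>, read off on a fixed interval so that it is the same for all
intervals on which the two are compared.\<close>

definition coeff :: "nat \<Rightarrow> real" where
  "coeff n = (\<integral>x. indicator {-1..1} x * u n x \<partial>lborel) / (\<integral>x. indicator {-1..1} x * k x \<partial>lborel)"

lemma coeff_bounds: "0 \<le> coeff n" "coeff n \<le> sqrt 2 / (\<integral>x. indicator {-1..1} x * k x \<partial>lborel)"
proof -
  have p: "0 < (\<integral>x. indicator {-1..1} x * k x \<partial>lborel)" by (rule local_integral_k_pos) simp
  have "0 \<le> (\<integral>x. indicator {-1..1} x * u n x \<partial>lborel)"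
    by (intro integral_nonneg_AE AE_I2 mult_nonneg_nonneg) (simp_all add: u(2) less_imp_le)
  then show "0 \<le> coeff n" unfolding coeff_def using p by simp
  have "(\<integral>x. indicator {-1..1} x * u n x \<partial>lborel)\<^sup>2 \<le> (\<integral>x. (indicator {-1..1::real} x)\<^sup>2 \<partial>lborel) * (\<integral>x. (u n x)\<^sup>2 \<partial>lborel)"
    by (rule sq_int_cauchy_schwarz[OF sq_int_indicator_Icc u(1)])
  also have "\<dots> = 2" unfolding indicator_square u_norm by simp
  finally have "(\<integral>x. indicator {-1..1} x * u n x \<partial>lborel) \<le> sqrt 2" by (rule real_le_rsqrt)
  then show "coeff n \<le> sqrt 2 / (\<integral>x. indicator {-1..1} x * k x \<partial>lborel)"
    unfolding coeff_def using p by (intro divide_right_mono) auto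
qed

text \<open>Integrating \<open>k x u y - k y u x\<close> over \<open>y\<close> in the fixed interval gives a multiple of \<open>u x - coeff k x\<close>, and the
whole expression tends to 0 in the mean because both \<open>gap n\<close> and the Rayleigh quotient of \<open>k\<close> tend to \<open>lam\<close>.\<close>

lemma local_difference_tendsto:
  assumes R: "1 \<le> R"
  shows "(\<lambda>n. \<integral>x. indicator {-R..R} x * \<bar>u n x - coeff n * k x\<bar> \<partial>lborel) \<longlonglongrightarrow> 0"
proof -
  let ?B = "{-R..R}" and ?P = "lborel \<Otimes>\<^sub>M lborel :: (real \<times> real) measure"
  let ?\<kappa> = "\<integral>x. indicator {-1..1} x * k x \<partial>lborel"
  have p: "0 < ?\<kappa>" by (rule local_integral_k_pos) simp
  define D where "D = 1 + 4 * R\<^sup>2 + C * (2 * R) powr \<gamma>"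
  define X where "X n x y = indicator ?B x * indicator ?B y * \<bar>k x * u n y - k y * u n x\<bar>" for n x y
  define I where "I n = (\<integral>p. (case p of (x, y) \<Rightarrow> X n x y) \<partial>?P)" for n
  have Xi: "integrable ?P (\<lambda>(x, y). X n x y)" 
    and I2: "(I n)\<^sup>2 \<le> 4 * pi * D * R * (energy (a n) k / a n - gap n)" for n
  proof -
    have R0: "0 < R" using R by simp
    note w = wronskian_bound[OF a(1,2) u k(1) u_eig R0 u_norm, of n]
    show "integrable ?P (\<lambda>(x, y). X n x y)" using w(1) unfolding X_def .
    have "(M n * (\<integral>x. (k x)\<^sup>2 \<partial>lborel) - form (a n) k k) / a n = energy (a n) k / a n - gap n"
      unfolding k_norm energy_def gap_def by (simp add: diff_divide_distrib[symmetric])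
    then show "(I n)\<^sup>2 \<le> 4 * pi * D * R * (energy (a n) k / a n - gap n)"
      using w(2) unfolding I_def X_def D_def by simp
  qed
  have "(\<lambda>n. 4 * pi * D * R * (energy (a n) k / a n - gap n)) \<longlonglongrightarrow> 4 * pi * D * R * (lam - lam)"
    by (intro tendsto_intros energy_k_tendsto gap_tendsto)
  then have "(\<lambda>n. sqrt (4 * pi * D * R * (energy (a n) k / a n - gap n))) \<longlonglongrightarrow> 0"
    using tendsto_real_sqrt by fastforce
  then have Ilim: "I \<longlonglongrightarrow> 0"
    by (rule Lim_null_comparison[rotated]) (use I2 in \<open>auto intro!: always_eventually real_le_rsqrt\<close>)
  have "(\<integral>x. indicator ?B x * \<bar>u n x - coeff n * k x\<bar> \<partial>lborel) \<le> I n / ?\<kappa>" for n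
  proof -
    have wi: "integrable lborel (\<lambda>x. indicator ?B x * \<bar>u n x - coeff n * k x\<bar>)"
    proof (rule sq_int_local)
      have "sq_int (\<lambda>x. u n x - coeff n * k x)" by (intro sq_int_diff sq_int_cmult u k)
      then show "sq_int (\<lambda>x. \<bar>u n x - coeff n * k x\<bar>)" by (rule sq_int_dominated) simp_all
    qed
    have AEx: "AE x in lborel. integrable lborel (X n x)"
      using lborel_pair.AE_integrable_fst'[OF Xi[of n]] by simp
    have "?\<kappa> * (\<integral>x. indicator ?B x * \<bar>u n x - coeff n * k x\<bar> \<partial>lborel) = (\<integral>x. ?\<kappa> * (indicator ?B x * \<bar>u n x - coeff n * k x\<bar>) \<partial>lborel)" by simp
    also have "\<dots> \<le> (\<integral>x. (\<integral>y. X n x y \<partial>lborel) \<partial>lborel)"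
    proof (rule integral_mono_AE)
      show "integrable lborel (\<lambda>x. \<integral>y. X n x y \<partial>lborel)" using lborel_pair.integrable_fst'[OF Xi[of n]] by simp
      show "AE x in lborel. ?\<kappa> * (indicator ?B x * \<bar>u n x - coeff n * k x\<bar>) \<le> (\<integral>y. X n x y \<partial>lborel)"
        using AEx
      proof eventually_elim
        case (elim x)
        show ?case
        proof (cases "x \<in> ?B")
          case True
          have i: "integrable lborel (\<lambda>y. indicator {-1..1} y * k y)" "integrable lborel (\<lambda>y. indicator {-1..1} y * u n y)"
            using sq_int_local k(1) u(1) by auto
          have i': "integrable lborel (\<lambda>y. indicator {-1..1} y * (k x * u n y - k y * u n x))"
          proof -
            have "integrable lborel (\<lambda>y. k x * (indicator {-1..1} y * u n y) - u n x * (indicator {-1..1} y * k y))"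
              using i by simp
            then show ?thesis by (simp add: algebra_simps)
          qed
          have "?\<kappa> * (u n x - coeff n * k x) = ?\<kappa> * u n x - k x * (\<integral>y. indicator {-1..1} y * u n y \<partial>lborel)"
            unfolding coeff_def using p by (simp add: field_simps)
          also have "\<dots> = - (\<integral>y. k x * (indicator {-1..1} y * u n y) - u n x * (indicator {-1..1} y * k y) \<partial>lborel)"
            using i by simp
          also have "\<dots> = - (\<integral>y. indicator {-1..1} y * (k x * u n y - k y * u n x) \<partial>lborel)"
            by (simp add: algebra_simps)
          finally have *: "?\<kappa> * (u n x - coeff n * k x) = - (\<integral>y. indicator {-1..1} y * (k x * u n y - k y * u n x) \<partial>lborel)" .
          have "?\<kappa> * \<bar>u n x - coeff n * k x\<bar> = \<bar>?\<kappa> * (u n x - coeff n * k x)\<bar>"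
            using p by (simp add: abs_mult)
          then have "?\<kappa> * \<bar>u n x - coeff n * k x\<bar> = \<bar>\<integral>y. indicator {-1..1} y * (k x * u n y - k y * u n x) \<partial>lborel\<bar>"
            unfolding * by simp
          also have "\<dots> \<le> (\<integral>y. \<bar>indicator {-1..1} y * (k x * u n y - k y * u n x)\<bar> \<partial>lborel)"
            by (rule integral_abs_bound)
          also have "\<dots> \<le> (\<integral>y. X n x y \<partial>lborel)"
          proof (intro integral_mono elim integrable_abs i')
            fix y :: real
            show "\<bar>indicator {-1..1} y * (k x * u n y - k y * u n x)\<bar> \<le> X n x y"
              using True R unfolding X_def by (auto split: split_indicator)
          qed
          finally show ?thesis using True by simp
        next
          case False
          then show ?thesis unfolding X_def by simp
        qed
      qed
    qed (use wi in simp)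
    also have "\<dots> = I n" unfolding I_def by (subst lborel_pair.integral_fst'[OF Xi, symmetric]) simp
    finally show ?thesis using p by (simp add: le_divide_eq mult.commute)
  qed
  moreover have Il: "(\<lambda>n. I n / ?\<kappa>) \<longlonglongrightarrow> 0" using tendsto_divide[OF Ilim tendsto_const[of ?\<kappa>]] p by simp
  moreover have "0 \<le> (\<integral>x. indicator ?B x * \<bar>u n x - coeff n * k x\<bar> \<partial>lborel)" for n
    by (intro integral_nonneg_AE) auto
  ultimately show ?thesis
    by (intro Lim_null_comparison[OF _ Il]) (simp add: always_eventually)
qed

text \<open>The difference \<open>u n - coeff n k\<close> has bounded energy and vanishes locally, hence it vanishes in \<open>L\<^sup>2\<close>. As both functions have
norm 1 and the coefficients are non-negative, these tend to 1.\<close>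

lemma eigenfunction_tendsto: "(\<lambda>n. \<integral>x. (u n x - k x)\<^sup>2 \<partial>lborel) \<longlonglongrightarrow> 0"
proof -
  define b where "b = sqrt 2 / (\<integral>x. indicator {-1..1} x * k x \<partial>lborel)"
  have cb: "(coeff n)\<^sup>2 \<le> b\<^sup>2" for n using coeff_bounds[of n] unfolding b_def by (intro power_mono) auto
  have w: "sq_int (\<lambda>x. u n x - coeff n * k x)" for n by (intro sq_int_diff sq_int_cmult u k)
  define r where "r n = (\<integral>x. (u n x - coeff n * k x)\<^sup>2 \<partial>lborel)" for n
  have rlim: "r \<longlonglongrightarrow> 0"
    unfolding r_def
  proof (rule bounded_energy_vanishing[where E="2 * (1 + b\<^sup>2) * (lam + 1)"])
    show "\<forall>\<^sub>F n in sequentially. energy (a n) (\<lambda>x. u n x - coeff n * k x) \<le> 2 * (1 + b\<^sup>2) * (lam + 1) * a n"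
      using eventually_energy_le
    proof eventually_elim
      case (elim n)
      have "energy (a n) (\<lambda>x. u n x - coeff n * k x) \<le> 2 * energy (a n) (u n) + 2 * (coeff n)\<^sup>2 * energy (a n) k"
        by (rule energy_diff_le[OF a(1) u(1) k(1)])
      also have "\<dots> \<le> 2 * ((lam + 1) * a n) + 2 * b\<^sup>2 * ((lam + 1) * a n)"
        using elim cb[of n] energy_nonneg[OF a(1) k(1), of n] energy_nonneg[OF a(1) u(1), of n] by (intro add_mono mult_mono) auto
      finally show ?case by (simp add: algebra_simps)
    qed
    show "0 < 2 * (1 + b\<^sup>2) * (lam + 1)" using lam_nonneg by (intro mult_pos_pos) (auto simp: one_plus_square_pos)
  qed (use a w local_difference_tendsto in auto)
  have cl: "(1 - coeff n)\<^sup>2 \<le> r n" for n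
  proof -
    have "overlap n ^ 2 \<le> 1" unfolding overlap_def using sq_int_cauchy_schwarz[OF u(1) k(1), of n] u_norm k_norm by simp
    then have o1: "overlap n \<le> 1" by (simp add: abs_square_le_1)
    have "r n = (\<integral>x. (u n x)\<^sup>2 - 2 * coeff n * (u n x * k x) + (coeff n)\<^sup>2 * (k x)\<^sup>2 \<partial>lborel)"
      unfolding r_def by (intro Bochner_Integration.integral_cong refl) (simp add: power2_eq_square algebra_simps)
    also have "\<dots> = 1 - 2 * coeff n * overlap n + (coeff n)\<^sup>2"
      unfolding overlap_def using sq_int_square[OF u(1)] sq_int_square[OF k(1)] sq_int_mult[OF u(1) k(1)] u_norm k_norm by simp
    also have "\<dots> \<ge> 1 - 2 * coeff n * 1 + (coeff n)\<^sup>2"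
      using o1 coeff_bounds(1)[of n] by (intro add_right_mono diff_left_mono mult_left_mono) auto
    finally show ?thesis by (simp add: power2_eq_square algebra_simps)
  qed
  have le: "(\<integral>x. (u n x - k x)\<^sup>2 \<partial>lborel) \<le> 4 * r n" for n
  proof -
    have "(\<integral>x. (u n x - k x)\<^sup>2 \<partial>lborel) \<le> (\<integral>x. 2 * (u n x - coeff n * k x)\<^sup>2 + 2 * (1 - coeff n)\<^sup>2 * (k x)\<^sup>2 \<partial>lborel)"
    proof (intro integral_mono Bochner_Integration.integrable_add integrable_mult_right sq_int_square sq_int_diff[OF u(1) k(1)] k w)
      fix x
      have "(u n x - k x)\<^sup>2 = ((u n x - coeff n * k x) + - ((1 - coeff n) * k x))\<^sup>2" by (simp add: algebra_simps)
      also have "\<dots> \<le> 2 * (u n x - coeff n * k x)\<^sup>2 + 2 * (- ((1 - coeff n) * k x))\<^sup>2" by (rule square_add_le)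
      finally show "(u n x - k x)\<^sup>2 \<le> 2 * (u n x - coeff n * k x)\<^sup>2 + 2 * (1 - coeff n)\<^sup>2 * (k x)\<^sup>2"
        by (simp add: power_mult_distrib)
    qed
    also have "\<dots> = 2 * r n + 2 * (1 - coeff n)\<^sup>2"
      unfolding r_def using sq_int_square[OF w] sq_int_square[OF k(1)] k_norm by simp
    finally show ?thesis using cl[of n] by simp
  qed
  have "(\<lambda>n. 4 * r n) \<longlonglongrightarrow> 0" using tendsto_mult_left[OF rlim, of 4] by simp
  then show ?thesis
    by (rule tendsto_sandwich[OF _ _ tendsto_const, rotated 2]) (use le in \<open>auto intro!: always_eventually\<close>)
qed

end

section \<open>Symbols, rescaling and the limit operator\<close>

lemma AE_lborel_affine:
  fixes P :: "real \<Rightarrow> bool"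
  assumes "AE x in lborel. P x" "c \<noteq> 0"
  shows "AE x in lborel. P (t + c * x)"
proof -
  obtain N where N: "N \<in> null_sets lborel" "{x \<in> space lborel. \<not> P x} \<subseteq> N"
    using assms(1) by (auto elim: AE_E3 simp: eventually_ae_filter)
  have [measurable]: "N \<in> sets borel" using N(1) by auto
  have "AE x in lborel. x \<notin> N" by (rule AE_not_in[OF N(1)])
  then have "AE x in lborel. t + c * x \<notin> N" by (intro AE_borel_affine assms(2)) simp_all
  then show ?thesis by eventually_elim (use N(2) in auto)
qed

text \<open>Changing the function to \<open>d\<close> on a null set makes the property \<open>P\<close> hold everywhere, not just almost everywhere.\<close>

lemma real_borel_version:
  fixes f :: "real \<Rightarrow> complex"
  assumes "f \<in> borel_measurable lebesgue" "AE x in lborel. f x \<in> \<real> \<and> P (Re (f x))" "P d" "{t. P t} \<in> sets borel"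
  obtains r where "r \<in> borel_measurable borel" "\<And>x. P (r x)" "AE x in lborel. f x = complex_of_real (r x)"
proof -
  obtain f' where f'[measurable]: "f' \<in> borel_measurable borel" and ae: "AE x in lborel. f x = f' x"
    using complex_borel_version[OF assms(1)] by blast
  have [measurable]: "Measurable.pred borel P" using assms(4) by (simp add: pred_def)
  show thesis
  proof (rule that)
    show "(\<lambda>x. if P (Re (f' x)) then Re (f' x) else d) \<in> borel_measurable borel" by measurable
    show "P (if P (Re (f' x)) then Re (f' x) else d)" for x using assms(3) by simp
    show "AE x in lborel. f x = complex_of_real (if P (Re (f' x)) then Re (f' x) else d)"
      using ae assms(2) by eventually_elim (auto simp: of_real_Re)
  qed
qed

locale admissible_symbol =
  fixes \<Theta> :: "real \<times> real \<Rightarrow> real" and \<gamma> c C :: real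
  assumes \<gamma>: "1 \<le> \<gamma>"
    and \<Theta>_measurable: "\<Theta> \<in> borel_measurable lebesgue"
    and homogeneous: "\<And>x y t. t > 0 \<Longrightarrow> \<Theta> (t * x, t * y) = t powr \<gamma> * \<Theta> (x, y)"
    and cC: "0 < c" "c \<le> C" and circle: "\<And>x y. x\<^sup>2 + y\<^sup>2 = 1 \<Longrightarrow> c \<le> \<Theta> (x, y) \<and> \<Theta> (x, y) \<le> C"
    and symmetric: "\<And>x y. \<Theta> (x, y) = \<Theta> (y, x)"
    and diagonal: "isCont (\<lambda>t. \<Theta> (t, 1)) 1" "isCont (\<lambda>t. \<Theta> (t, -1)) (-1)"
begin

lemma \<Theta>_zero: "\<Theta> (0, 0) = 0"
proof -
  have "\<Theta> (0, 0) = 2 powr \<gamma> * \<Theta> (0, 0)" using homogeneous[of 2 0 0] by simp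
  moreover have "2 powr \<gamma> \<noteq> (1::real)" using \<gamma> by simp
  ultimately show ?thesis by simp
qed

lemma \<Theta>_polar:
  assumes "(x, y) \<noteq> (0, 0)"
  shows "c * sqrt (x\<^sup>2 + y\<^sup>2) powr \<gamma> \<le> \<Theta> (x, y)" "\<Theta> (x, y) \<le> C * sqrt (x\<^sup>2 + y\<^sup>2) powr \<gamma>"
proof -
  let ?r = "sqrt (x\<^sup>2 + y\<^sup>2)"
  have r: "0 < ?r" using assms by (simp add: sum_power2_gt_zero_iff)
  then have r2: "0 < x\<^sup>2 + y\<^sup>2" by simp
  have "(x / ?r)\<^sup>2 + (y / ?r)\<^sup>2 = (x\<^sup>2 + y\<^sup>2) / ?r\<^sup>2" by (simp only: power_divide add_divide_distrib)
  also have "?r\<^sup>2 = x\<^sup>2 + y\<^sup>2" using r2 by simp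
  also have "(x\<^sup>2 + y\<^sup>2) / (x\<^sup>2 + y\<^sup>2) = 1" using r2 by (intro divide_self) linarith
  finally have b: "c \<le> \<Theta> (x / ?r, y / ?r)" "\<Theta> (x / ?r, y / ?r) \<le> C" using circle by auto
  have scale: "\<Theta> (x, y) = s powr \<gamma> * \<Theta> (x / s, y / s)" if "0 < s" for s
    using homogeneous[OF that, of "x / s" "y / s"] that by simp
  note e = scale[OF r]
  show "c * ?r powr \<gamma> \<le> \<Theta> (x, y)" unfolding e using b by (subst mult.commute) (intro mult_left_mono, auto)
  show "\<Theta> (x, y) \<le> C * ?r powr \<gamma>" unfolding e using b by (subst (2) mult.commute) (intro mult_left_mono, auto)
qed

lemma \<Theta>_lower: "c * \<bar>x\<bar> powr \<gamma> \<le> \<Theta> (x, y)"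
proof (cases "(x, y) = (0, 0)")
  case False
  have "\<bar>x\<bar> \<le> sqrt (x\<^sup>2 + y\<^sup>2)" by (rule real_le_rsqrt) simp
  then have "c * \<bar>x\<bar> powr \<gamma> \<le> c * sqrt (x\<^sup>2 + y\<^sup>2) powr \<gamma>"
    using cC \<gamma> by (intro mult_left_mono powr_mono2) auto
  then show ?thesis using \<Theta>_polar(1)[OF False] by simp
qed (simp add: \<Theta>_zero)

lemma \<Theta>_upper: "\<Theta> (x, y) \<le> C * (\<bar>x\<bar> + \<bar>y\<bar>) powr \<gamma>"
proof (cases "(x, y) = (0, 0)")
  case False
  have "C * sqrt (x\<^sup>2 + y\<^sup>2) powr \<gamma> \<le> C * (\<bar>x\<bar> + \<bar>y\<bar>) powr \<gamma>"
    using cC \<gamma> by (intro mult_left_mono powr_mono2 sqrt_sum_squares_le_sum_abs) auto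
  then show ?thesis using \<Theta>_polar(2)[OF False] by simp
qed (simp add: \<Theta>_zero)

lemma \<Theta>_sgn: 
  assumes "x \<noteq> 0" shows "\<Theta> (z, x) = \<bar>x\<bar> powr \<gamma> * \<Theta> (z / \<bar>x\<bar>, sgn x)"
proof -
  have "\<bar>x\<bar> * (z / \<bar>x\<bar>) = z" "\<bar>x\<bar> * sgn x = x" using assms by (auto simp: abs_mult_sgn)
  then show ?thesis using homogeneous[of "\<bar>x\<bar>" "z / \<bar>x\<bar>" "sgn x"] assms by simp
qed

lemma \<Theta>_near_diagonal:
  assumes x: "x \<noteq> 0" shows "isCont (\<lambda>z. \<Theta> (x + z, x)) 0"
proof -
  have s: "isCont (\<lambda>t. \<Theta> (t, sgn x)) (sgn x)" using diagonal x by (auto simp: sgn_if)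
  have f: "isCont (\<lambda>z. (x + z) / \<bar>x\<bar>) 0" using x by (intro continuous_intros) auto
  have "(x + 0) / \<bar>x\<bar> = sgn x" using x by (simp add: sgn_if)
  with s have "isCont (\<lambda>t. \<Theta> (t, sgn x)) ((x + 0) / \<bar>x\<bar>)" by simp
  with f have "isCont (\<lambda>z. \<Theta> ((x + z) / \<bar>x\<bar>, sgn x)) 0" by (rule isCont_o2)
  then show ?thesis unfolding \<Theta>_sgn[OF x, of "x + _"] by (intro continuous_intros)
qed

definition diag :: "real \<Rightarrow> real" where
  "diag x = \<Theta> (x, x)"

lemma diag_eq: "diag x = \<bar>x\<bar> powr \<gamma> * (if x \<le> 0 then \<Theta> (-1, -1) else \<Theta> (1, 1))"
proof (cases "x = 0")
  case False
  then show ?thesis using \<Theta>_sgn[OF False, of x] unfolding diag_def by (auto simp: sgn_if)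
qed (simp add: diag_def \<Theta>_zero)

lemma diag_measurable [measurable]: "diag \<in> borel_measurable borel"
  unfolding diag_eq[abs_def] by measurable

lemma diag_isCont: assumes "x \<noteq> 0" shows "isCont diag x"
proof -
  let ?s = "if x \<le> 0 then \<Theta> (-1, -1) else \<Theta> (1, 1)"
  have "isCont (\<lambda>y. \<bar>y\<bar> powr \<gamma> * ?s) x" using assms by (intro continuous_intros) auto
  moreover have "\<forall>\<^sub>F y in nhds x. diag y = \<bar>y\<bar> powr \<gamma> * ?s"
  proof (cases "x < 0")
    case True
    then have "\<forall>\<^sub>F y in nhds x. y < 0" by (intro order_tendstoD(2)[OF filterlim_ident])
    then show ?thesis by eventually_elim (use True in \<open>simp add: diag_eq\<close>)
  next
    case False
    with assms have "0 < x" by simp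
    then have "\<forall>\<^sub>F y in nhds x. 0 < y" by (intro order_tendstoD(1)[OF filterlim_ident])
    then show ?thesis by eventually_elim (use \<open>0 < x\<close> in \<open>simp add: diag_eq\<close>)
  qed
  ultimately show ?thesis by (subst isCont_cong)
qed

text \<open>A Borel version of the symbol may differ from it on a null set that contains the diagonal. On a symmetric
null set it is therefore replaced by the mean of the diagonal values at both coordinates, which is an explicit
function and satisfies bounds of the same form.\<close>

lemma borel_symbol:
  obtains T where "homogeneous_perturbation T (c / 2) (C * 2 powr \<gamma>) \<gamma>" "\<And>x. T x x = \<Theta> (x, x)"
    "AE x in lborel. AE y in lborel. T x y = \<Theta> (x, y)"
proof -
  obtain \<Theta>b where [measurable]: "\<Theta>b \<in> borel_measurable borel" and ae: "AE p in lborel. \<Theta> p = \<Theta>b p"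
    using completion_ex_borel_measurable_real[OF \<Theta>_measurable] by auto
  obtain N where N: "N \<in> null_sets lborel" "{p \<in> space lborel. \<Theta> p \<noteq> \<Theta>b p} \<subseteq> N"
    using ae unfolding eventually_ae_filter by auto
  have Nm[measurable]: "N \<in> sets borel" using N(1) by auto
  define T where "T x y = (if (x, y) \<in> N \<or> (y, x) \<in> N then (diag x + diag y) / 2 else \<Theta>b (x, y))" for x y
  have T_eq: "T x y = (if (x, y) \<in> N \<or> (y, x) \<in> N then (diag x + diag y) / 2 else \<Theta> (x, y))" for x y
  proof -
    have "\<Theta>b p = \<Theta> p" if "p \<notin> N" for p
    proof (rule ccontr)
      assume "\<Theta>b p \<noteq> \<Theta> p"
      then have "p \<in> {p \<in> space lborel. \<Theta> p \<noteq> \<Theta>b p}" by simp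
      with N(2) that show False by blast
    qed
    then show ?thesis unfolding T_def by simp
  qed
  have Tm: "(\<lambda>(x, y). T x y) \<in> borel_measurable (borel \<Otimes>\<^sub>M borel)"
  proof -
    have [measurable]: "\<Theta>b \<in> borel_measurable (borel \<Otimes>\<^sub>M borel)" "N \<in> sets (borel \<Otimes>\<^sub>M borel)"
      unfolding borel_prod by simp_all
    show ?thesis unfolding T_def by measurable
  qed
  have diag_low: "c * \<bar>x\<bar> powr \<gamma> \<le> diag x" for x unfolding diag_def by (rule \<Theta>_lower)
  have diag_nn: "0 \<le> diag x" for x by (rule order_trans[OF _ diag_low]) (use cC in simp)
  have diag_up: "diag x \<le> C * (2 * \<bar>x\<bar>) powr \<gamma>" for x using \<Theta>_upper[of x x] unfolding diag_def by (simp only: mult_2)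
  have hp: "homogeneous_perturbation T (c / 2) (C * 2 powr \<gamma>) \<gamma>"
  proof
    show "(\<lambda>(x, y). T x y) \<in> borel_measurable (borel \<Otimes>\<^sub>M borel)" by (rule Tm)
    show "T x y = T y x" for x y unfolding T_eq by (auto simp: symmetric[of x y] add.commute)
    show "0 < c / 2" "0 < C * 2 powr \<gamma>" "0 < \<gamma>" using cC \<gamma> by auto
    show "c / 2 * \<bar>x\<bar> powr \<gamma> \<le> T x y" for x y
    proof -
      have "c / 2 * \<bar>x\<bar> powr \<gamma> \<le> c * \<bar>x\<bar> powr \<gamma>" using cC by (intro mult_right_mono) auto
      moreover have "c / 2 * \<bar>x\<bar> powr \<gamma> \<le> (diag x + diag y) / 2"
        using diag_low[of x] diag_nn[of y] by simp
      ultimately show ?thesis using \<Theta>_lower[of x y] unfolding T_eq by auto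
    qed
    show "T x y \<le> C * 2 powr \<gamma> * (\<bar>x\<bar> + \<bar>y\<bar>) powr \<gamma>" for x y
    proof -
      have e: "C * 2 powr \<gamma> * (\<bar>x\<bar> + \<bar>y\<bar>) powr \<gamma> = C * (2 * (\<bar>x\<bar> + \<bar>y\<bar>)) powr \<gamma>"
        by (subst powr_mult) simp_all
      have "C * (2 * \<bar>x\<bar>) powr \<gamma> \<le> C * (2 * (\<bar>x\<bar> + \<bar>y\<bar>)) powr \<gamma>" "C * (2 * \<bar>y\<bar>) powr \<gamma> \<le> C * (2 * (\<bar>x\<bar> + \<bar>y\<bar>)) powr \<gamma>"
         "C * (\<bar>x\<bar> + \<bar>y\<bar>) powr \<gamma> \<le> C * (2 * (\<bar>x\<bar> + \<bar>y\<bar>)) powr \<gamma>"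
        using cC \<gamma> by (intro mult_left_mono powr_mono2; simp)+
      then show ?thesis using diag_up[of x] diag_up[of y] \<Theta>_upper[of x y] unfolding T_eq e by auto
    qed
    show "isCont (\<lambda>z. T (x + z) x) 0" if x: "x \<noteq> 0" for x
    proof -
      have l1: "((\<lambda>z. \<Theta> (x + z, x)) \<longlongrightarrow> diag x) (at 0)"
        using \<Theta>_near_diagonal[OF x] unfolding isCont_def diag_def by simp
      have "isCont (\<lambda>z. x + z) 0" by (intro continuous_intros)
      moreover have "isCont diag (x + 0)" using diag_isCont[OF x] by simp
      ultimately have "isCont (\<lambda>z. diag (x + z)) 0" by (rule isCont_o2)
      then have l2: "((\<lambda>z. diag (x + z)) \<longlongrightarrow> diag x) (at 0)" unfolding isCont_def by simp
      have "((\<lambda>z. T (x + z) x - diag x) \<longlongrightarrow> 0) (at 0)"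
      proof (rule Lim_null_comparison)
        have "norm (T (x + z) x - diag x) \<le> \<bar>\<Theta> (x + z, x) - diag x\<bar> + \<bar>diag (x + z) - diag x\<bar>" for z
          unfolding T_eq by (auto simp: abs_if field_simps)
        then show "\<forall>\<^sub>F z in at 0. norm (T (x + z) x - diag x) \<le> \<bar>\<Theta> (x + z, x) - diag x\<bar> + \<bar>diag (x + z) - diag x\<bar>"
          by (intro always_eventually allI)
        have "((\<lambda>z. \<bar>\<Theta> (x + z, x) - diag x\<bar> + \<bar>diag (x + z) - diag x\<bar>) \<longlongrightarrow> \<bar>diag x - diag x\<bar> + \<bar>diag x - diag x\<bar>) (at 0)"
          by (intro tendsto_intros l1 l2)
        then show "((\<lambda>z. \<bar>\<Theta> (x + z, x) - diag x\<bar> + \<bar>diag (x + z) - diag x\<bar>) \<longlongrightarrow> 0) (at 0)" by simp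
      qed
      then have "((\<lambda>z. T (x + z) x) \<longlongrightarrow> diag x) (at 0)" by (rule LIM_zero_cancel)
      moreover have "T (x + 0) x = diag x" unfolding T_eq by (auto simp: diag_def)
      ultimately show ?thesis unfolding isCont_def by simp
    qed
  qed
  have N': "AE p in lborel \<Otimes>\<^sub>M (lborel :: real measure). p \<notin> N"
    using AE_not_in[OF N(1)] unfolding lborel_prod .
  have a1: "AE x in lborel. AE y in lborel. (x, y) \<notin> N" by (rule lborel_pair.AE_pair[OF N'])
  have a2: "AE x in lborel. AE y in lborel. (y, x) \<notin> N"
  proof (subst lborel_pair.AE_commute)
    have "N \<in> sets (borel \<Otimes>\<^sub>M borel)" unfolding borel_prod by simp
    then have [measurable]: "Measurable.pred (borel \<Otimes>\<^sub>M borel) (\<lambda>p. p \<in> N)" by measurable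
    show "{p \<in> space (lborel \<Otimes>\<^sub>M lborel). (snd p, fst p) \<notin> N} \<in> sets (lborel \<Otimes>\<^sub>M lborel)"
      by measurable
  qed (rule a1)
  have "AE x in lborel. AE y in lborel. T x y = \<Theta> (x, y)"
    using a1 a2
  proof eventually_elim
    case (elim x)
    then show ?case by eventually_elim (simp add: T_eq)
  qed
  then show thesis using that[OF hp] T_eq by (auto simp: diag_def)
qed

end

context homogeneous_perturbation begin

text \<open>By homogeneity \<open>\<beta>\<^sup>2 \<Theta> (x / \<alpha>, y / \<alpha>) = \<beta>\<^sup>2 \<alpha>\<^sup>-\<^sup>\<gamma> \<Theta> (x, y)\<close>, and \<open>\<alpha>\<close> is chosen such that \<open>\<beta>\<^sup>2 \<alpha>\<^sup>-\<^sup>\<gamma> = \<alpha>\<close>.\<close>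

lemma rescaled_eigenfunction:
  fixes \<Theta> :: "real \<times> real \<Rightarrow> real" and \<Psi> :: "real \<Rightarrow> complex"
  assumes hom: "\<And>x y t. t > 0 \<Longrightarrow> \<Theta> (t * x, t * y) = t powr \<gamma> * \<Theta> (x, y)"
    and ae: "AE x in lborel. AE y in lborel. T x y = \<Theta> (x, y)"
    and b: "0 < \<beta>" and al: "\<alpha> = \<beta> powr (2 / (\<gamma> + 1))"
    and eig: "eigenfunction (K_op \<Theta> \<beta>) (complex_of_real m) \<Psi>"
    and \<psi>[measurable]: "\<psi> \<in> borel_measurable borel" and \<Psi>: "AE x in lborel. \<Psi> x = complex_of_real (\<psi> x)"
  shows "AE x in lborel. K_mean \<alpha> (\<lambda>x. \<alpha> powr (- 1 / 2) * \<psi> (x / \<alpha>)) x = m * (\<alpha> powr (- 1 / 2) * \<psi> (x / \<alpha>))"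
proof -
  have a: "0 < \<alpha>" using b al by simp
  have pw: "\<beta>\<^sup>2 * (1 / \<alpha>) powr \<gamma> = \<alpha>"
  proof -
    have "\<beta>\<^sup>2 = \<beta> powr 2" using b by simp
    also have "2 = 2 / (\<gamma> + 1) * (\<gamma> + 1)"
    proof -
      have *: "2 = 2 / t * t" if "0 < t" for t :: real using that by simp
      show ?thesis by (rule *) (use \<gamma>_pos in simp)
    qed
    also have "\<beta> powr \<dots> = \<alpha> powr (\<gamma> + 1)" unfolding al powr_powr ..
    also have "\<dots> = \<alpha> powr \<gamma> * \<alpha>" using a by (simp add: powr_add)
    finally show ?thesis using a by (simp add: powr_divide)
  qed
  have "AE x in lborel. complex_of_real m * \<Psi> x = (\<integral>y. complex_of_real (K_kernel \<Theta> \<beta> x y) * \<Psi> y \<partial>lebesgue)"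
    using eig unfolding eigenfunction_def K_op_def AE_completion_iff by blast
  then have "AE x in lborel. complex_of_real m * \<Psi> (0 + 1 / \<alpha> * x) = (\<integral>y. complex_of_real (K_kernel \<Theta> \<beta> (0 + 1 / \<alpha> * x) y) * \<Psi> y \<partial>lebesgue)"
    by (rule AE_lborel_affine) (use a in simp)
  moreover have "AE x in lborel. \<Psi> (0 + 1 / \<alpha> * x) = complex_of_real (\<psi> (0 + 1 / \<alpha> * x))"
    by (rule AE_lborel_affine[OF \<Psi>]) (use a in simp)
  ultimately show ?thesis using ae
  proof eventually_elim
    case (elim x)
    have "AE y in lborel. T x (0 + \<alpha> * y) = \<Theta> (x, 0 + \<alpha> * y)"
      by (rule AE_lborel_affine[OF elim(3)]) (use a in simp)
    then have "AE y in lborel. complex_of_real (K_kernel \<Theta> \<beta> (x / \<alpha>) y) * \<Psi> y = complex_of_real (\<alpha> * (K \<alpha> x (\<alpha> * y) * \<psi> y))"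
      using \<Psi>
    proof eventually_elim
      case (elim y)
      have "\<Theta> (x / \<alpha>, y) = (1 / \<alpha>) powr \<gamma> * \<Theta> (x, \<alpha> * y)"
        using hom[of "1 / \<alpha>" x "\<alpha> * y"] a by simp
      then have "\<beta>\<^sup>2 * \<Theta> (x / \<alpha>, y) = \<alpha> * T x (\<alpha> * y)"
        using pw elim(1) by (simp add: mult.assoc[symmetric])
      then have k: "K_kernel \<Theta> \<beta> (x / \<alpha>) y = 1 / pi * (1 / (1 + (x / \<alpha> - y)\<^sup>2 + \<alpha> * T x (\<alpha> * y)))"
        unfolding K_kernel_def by simp
      have "\<alpha>\<^sup>2 + (x - \<alpha> * y)\<^sup>2 + \<alpha> ^ 3 * T x (\<alpha> * y) = \<alpha>\<^sup>2 * (1 + (x / \<alpha> - y)\<^sup>2 + \<alpha> * T x (\<alpha> * y))"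
        using a by (simp add: field_simps power2_eq_square power3_eq_cube)
      then have "\<alpha> * K \<alpha> x (\<alpha> * y) = \<alpha> * (\<alpha> / (pi * (\<alpha>\<^sup>2 * (1 + (x / \<alpha> - y)\<^sup>2 + \<alpha> * T x (\<alpha> * y)))))"
        unfolding K_def by simp
      also have "\<dots> = 1 / pi * (1 / (1 + (x / \<alpha> - y)\<^sup>2 + \<alpha> * T x (\<alpha> * y)))"
        using a by (simp add: power2_eq_square)
      finally show ?case unfolding k[symmetric] elim(2) by (simp flip: mult.assoc)
    qed
    then have "(\<integral>y. complex_of_real (K_kernel \<Theta> \<beta> (x / \<alpha>) y) * \<Psi> y \<partial>lebesgue) = (\<integral>y. complex_of_real (\<alpha> * (K \<alpha> x (\<alpha> * y) * \<psi> y)) \<partial>lborel)"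
      by (rule integral_lebesgue_cong_AE(1)) measurable
    also have "\<dots> = complex_of_real (\<integral>y. \<alpha> * (K \<alpha> x (\<alpha> * y) * \<psi> y) \<partial>lborel)" by (rule integral_complex_of_real)
    also have "(\<integral>y. \<alpha> * (K \<alpha> x (\<alpha> * y) * \<psi> y) \<partial>lborel) = (\<integral>y. K \<alpha> x y * \<psi> (y / \<alpha>) \<partial>lborel)"
      using lborel_integral_real_affine[of \<alpha> "\<lambda>y. K \<alpha> x y * \<psi> (y / \<alpha>)" 0] a by simp
    finally have "complex_of_real (m * \<psi> (x / \<alpha>)) = complex_of_real (\<integral>y. K \<alpha> x y * \<psi> (y / \<alpha>) \<partial>lborel)"
      using elim(1,2) by simp
    then have "m * \<psi> (x / \<alpha>) = (\<integral>y. K \<alpha> x y * \<psi> (y / \<alpha>) \<partial>lborel)" by (simp only: of_real_eq_iff)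
    moreover have "K_mean \<alpha> (\<lambda>x. \<alpha> powr (- 1 / 2) * \<psi> (x / \<alpha>)) x = \<alpha> powr (- 1 / 2) * (\<integral>y. K \<alpha> x y * \<psi> (y / \<alpha>) \<partial>lborel)"
      unfolding K_mean_def by (simp only: mult.left_commute[of "K \<alpha> x _"] integral_mult_right_zero)
    ultimately show ?case by (simp add: mult_ac)
  qed
qed

lemma weight_square_integrable:
  assumes k: "sq_int k" and wk: "sq_int (\<lambda>x. \<bar>x\<bar> powr \<gamma> * k x)"
  shows "sq_int (\<lambda>y. W y * k y)"
proof -
  have [measurable]: "k \<in> borel_measurable borel" using k by (rule sq_int_measurable)
  let ?D = "C * 2 powr \<gamma> * 2 powr \<gamma>"
  have D: "0 < ?D" using C_pos by simp
  have dom: "sq_int (\<lambda>x. (2 + 2 * ?D) * \<bar>k x\<bar> + 2 * ?D * (\<bar>x\<bar> powr \<gamma> * \<bar>k x\<bar>))"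
  proof (intro sq_int_add sq_int_cmult)
    show "sq_int (\<lambda>x. \<bar>k x\<bar>)" by (rule sq_int_dominated[OF k]) simp_all
    show "sq_int (\<lambda>x. \<bar>x\<bar> powr \<gamma> * \<bar>k x\<bar>)" by (rule sq_int_dominated[OF wk]) (simp_all add: abs_mult)
  qed
  have "\<bar>W y * k y\<bar> \<le> \<bar>(2 + 2 * ?D) * \<bar>k y\<bar> + 2 * ?D * (\<bar>y\<bar> powr \<gamma> * \<bar>k y\<bar>)\<bar>" for y
  proof -
    have "(1 + \<bar>y\<bar>) powr \<gamma> \<le> (2 * max 1 \<bar>y\<bar>) powr \<gamma>" using \<gamma>_pos by (intro powr_mono2) auto
    also have "\<dots> = 2 powr \<gamma> * max 1 \<bar>y\<bar> powr \<gamma>" by (rule powr_mult)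
    also have "max 1 \<bar>y\<bar> powr \<gamma> \<le> 1 + \<bar>y\<bar> powr \<gamma>" by (simp add: max_def)
    finally have "C * 2 powr \<gamma> * (1 + \<bar>y\<bar>) powr \<gamma> \<le> C * 2 powr \<gamma> * (2 powr \<gamma> * (1 + \<bar>y\<bar> powr \<gamma>))"
      using C_pos by (simp add: mult_left_mono)
    then have "W y \<le> (2 + 2 * ?D) + 2 * ?D * \<bar>y\<bar> powr \<gamma>" unfolding W_def by (simp add: algebra_simps)
    then have "W y * \<bar>k y\<bar> \<le> ((2 + 2 * ?D) + 2 * ?D * \<bar>y\<bar> powr \<gamma>) * \<bar>k y\<bar>" by (rule mult_right_mono) simp
    moreover have "0 \<le> W y" unfolding W_def using C_pos by simp
    ultimately have "\<bar>W y * k y\<bar> \<le> (2 + 2 * ?D) * \<bar>k y\<bar> + 2 * ?D * (\<bar>y\<bar> powr \<gamma> * \<bar>k y\<bar>)"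
      by (simp add: abs_mult algebra_simps)
    then show ?thesis by (rule order_trans) (rule abs_ge_self)
  qed
  then show ?thesis by (rule sq_int_dominated[OF dom, rotated]) simp
qed

text \<open>The eigenvalue equation \<open>\<bar>D\<bar>k = lam k - \<Theta> (x, x) / 2 k\<close> combines the two limits: the Poisson part of the difference
quotient tends to \<open>\<bar>D\<bar>k\<close>, the perturbation to the potential times \<open>k\<close>.\<close>

lemma eigenfunction_A_residual:
  fixes \<Theta> :: "real \<times> real \<Rightarrow> real" and \<phi> :: "real \<Rightarrow> complex" and a :: "nat \<Rightarrow> real"
  assumes T_diag_eq: "\<And>x. T x x = \<Theta> (x, x)"
    and eig: "eigenfunction (A_op \<gamma> \<Theta>) (complex_of_real lam) \<phi>"
    and k[measurable]: "k \<in> borel_measurable borel" and \<phi>: "AE x in lborel. \<phi> x = complex_of_real (k x)"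
    and a: "\<And>n. 0 < a n" "\<And>n. a n \<le> 1" "a \<longlonglongrightarrow> 0"
  shows "(\<lambda>n. sqint (\<lambda>x. (k x - K_mean (a n) k x) / a n - lam * k x)) \<longlonglongrightarrow> 0"
proof -
  obtain g where weight: "(\<lambda>x. complex_of_real (\<bar>x\<bar> powr \<gamma>) * \<phi> x) \<in> L2" and D: "abs_D \<phi> g"
    and g: "AE x in lborel. complex_of_real lam * \<phi> x = g x + complex_of_real (\<Theta> (x, x) / 2) * \<phi> x"
    using eig unfolding eigenfunction_def A_op_def AE_completion_iff by blast
  have \<phi>L: "\<phi> \<in> L2" and gL: "g \<in> L2" using D unfolding abs_D_def L2_fourier_def by auto
  have [measurable]: "(\<lambda>x. \<Theta> (x, x)) \<in> borel_measurable borel"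
    using T_diag_measurable unfolding T_diag_eq .
  define gr where "gr x = lam * k x - \<Theta> (x, x) / 2 * k x" for x
  have gr[measurable]: "gr \<in> borel_measurable borel" unfolding gr_def by measurable
  have g': "AE x in lborel. g x = complex_of_real (gr x)"
    using g \<phi> by eventually_elim (simp add: gr_def algebra_simps)
  have k2: "sq_int k" using \<phi>L L2_iff_borel(1)[OF \<phi>] by (simp add: sq_int_def)
  have g2: "sq_int gr" using gL L2_iff_borel(1)[OF g'] by (simp add: sq_int_def)
  have "AE x in lborel. complex_of_real (\<bar>x\<bar> powr \<gamma>) * \<phi> x = complex_of_real (\<bar>x\<bar> powr \<gamma> * k x)"
    using \<phi> by eventually_elim simp
  from weight L2_iff_borel(1)[OF this]
  have "integrable lborel (\<lambda>x. (cmod (complex_of_real (\<bar>x\<bar> powr \<gamma> * k x)))\<^sup>2)" by simp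
  then have "sq_int (\<lambda>x. \<bar>x\<bar> powr \<gamma> * k x)" unfolding sq_int_def by (simp add: norm_mult power_mult_distrib)
  then have W2: "sq_int (\<lambda>y. W y * k y)" by (rule weight_square_integrable[OF k2])
  have semi: "poisson_mean a k x - poisson_mean b k x = (\<integral>s. indicator {a..b} s * poisson_mean s gr x \<partial>lborel)"
    if "0 < a" "a \<le> b" for a b x
  proof -
    have "complex_of_real (poisson_mean a k x - poisson_mean b k x) = (\<integral>s. indicator {a..b} s *\<^sub>R complex_of_real (poisson_mean s gr x) \<partial>lborel)"
      using abs_D_semigroup[OF D that \<phi> _ g', of x] by (simp add: poisson_conv_of_real)
    also have "\<dots> = complex_of_real (\<integral>s. indicator {a..b} s * poisson_mean s gr x \<partial>lborel)"
      by (simp only: scaleR_conv_of_real of_real_mult[symmetric] integral_complex_of_real)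
    finally show ?thesis by (simp only: of_real_eq_iff)
  qed
  have l1: "(\<lambda>n. sqint (\<lambda>x. (k x - poisson_mean (a n) k x) / a n - gr x)) \<longlonglongrightarrow> 0"
    by (rule poisson_generator_limit[OF _ _ _ _ semi a(1,3)]) (use k2 g2 in \<open>simp_all add: sq_int_iff_sqint\<close>)
  have l2: "(\<lambda>n. sqint (\<lambda>x. (poisson_mean (a n) k x - K_mean (a n) k x) / a n - T x x / 2 * k x)) \<longlonglongrightarrow> 0"
    by (rule potential_limit[OF _ _ _ a]) (use k2 W2 in \<open>simp_all add: sq_int_iff_sqint\<close>)
  have "(\<lambda>n. 2 * sqint (\<lambda>x. (k x - poisson_mean (a n) k x) / a n - gr x)
     + 2 * sqint (\<lambda>x. (poisson_mean (a n) k x - K_mean (a n) k x) / a n - T x x / 2 * k x)) \<longlonglongrightarrow> 2 * 0 + 2 * 0"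
    by (intro tendsto_add ennreal_tendsto_cmult l1 l2) simp_all
  then have lim: "(\<lambda>n. 2 * sqint (\<lambda>x. (k x - poisson_mean (a n) k x) / a n - gr x)
     + 2 * sqint (\<lambda>x. (poisson_mean (a n) k x - K_mean (a n) k x) / a n - T x x / 2 * k x)) \<longlonglongrightarrow> 0" by simp
  show ?thesis
  proof (rule ennreal_tendsto_0_le[OF lim], rule sqint_add_le)
    show "AE x in lborel. (k x - K_mean (a n) k x) / a n - lam * k x
       = ((k x - poisson_mean (a n) k x) / a n - gr x) + ((poisson_mean (a n) k x - K_mean (a n) k x) / a n - T x x / 2 * k x)" for n
      by (intro AE_I2) (simp add: gr_def T_diag_eq diff_divide_distrib)
  qed simp_all
qed

end

section \<open>The limit theorem\<close>

theorem theorem1: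
  fixes \<gamma> :: real
    and \<Theta> :: "real \<times> real \<Rightarrow> real"
    and M :: "real \<Rightarrow> real"
    and \<Psi> :: "real \<Rightarrow> real \<Rightarrow> complex"
    and lam1 :: real
    and \<phi>1 :: "real \<Rightarrow> complex"
  assumes "\<gamma> \<ge> 1"
    and "\<Theta> \<in> borel_measurable lebesgue"
    and "\<And>p. \<Theta> p \<ge> 0"
    and "\<And>x y t. t > 0 \<Longrightarrow> \<Theta> (t * x, t * y) = t powr \<gamma> * \<Theta> (x, y)"
    and "\<exists>c C. 0 < c \<and> c \<le> C \<and> (\<forall>x y. x\<^sup>2 + y\<^sup>2 = 1 \<longrightarrow> c \<le> \<Theta> (x, y) \<and> \<Theta> (x, y) \<le> C)"
    and "\<And>x y. \<Theta> (x, y) = \<Theta> (y, x)"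
    and "\<exists>\<epsilon>>0. \<exists>C>0.
           (\<forall>t\<in>{1 - \<epsilon><..<1 + \<epsilon>}. \<bar>\<Theta> (t, 1) - \<Theta> (1, 1)\<bar> \<le> C * \<bar>t - 1\<bar>) \<and>
           (\<forall>t\<in>{-1 - \<epsilon><..<-1 + \<epsilon>}. \<bar>\<Theta> (t, -1) - \<Theta> (-1, -1)\<bar> \<le> C * \<bar>t + 1\<bar>)"
    and "\<And>\<beta>. \<beta> > 0 \<Longrightarrow> largest_eigenvalue (K_op \<Theta> \<beta>) (M \<beta>)"
    and "\<And>\<beta>. \<beta> > 0 \<Longrightarrow> eigenfunction (K_op \<Theta> \<beta>) (complex_of_real (M \<beta>)) (\<Psi> \<beta>)"
    and "\<And>\<beta>. \<beta> > 0 \<Longrightarrow> L2_norm (\<Psi> \<beta>) = 1"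
    and "\<And>\<beta>. \<beta> > 0 \<Longrightarrow> AE x in lebesgue. \<Psi> \<beta> x \<in> \<real> \<and> Re (\<Psi> \<beta> x) > 0"
    and "lowest_eigenvalue (A_op \<gamma> \<Theta>) lam1"
    and "eigenfunction (A_op \<gamma> \<Theta>) (complex_of_real lam1) \<phi>1"
    and "L2_norm \<phi>1 = 1"
    and "AE x in lebesgue. \<phi>1 x \<in> \<real> \<and> Re (\<phi>1 x) \<ge> 0"
  shows "((\<lambda>\<beta>. \<beta> powr (- 2 / (\<gamma> + 1)) * (1 - M \<beta>)) \<longlongrightarrow> lam1) (at_right 0) \<and>
    L2_tendsto
      (\<lambda>\<beta> x. let \<alpha> = \<beta> powr (2 / (\<gamma> + 1))
              in complex_of_real (\<alpha> powr (- 1 / 2)) * \<Psi> \<beta> (x / \<alpha>))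
      \<phi>1 (at_right 0)"
proof -
  obtain c C where cC: "0 < c" "c \<le> C" and circle: "\<And>x y. x\<^sup>2 + y\<^sup>2 = 1 \<Longrightarrow> c \<le> \<Theta> (x, y) \<and> \<Theta> (x, y) \<le> C"
    using assms(5) by blast
  obtain \<epsilon> L where \<epsilon>: "0 < \<epsilon>" and
      lip1: "\<And>t. t \<in> {1 - \<epsilon><..<1 + \<epsilon>} \<Longrightarrow> \<bar>\<Theta> (t, 1) - \<Theta> (1, 1)\<bar> \<le> L * \<bar>t - 1\<bar>" and
      lip2: "\<And>t. t \<in> {-1 - \<epsilon><..<-1 + \<epsilon>} \<Longrightarrow> \<bar>\<Theta> (t, -1) - \<Theta> (-1, -1)\<bar> \<le> L * \<bar>t + 1\<bar>"
    using assms(7) by blast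
  interpret symbol: admissible_symbol \<Theta> \<gamma> c C
  proof
    have iso: "isCont f s" if lip: "\<And>t. t \<in> {s - \<epsilon><..<s + \<epsilon>} \<Longrightarrow> \<bar>f t - f s\<bar> \<le> L * \<bar>t - s\<bar>" for f :: "real \<Rightarrow> real" and s
      unfolding isCont_def
    proof (rule LIM_zero_cancel, rule Lim_null_comparison)
      have "\<forall>\<^sub>F t in at s. t \<in> {s - \<epsilon><..<s + \<epsilon>}"
        using \<epsilon> by (intro eventually_at_in_open') auto
      then show "\<forall>\<^sub>F t in at s. norm (f t - f s) \<le> L * \<bar>t - s\<bar>"
        by eventually_elim (use lip in auto)
      have "((\<lambda>t. L * \<bar>t - s\<bar>) \<longlongrightarrow> L * \<bar>s - s\<bar>) (at s)" by (intro tendsto_intros)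
      then show "((\<lambda>t. L * \<bar>t - s\<bar>) \<longlongrightarrow> 0) (at s)" by simp
    qed
    show "isCont (\<lambda>t. \<Theta> (t, 1)) 1" by (rule iso) (use lip1 in auto)
    show "isCont (\<lambda>t. \<Theta> (t, -1)) (-1)" by (rule iso) (use lip2 in auto)
  qed (fact assms cC circle)+
  obtain T where hp: "homogeneous_perturbation T (c / 2) (C * 2 powr \<gamma>) \<gamma>" and T_on_diag: "\<And>x. T x x = \<Theta> (x, x)"
    and T_ae: "AE x in lborel. AE y in lborel. T x y = \<Theta> (x, y)"
    using symbol.borel_symbol by blast
  interpret homogeneous_perturbation T "c / 2" "C * 2 powr \<gamma>" \<gamma> by (rule hp)

  have \<phi>L: "\<phi>1 \<in> L2" and \<phi>m: "\<phi>1 \<in> borel_measurable lebesgue"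
    using assms(13) unfolding eigenfunction_def A_op_def abs_D_def L2_fourier_def L2_def by auto
  obtain k where k[measurable]: "k \<in> borel_measurable borel" and k0: "\<And>x. 0 \<le> k x"
    and \<phi>k: "AE x in lborel. \<phi>1 x = complex_of_real (k x)"
    by (rule real_borel_version[OF \<phi>m assms(15)[unfolded AE_completion_iff], of 0]) auto
  have k2: "sq_int k" using \<phi>L L2_iff_borel(1)[OF \<phi>k] by (simp add: sq_int_def)
  have k1: "(\<integral>x. (k x)\<^sup>2 \<partial>lborel) = 1" using assms(14) L2_iff_borel(2)[OF \<phi>k] by simp

  have "\<exists>\<psi>. \<psi> \<in> borel_measurable borel \<and> (\<forall>x. 0 < \<psi> x) \<and> (AE x in lborel. \<Psi> \<beta> x = complex_of_real (\<psi> x))" if \<beta>: "0 < \<beta>" for \<beta>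
  proof -
    have "\<Psi> \<beta> \<in> borel_measurable lebesgue"
      using assms(9)[OF \<beta>] unfolding eigenfunction_def K_op_def L2_def by auto
    then obtain \<psi> where "\<psi> \<in> borel_measurable borel" "\<And>x. 0 < \<psi> x" "AE x in lborel. \<Psi> \<beta> x = complex_of_real (\<psi> x)"
      by (rule real_borel_version[OF _ assms(11)[OF \<beta>, unfolded AE_completion_iff], of 1]) auto
    then show ?thesis by blast
  qed
  then obtain \<psi> where \<psi>m: "\<And>\<beta>. 0 < \<beta> \<Longrightarrow> \<psi> \<beta> \<in> borel_measurable borel" and \<psi>0: "\<And>\<beta> x. 0 < \<beta> \<Longrightarrow> 0 < \<psi> \<beta> x"
    and \<Psi>\<psi>: "\<And>\<beta>. 0 < \<beta> \<Longrightarrow> AE x in lborel. \<Psi> \<beta> x = complex_of_real (\<psi> \<beta> x)"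
    by metis
  define \<alpha> where "\<alpha> \<beta> = \<beta> powr (2 / (\<gamma> + 1))" for \<beta>
  have \<alpha>0: "0 < \<alpha> \<beta>" if "0 < \<beta>" for \<beta> using that unfolding \<alpha>_def by simp
  define u where "u \<beta> x = \<alpha> \<beta> powr (- 1 / 2) * \<psi> \<beta> (x / \<alpha> \<beta>)" for \<beta> x
  have u0: "0 < u \<beta> x" if "0 < \<beta>" for \<beta> x unfolding u_def using \<psi>0[OF that] \<alpha>0[OF that] by simp
  have um: "u \<beta> \<in> borel_measurable borel" if "0 < \<beta>" for \<beta>
    unfolding u_def[abs_def] using \<psi>m[OF that] by measurable
  have usq: "(u \<beta> x)\<^sup>2 = 1 / \<alpha> \<beta> * (\<psi> \<beta> (0 + 1 / \<alpha> \<beta> * x))\<^sup>2" if "0 < \<beta>" for \<beta> x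
  proof -
    have "(\<alpha> \<beta> powr (- 1 / 2))\<^sup>2 = \<alpha> \<beta> powr (- 1 / 2 + - 1 / 2)" unfolding power2_eq_square powr_add ..
    also have "\<dots> = 1 / \<alpha> \<beta>" using \<alpha>0[OF that] by (simp add: powr_minus_divide)
    finally show ?thesis unfolding u_def by (simp add: power_mult_distrib)
  qed
  have u2: "sq_int (u \<beta>)" and u1: "(\<integral>x. (u \<beta> x)\<^sup>2 \<partial>lborel) = 1" if \<beta>: "0 < \<beta>" for \<beta>
  proof -
    have \<psi>c: "(\<lambda>x. complex_of_real (\<psi> \<beta> x)) \<in> borel_measurable borel" using \<psi>m[OF \<beta>] by measurable
    have "\<Psi> \<beta> \<in> L2" using assms(9)[OF \<beta>] unfolding eigenfunction_def K_op_def by auto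
    then have i: "integrable lborel (\<lambda>x. (\<psi> \<beta> x)\<^sup>2)" using L2_iff_borel(1)[OF \<Psi>\<psi>[OF \<beta>] \<psi>c] by simp
    have v: "(\<integral>x. (\<psi> \<beta> x)\<^sup>2 \<partial>lborel) = 1"
      using assms(10)[OF \<beta>] L2_iff_borel(2)[OF \<Psi>\<psi>[OF \<beta>] \<psi>c] by simp
    have "integrable lborel (\<lambda>x. (\<psi> \<beta> (0 + 1 / \<alpha> \<beta> * x))\<^sup>2)"
      by (rule lborel_integrable_real_affine[OF i]) (use \<alpha>0[OF \<beta>] in simp)
    then show "sq_int (u \<beta>)" unfolding sq_int_def usq[OF \<beta>] using um[OF \<beta>] by simp
    have "(\<integral>x. (\<psi> \<beta> x)\<^sup>2 \<partial>lborel) = \<bar>1 / \<alpha> \<beta>\<bar> *\<^sub>R (\<integral>x. (\<psi> \<beta> (0 + 1 / \<alpha> \<beta> * x))\<^sup>2 \<partial>lborel)"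
      by (rule lborel_integral_real_affine) (use \<alpha>0[OF \<beta>] in simp)
    then show "(\<integral>x. (u \<beta> x)\<^sup>2 \<partial>lborel) = 1" unfolding usq[OF \<beta>] v using \<alpha>0[OF \<beta>] by simp
  qed
  have u_eig: "AE x in lborel. K_mean (\<alpha> \<beta>) (u \<beta>) x = M \<beta> * u \<beta> x" if \<beta>: "0 < \<beta>" for \<beta>
    unfolding u_def[abs_def]
    by (rule rescaled_eigenfunction[OF assms(4) T_ae \<beta> \<alpha>_def assms(9)[OF \<beta>] \<psi>m[OF \<beta>] \<Psi>\<psi>[OF \<beta>]])

  have seq: "(\<lambda>n. (1 - M (X n)) / \<alpha> (X n)) \<longlonglongrightarrow> lam1 \<and> (\<lambda>n. \<integral>x. (u (X n) x - k x)\<^sup>2 \<partial>lborel) \<longlonglongrightarrow> 0"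
    if X: "\<And>n. 0 < X n" "X \<longlonglongrightarrow> 0" for X :: "nat \<Rightarrow> real"
  proof -
    obtain N where N: "\<And>n. N \<le> n \<Longrightarrow> X n < 1"
      using order_tendstoD(2)[OF X(2) zero_less_one] by (auto simp: eventually_sequentially)
    \<comment> \<open>The estimates require \<open>\<alpha> \<le> 1\<close>, which holds after dropping finitely many terms.\<close>
    define Y where "Y n = X (n + N)" for n
    have Y: "0 < Y n" "Y n < 1" for n using X(1) N unfolding Y_def by auto
    have Y0: "Y \<longlonglongrightarrow> 0" unfolding Y_def by (rule LIMSEQ_ignore_initial_segment[OF X(2)])
    have a1: "\<alpha> (Y n) \<le> 1" for n
      unfolding \<alpha>_def using Y[of n] assms(1) by (intro powr_le1) auto
    have "(\<lambda>n. Y n powr (2 / (\<gamma> + 1))) \<longlonglongrightarrow> 0"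
      by (rule tendsto_zero_powrI[OF Y0 tendsto_const]) (use Y assms(1) in \<open>auto intro: always_eventually less_imp_le\<close>)
    then have alim: "(\<lambda>n. \<alpha> (Y n)) \<longlonglongrightarrow> 0" unfolding \<alpha>_def .
    interpret ground_state_sequence T "c / 2" "C * 2 powr \<gamma>" \<gamma> k lam1 "\<lambda>n. \<alpha> (Y n)" "\<lambda>n. u (Y n)" "\<lambda>n. M (Y n)"
    proof
      show "(\<lambda>n. sqint (\<lambda>x. (k x - K_mean (\<alpha> (Y n)) k x) / \<alpha> (Y n) - lam1 * k x)) \<longlonglongrightarrow> 0"
        by (rule eigenfunction_A_residual[OF T_on_diag assms(13) k \<phi>k]) (use \<alpha>0 Y a1 alim in auto)
    qed (use \<alpha>0 Y a1 alim k2 k0 k1 u2 u0 u1 u_eig in auto)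
    have "(\<lambda>n. (1 - M (Y n)) / \<alpha> (Y n)) \<longlonglongrightarrow> lam1"
      using gap_tendsto unfolding gap_def[abs_def] .
    moreover note eigenfunction_tendsto
    ultimately show ?thesis
      unfolding Y_def by (auto intro: LIMSEQ_offset[of _ N])
  qed
  have lim: "((\<lambda>\<beta>. (1 - M \<beta>) / \<alpha> \<beta>) \<longlongrightarrow> lam1) (at_right 0)" "((\<lambda>\<beta>. \<integral>x. (u \<beta> x - k x)\<^sup>2 \<partial>lborel) \<longlongrightarrow> 0) (at_right 0)"
    unfolding tendsto_at_iff_sequentially comp_def using seq by auto
  have "((\<lambda>\<beta>. \<beta> powr (- 2 / (\<gamma> + 1)) * (1 - M \<beta>)) \<longlongrightarrow> lam1) (at_right 0)"
  proof (rule Lim_transform_eventually[OF lim(1)])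
    have "(1 - M \<beta>) / \<alpha> \<beta> = \<beta> powr (- 2 / (\<gamma> + 1)) * (1 - M \<beta>)" for \<beta>
      unfolding \<alpha>_def by (simp add: powr_minus_divide flip: minus_divide_left)
    then show "\<forall>\<^sub>F \<beta> in at_right 0. (1 - M \<beta>) / \<alpha> \<beta> = \<beta> powr (- 2 / (\<gamma> + 1)) * (1 - M \<beta>)" by simp
  qed
  moreover have "L2_tendsto (\<lambda>\<beta> x. let \<alpha> = \<beta> powr (2 / (\<gamma> + 1)) in complex_of_real (\<alpha> powr (- 1 / 2)) * \<Psi> \<beta> (x / \<alpha>)) \<phi>1 (at_right 0)"
  proof -
    let ?f = "\<lambda>\<beta> x. complex_of_real (\<alpha> \<beta> powr (- 1 / 2)) * \<Psi> \<beta> (x / \<alpha> \<beta>)"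
    have fu: "AE x in lborel. ?f \<beta> x = complex_of_real (u \<beta> x)" if \<beta>: "0 < \<beta>" for \<beta>
    proof -
      have "AE x in lborel. \<Psi> \<beta> (0 + 1 / \<alpha> \<beta> * x) = complex_of_real (\<psi> \<beta> (0 + 1 / \<alpha> \<beta> * x))"
        by (rule AE_lborel_affine[OF \<Psi>\<psi>[OF \<beta>]]) (use \<alpha>0[OF \<beta>] in simp)
      then show ?thesis by eventually_elim (simp add: u_def)
    qed
    have pos: "\<forall>\<^sub>F \<beta> in at_right (0::real). 0 < \<beta>" by (simp add: eventually_at_right_less)
    have fL: "?f \<beta> \<in> L2" if \<beta>: "0 < \<beta>" for \<beta>
    proof -
      have "(\<lambda>x. complex_of_real (u \<beta> x)) \<in> borel_measurable borel" using um[OF \<beta>] by measurable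
      from L2_iff_borel(1)[OF fu[OF \<beta>] this] show ?thesis using sq_int_square[OF u2[OF \<beta>]] by simp
    qed
    have fn: "L2_norm (\<lambda>x. ?f \<beta> x - \<phi>1 x) = sqrt (\<integral>x. (u \<beta> x - k x)\<^sup>2 \<partial>lborel)" if \<beta>: "0 < \<beta>" for \<beta>
    proof -
      have ae: "AE x in lborel. ?f \<beta> x - \<phi>1 x = complex_of_real (u \<beta> x - k x)"
        using fu[OF \<beta>] \<phi>k by eventually_elim simp
      have "(\<lambda>x. complex_of_real (u \<beta> x - k x)) \<in> borel_measurable borel" using um[OF \<beta>] by measurable
      from L2_iff_borel(2)[OF ae this] show ?thesis by (simp only: norm_of_real power2_abs)
    qed
    have "((\<lambda>\<beta>. L2_norm (\<lambda>x. ?f \<beta> x - \<phi>1 x)) \<longlongrightarrow> 0) (at_right 0)"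
    proof (rule Lim_transform_eventually)
      show "((\<lambda>\<beta>. sqrt (\<integral>x. (u \<beta> x - k x)\<^sup>2 \<partial>lborel)) \<longlongrightarrow> 0) (at_right 0)"
        using tendsto_real_sqrt[OF lim(2)] by simp
      show "\<forall>\<^sub>F \<beta> in at_right 0. sqrt (\<integral>x. (u \<beta> x - k x)\<^sup>2 \<partial>lborel) = L2_norm (\<lambda>x. ?f \<beta> x - \<phi>1 x)"
        using pos by eventually_elim (rule fn[symmetric])
    qed
    moreover have "\<forall>\<^sub>F \<beta> in at_right 0. ?f \<beta> \<in> L2" using pos by eventually_elim (rule fL)
    ultimately show ?thesis unfolding L2_tendsto_def Let_def \<alpha>_def[symmetric] using \<phi>L by blast
  qed
  ultimately show ?thesis by blast
qed

end
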